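(* Let $V\in C^2(\mathbb{R};\mathbb{R})$, $\theta>0$ and $\sigma:\mathbb{R}\to\mathbb{R}$ satisfy: (a) there is $L>0$ with $-(x-y)(V'(x)-V'(y))\le L|x-y|^2$ for all $x,y\in\mathbb{R}$; (b) there are $L>0$, $\kappa\ge1$ with $|V'(x)|\le L(1+|x|^\kappa)$ for all $x\in\mathbb{R}$; (c) there are $\alpha,\beta,\delta>0$ with $-(x-y)(V'(x)-V'(y))\le-\alpha|x-y|^{2+\delta}+\beta$ for all $x,y\in\mathbb{R}$; (d) $\sigma$ is Lipschitz and there are $0<\underline\sigma<\overline\sigma$ with $\underline\sigma^2\le\sigma^2(x)\le\overline\sigma^2$ for all $x$. If the function $V':\mathbb{R}\to\mathbb{R}$ has zero-crossing number $Z(V')=2n-1$, then the equation $$\mathrm dX_t=-V'(X_t)\,\mathrm dt-\theta\big(X_t-\mathbf E[X_t]\big)\,\mathrm dt+\sigma(X_t)\,\mathrm dB_t$$ has at most $2n-1$ invariant measures.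
   Context: Zero-crossing number: for continuous $f:\mathbb{R}\to\mathbb{R}$, $Z(f)$ is the maximal integer $N$ such that there are $x_1<x_2<\cdots<x_{N+1}$ with $f(x_i)f(x_{i+1})<0$ for all $i=1,\dots,N$. $\mathcal P_2(\mathbb{R})$ is the set of Borel probability measures on $\mathbb{R}$ with finite second moment. $B_t$ is a standard Brownian motion. The equation has a unique solution $X_t^\xi$ for each square-integrable initial datum $\xi$ at time $0$ (independent of the Brownian increments after time $0$), and $P_t^*\mu:=\mathcal L(X_t^{\xi})$ where $\mathcal L(\xi)=\mu$ ($\mathcal L$ denotes law). A measure $\nu\in\mathcal P_2(\mathbb{R})$ is invariant if $P_t^*\nu=\nu$ for all $t\ge0$. *)

theory Defs
  imports "HOL-Probability.Probability"
begin

section \<open>Zero-crossing number\<close>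

definition has_crossings :: "(real \<Rightarrow> real) \<Rightarrow> nat \<Rightarrow> bool" where
  "has_crossings f N \<longleftrightarrow>
     (\<exists>x :: nat \<Rightarrow> real. \<forall>i\<in>{1..N}. x i < x (i + 1) \<and> f (x i) * f (x (i + 1)) < 0)"

text \<open>The value is \<open>\<infinity>\<close> exactly when there are arbitrarily many crossings, in which case no maximal
  \<open>N\<close> exists.  The set always contains \<open>0\<close>.\<close>

definition zero_crossing_number :: "(real \<Rightarrow> real) \<Rightarrow> enat" where
  "zero_crossing_number f = (SUP N\<in>{N. has_crossings f N}. enat N)"


section \<open>Brownian motion on a filtered probability space\<close>

text \<open>Time is \<open>[0, \<infinity>)\<close>. The filtration is indexed by \<^typ>\<open>real\<close> as in \<^theory>\<open>HOL-Probability.Stopping_Time\<close>,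
  but its values at negative times are never used.\<close>

locale brownian_motion = prob_space M + filtration "space M" F
  for M :: "'a measure" and F :: "real \<Rightarrow> 'a measure" +
  fixes B :: "real \<Rightarrow> 'a \<Rightarrow> real"
  assumes subalgebra_F: "\<And>t. 0 \<le> t \<Longrightarrow> subalgebra M (F t)"
    and adapted: "\<And>t. 0 \<le> t \<Longrightarrow> B t \<in> borel_measurable (F t)"
    and start_zero: "AE \<omega> in M. B 0 \<omega> = 0"
    and continuous_paths: "AE \<omega> in M. continuous_on {0..} (\<lambda>t. B t \<omega>)"
    and gaussian_increments: "\<And>s t. 0 \<le> s \<Longrightarrow> s < t \<Longrightarrow>
      distributed M lborel (\<lambda>\<omega>. B t \<omega> - B s \<omega>) (normal_density 0 (sqrt (t - s)))"
    and independent_increments: "\<And>s t. 0 \<le> s \<Longrightarrow> s < t \<Longrightarrow>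
      indep_set (sets (F s)) {(\<lambda>\<omega>. B t \<omega> - B s \<omega>) -` A \<inter> space M | A. A \<in> sets borel}"


section \<open>Ito integral\<close>

text \<open>A simple integrand on \<open>[0, T]\<close> is given by a partition \<open>0 = p 0 < p 1 < ... < p k = T\<close> and bounded
  \<open>F (p i)\<close>-measurable values \<open>\<phi> i\<close> on \<open>(p i, p (i + 1)]\<close>.\<close>

definition simple_integrand ::
  "'a measure \<Rightarrow> (real \<Rightarrow> 'a measure) \<Rightarrow> real \<Rightarrow> nat \<Rightarrow> (nat \<Rightarrow> real) \<Rightarrow> (nat \<Rightarrow> 'a \<Rightarrow> real) \<Rightarrow> bool" where
  "simple_integrand M F T k p \<phi> \<longleftrightarrow>
     p 0 = 0 \<and> p k = T \<and> (\<forall>i<k. p i < p (i + 1)) \<and>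
     (\<forall>i<k. \<phi> i \<in> borel_measurable (F (p i)) \<and> (\<exists>C. \<forall>\<omega>\<in>space M. \<bar>\<phi> i \<omega>\<bar> \<le> C))"

definition simple_process ::
  "nat \<Rightarrow> (nat \<Rightarrow> real) \<Rightarrow> (nat \<Rightarrow> 'a \<Rightarrow> real) \<Rightarrow> real \<Rightarrow> 'a \<Rightarrow> real" where
  "simple_process k p \<phi> s \<omega> = (\<Sum>i<k. \<phi> i \<omega> * indicator {p i<..p (i + 1)} s)"

definition simple_ito_integral ::
  "(real \<Rightarrow> 'a \<Rightarrow> real) \<Rightarrow> nat \<Rightarrow> (nat \<Rightarrow> real) \<Rightarrow> (nat \<Rightarrow> 'a \<Rightarrow> real) \<Rightarrow> 'a \<Rightarrow> real" where
  "simple_ito_integral B k p \<phi> \<omega> = (\<Sum>i<k. \<phi> i \<omega> * (B (p (i + 1)) \<omega> - B (p i) \<omega>))"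

definition progressive :: "(real \<Rightarrow> 'a measure) \<Rightarrow> real \<Rightarrow> (real \<Rightarrow> 'a \<Rightarrow> real) \<Rightarrow> bool" where
  "progressive F T H \<longleftrightarrow>
     (\<forall>u\<in>{0..T}. (\<lambda>(s, \<omega>). H s \<omega>) \<in> borel_measurable (restrict_space borel {0..u} \<Otimes>\<^sub>M F u))"

text \<open>\<open>I\<close> is a version of \<open>\<integral>\<^sub>0\<^sup>T H dB\<close>: the \<open>L\<^sup>2\<close> limit of the integrals of simple integrands that
  approximate \<open>H\<close> in \<open>L\<^sup>2([0, T] \<times> M)\<close>.  By the isometry \<open>I\<close> is determined up to null sets.\<close>

definition has_ito_integral ::
  "'a measure \<Rightarrow> (real \<Rightarrow> 'a measure) \<Rightarrow> (real \<Rightarrow> 'a \<Rightarrow> real) \<Rightarrow> real \<Rightarrow> (real \<Rightarrow> 'a \<Rightarrow> real) \<Rightarrow> ('a \<Rightarrow> real) \<Rightarrow> bool" where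
  "has_ito_integral M F B T H I \<longleftrightarrow>
     progressive F T H \<and> I \<in> borel_measurable M \<and>
     (\<exists>k p \<phi>. (\<forall>n. simple_integrand M F T (k n) (p n) (\<phi> n)) \<and>
        (\<lambda>n. \<integral>\<^sup>+\<omega>. (\<integral>\<^sup>+s\<in>{0..T}. ennreal ((simple_process (k n) (p n) (\<phi> n) s \<omega> - H s \<omega>)\<^sup>2) \<partial>lborel) \<partial>M)
          \<longlonglongrightarrow> 0 \<and>
        (\<lambda>n. \<integral>\<^sup>+\<omega>. ennreal ((simple_ito_integral B (k n) (p n) (\<phi> n) \<omega> - I \<omega>)\<^sup>2) \<partial>M)
          \<longlonglongrightarrow> 0)"


section \<open>The McKean-Vlasov equation and its invariant measures\<close>

text \<open>\<open>X\<close> solves \<open>dX = - V'(X) dt - \<theta> (X - E X) dt + \<sigma>(X) dB\<close> with initial datum \<open>\<xi>\<close>; since \<open>\<xi>\<close> is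
  \<open>F 0\<close>-measurable, it is independent of the Brownian increments.  Integrability of \<open>X t\<close> and
  of \<open>s \<mapsto> E (X s)\<close> is required because Isabelle integrals of non-integrable functions are \<open>0\<close>.\<close>

definition mv_solution ::
  "'a measure \<Rightarrow> (real \<Rightarrow> 'a measure) \<Rightarrow> (real \<Rightarrow> 'a \<Rightarrow> real) \<Rightarrow> (real \<Rightarrow> real) \<Rightarrow> real \<Rightarrow> (real \<Rightarrow> real) \<Rightarrow>
    ('a \<Rightarrow> real) \<Rightarrow> (real \<Rightarrow> 'a \<Rightarrow> real) \<Rightarrow> bool" where
  "mv_solution M F B V \<theta> \<sigma> \<xi> X \<longleftrightarrow>
     \<xi> \<in> borel_measurable (F 0) \<and>
     (\<forall>t\<ge>0. X t \<in> borel_measurable (F t)) \<and>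
     (AE \<omega> in M. continuous_on {0..} (\<lambda>t. X t \<omega>)) \<and>
     (\<forall>t\<ge>0. integrable M (X t)) \<and>
     (\<forall>t\<ge>0. set_integrable lborel {0..t} (\<lambda>s. \<integral>\<omega>. X s \<omega> \<partial>M)) \<and>
     (\<forall>t\<ge>0. \<exists>I. has_ito_integral M F B t (\<lambda>s \<omega>. \<sigma> (X s \<omega>)) I \<and>
        (AE \<omega> in M. X t \<omega> = \<xi> \<omega>
            - (LINT s:{0..t}|lborel. deriv V (X s \<omega>))
            - \<theta> * (LINT s:{0..t}|lborel. X s \<omega> - (\<integral>\<omega>'. X s \<omega>' \<partial>M))
            + I \<omega>))"

definition P2 :: "real measure set" where
  "P2 = {\<mu>. prob_space \<mu> \<and> sets \<mu> = sets borel \<and> integrable \<mu> (\<lambda>x. x\<^sup>2)}"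

definition mv_solution_from ::
  "'a measure \<Rightarrow> (real \<Rightarrow> 'a measure) \<Rightarrow> (real \<Rightarrow> 'a \<Rightarrow> real) \<Rightarrow> (real \<Rightarrow> real) \<Rightarrow> real \<Rightarrow> (real \<Rightarrow> real) \<Rightarrow>
    real measure \<Rightarrow> (real \<Rightarrow> 'a \<Rightarrow> real) \<Rightarrow> bool" where
  "mv_solution_from M F B V \<theta> \<sigma> \<mu> X \<longleftrightarrow>
     (\<exists>\<xi>. distr M borel \<xi> = \<mu> \<and> mv_solution M F B V \<theta> \<sigma> \<xi> X)"

text \<open>\<open>P\<^sub>t\<^sup>* \<mu>\<close>, the law at time \<open>t\<close> of a solution whose initial law is \<open>\<mu>\<close>.  Under the
  assumptions on the coefficients this does not depend on the chosen initial datum and solution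
  (uniqueness); the choice is made once for all times.\<close>

definition P_star ::
  "'a measure \<Rightarrow> (real \<Rightarrow> 'a measure) \<Rightarrow> (real \<Rightarrow> 'a \<Rightarrow> real) \<Rightarrow> (real \<Rightarrow> real) \<Rightarrow> real \<Rightarrow> (real \<Rightarrow> real) \<Rightarrow>
    real \<Rightarrow> real measure \<Rightarrow> real measure" where
  "P_star M F B V \<theta> \<sigma> t \<mu> = distr M borel ((SOME X. mv_solution_from M F B V \<theta> \<sigma> \<mu> X) t)"

text \<open>The existence clause says that \<open>P\<^sub>t\<^sup>* \<nu>\<close> is defined.  It holds for every \<open>\<nu> \<in> P2\<close> by
  well-posedness of the equation as soon as the underlying space satisfies the usual conditions
  and \<open>F 0\<close> is rich enough to carry a random variable of law \<open>\<nu>\<close>.\<close>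

definition invariant_measure ::
  "'a measure \<Rightarrow> (real \<Rightarrow> 'a measure) \<Rightarrow> (real \<Rightarrow> 'a \<Rightarrow> real) \<Rightarrow> (real \<Rightarrow> real) \<Rightarrow> real \<Rightarrow> (real \<Rightarrow> real) \<Rightarrow>
    real measure \<Rightarrow> bool" where
  "invariant_measure M F B V \<theta> \<sigma> \<nu> \<longleftrightarrow>
     \<nu> \<in> P2 \<and> (\<exists>X. mv_solution_from M F B V \<theta> \<sigma> \<nu> X) \<and>
     (\<forall>t\<ge>0. P_star M F B V \<theta> \<sigma> t \<nu> = \<nu>)"

end

theory Submission
  imports Defs
begin

text \<open>
  An invariant measure \<open>\<nu>\<close> with mean \<open>m\<close> is the law of a stationary solution, whose drift
  \<open>b x = - V' x - \<theta> (x - m)\<close> does not depend on time.  Ito's formula in expectation shows that \<open>\<nu>\<close>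
  annihilates the generator \<open>\<phi> \<mapsto> b \<phi>' + \<sigma>\<^sup>2 \<phi>'' / 2\<close>.  In dimension one this forces \<open>\<nu>\<close> to have a density
  proportional to \<open>exp Q / \<sigma>\<^sup>2\<close> with \<open>Q' = 2 b / \<sigma>\<^sup>2\<close>, so \<open>\<nu>\<close> is determined by \<open>m\<close>.  Write
  \<open>Q = Q\<^sub>0 + 2 \<theta> m h\<close> with \<open>h' = 1 / \<sigma>\<^sup>2\<close> and \<open>Q\<^sub>0\<close> independent of \<open>m\<close>.  Since \<open>exp Q\<close> vanishes at infinity, its
  derivative has integral zero, and the mean of the density is \<open>m\<close> only if
  \<open>\<integral> V' exp Q\<^sub>0 / \<sigma>\<^sup>2 \<cdot> exp (2 \<theta> m h) = 0\<close>.  The left side is a Laplace transform in \<open>m\<close> of a function with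
  the sign changes of \<open>V'\<close>, and by Descartes' rule of signs it has at most \<open>Z(V')\<close> zeros.
\<close>

section \<open>Increments of Brownian motion\<close>

text \<open>The Ito integral is only given at each fixed time, as an L2 limit of simple integrals,
  so the generator identity has to be derived by hand from sums over grids. The obstacle is
  integrability: \<open>\<nu>\<close> is only known to have a second moment, while \<open>V'\<close>
  may grow like a large power, so the drift along the solution may fail to be integrable. The
  argument is arranged so that the drift is handled path by path, and expectations are only taken of
  bounded functions and of martingale sums bounded in L2. The class of test functions is dictated by
  \<open>\<sigma>\<close>, which is merely Lipschitz: \<open>f'\<close> has compact support and
  \<open>f''\<close> is Lipschitz, so that Taylor remainders are controlled without a third
  derivative and \<open>f' b\<close> stays bounded. Total mass 1 fixes the constant of
  proportionality in the density, hence the parameter \<open>2 \<theta> m\<close> identifies the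
  measure, and counting zeros of the transform counts measures. The boundary terms of the transform
  identity vanish because the confinement \<open>- \<theta> x\<close> together with dissipativity
  makes \<open>Q\<close> decay at least linearly.\<close>

context brownian_motion
begin

lemma F_measurable_imp:
  assumes "0 \<le> t" "f \<in> borel_measurable (F t)"
  shows "f \<in> borel_measurable M"
  using measurable_from_subalg[OF subalgebra_F[OF assms(1)] assms(2)] .

lemma F_measurable_mono:
  assumes "0 \<le> s" "s \<le> t" "f \<in> borel_measurable (F s)"
  shows "f \<in> borel_measurable (F t)"
proof -
  have "subalgebra (F t) (F s)"
    using sets_F_mono[OF assms(2)] by (simp add: subalgebra_def space_F)
  then show ?thesis
    using assms(3) by (rule measurable_from_subalg)
qed

lemma B_measurable [measurable]: "0 \<le> t \<Longrightarrow> B t \<in> borel_measurable M"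
  by (rule F_measurable_imp[OF _ adapted])

lemma increment_moment:
  assumes "0 \<le> s" "s < t"
  shows "integrable M (\<lambda>\<omega>. (B t \<omega> - B s \<omega>) ^ k)"
    and "expectation (\<lambda>\<omega>. (B t \<omega> - B s \<omega>) ^ k)
      = (\<integral>x. normal_density 0 (sqrt (t - s)) x * x ^ k \<partial>lborel)"
proof -
  note D = gaussian_increments[OF assms]
  show "integrable M (\<lambda>\<omega>. (B t \<omega> - B s \<omega>) ^ k)"
    using distributed_integrable[OF D, of "\<lambda>x. x ^ k"] integrable_normal_moment[of "sqrt (t - s)" 0 k] assms
    by simp
  show "expectation (\<lambda>\<omega>. (B t \<omega> - B s \<omega>) ^ k)
      = (\<integral>x. normal_density 0 (sqrt (t - s)) x * x ^ k \<partial>lborel)"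
    using distributed_integral[OF D, of "\<lambda>x. x ^ k"] by simp
qed

lemma integrable_increment_power:
  assumes "0 \<le> s" "s \<le> t"
  shows "integrable M (\<lambda>\<omega>. (B t \<omega> - B s \<omega>) ^ k)"
  using increment_moment(1)[of s t k] assms by (cases "s = t") (auto simp: power_0_left)

lemma integrable_increment:
  assumes "0 \<le> s" "s \<le> t"
  shows "integrable M (\<lambda>\<omega>. B t \<omega> - B s \<omega>)"
  using integrable_increment_power[OF assms, of 1] by (simp only: power_one_right)

lemma increment_F_measurable:
  assumes "0 \<le> s" "s \<le> t" "t \<le> u"
  shows "(\<lambda>\<omega>. B t \<omega> - B s \<omega>) \<in> borel_measurable (F u)"
  using F_measurable_mono[of t u "B t"] F_measurable_mono[of s u "B s"] adapted assms
  by (intro borel_measurable_diff) auto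

lemma increment_mean:
  assumes "0 \<le> s" "s \<le> t"
  shows "expectation (\<lambda>\<omega>. B t \<omega> - B s \<omega>) = 0"
  using increment_moment(2)[of s t 1] integral_normal_moment_odd[of "sqrt (t - s)" 0 0] assms
  by (cases "s = t") auto

lemma increment_variance:
  assumes "0 \<le> s" "s \<le> t"
  shows "expectation (\<lambda>\<omega>. (B t \<omega> - B s \<omega>)\<^sup>2) = t - s"
  using increment_moment(2)[of s t 2] integral_normal_moment_even[of "sqrt (t - s)" 0 1] assms
  by (cases "s = t") auto

text \<open>The fourth moment enters twice: through the variance of the centred squared increment,
  and through the cubic Taylor remainder, which is interpolated between second and fourth
  moments.\<close>

lemma increment_fourth_moment:
  assumes "0 \<le> s" "s \<le> t"
  shows "expectation (\<lambda>\<omega>. (B t \<omega> - B s \<omega>) ^ 4) = 3 * (t - s)\<^sup>2"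
  using increment_moment(2)[of s t 4] integral_normal_moment_even[of "sqrt (t - s)" 0 2] assms
  by (cases "s = t") (auto simp: fact_numeral power2_eq_square field_simps)

text \<open>The locale gives independence for events. Preimages under \<open>Y\<close> and under
  \<open>g\<close> of the increment form intersection-stable families, so independence passes to the
  generated sigma-algebras and hence to the random variables. A general \<open>g\<close> covers
  increments, their squares and centred squares alike.\<close>

lemma integral_mult_increment:
  fixes g :: "real \<Rightarrow> real"
  assumes st: "0 \<le> s" "s \<le> t" and Y: "Y \<in> borel_measurable (F s)" "integrable M Y"
    and g: "g \<in> borel_measurable borel" "integrable M (\<lambda>\<omega>. g (B t \<omega> - B s \<omega>))"
  shows "integrable M (\<lambda>\<omega>. Y \<omega> * g (B t \<omega> - B s \<omega>))"
    and "expectation (\<lambda>\<omega>. Y \<omega> * g (B t \<omega> - B s \<omega>))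
       = expectation Y * expectation (\<lambda>\<omega>. g (B t \<omega> - B s \<omega>))"
proof -
  have "integrable M (\<lambda>\<omega>. Y \<omega> * g (B t \<omega> - B s \<omega>)) \<and>
    expectation (\<lambda>\<omega>. Y \<omega> * g (B t \<omega> - B s \<omega>))
       = expectation Y * expectation (\<lambda>\<omega>. g (B t \<omega> - B s \<omega>))"
  proof (cases "s = t")
    case True
    then show ?thesis using Y by (simp add: prob_space)
  next
    case False
    with st have "s < t" by simp
    let ?D = "\<lambda>\<omega>. B t \<omega> - B s \<omega>"
    have D: "?D \<in> borel_measurable M"
      using st by (intro borel_measurable_diff B_measurable) auto
    have "indep_set (sigma_sets (space M) {Y -` A \<inter> space M |A. A \<in> sets borel})
       (sigma_sets (space M) {(\<lambda>\<omega>. g (?D \<omega>)) -` A \<inter> space M |A. A \<in> sets borel})"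
    proof (rule indep_set_sigma_sets)
      have "A \<in> sets borel \<Longrightarrow> Y -` A \<inter> space M \<in> sets (F s)" for A
        using measurable_sets[OF Y(1)] by (simp add: space_F)
      moreover have "A \<in> sets borel \<Longrightarrow> \<exists>A'\<in>sets borel.
          (\<lambda>\<omega>. g (?D \<omega>)) -` A \<inter> space M = ?D -` A' \<inter> space M" for A
        using measurable_sets[OF g(1), of A] by (intro bexI[of _ "g -` A"]) auto
      ultimately show "indep_set {Y -` A \<inter> space M |A. A \<in> sets borel}
          {(\<lambda>\<omega>. g (?D \<omega>)) -` A \<inter> space M |A. A \<in> sets borel}"
        using independent_increments[OF st(1) \<open>s < t\<close>] unfolding indep_sets2_eq
        by (smt (verit) mem_Collect_eq subset_iff)
    next
      show "Int_stable {Y -` A \<inter> space M |A. A \<in> sets borel}"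
        by (auto simp: Int_stable_def) (rule_tac x="A \<inter> Aa" in exI, auto)
      show "Int_stable {(\<lambda>\<omega>. g (?D \<omega>)) -` A \<inter> space M |A. A \<in> sets borel}"
        by (auto simp: Int_stable_def) (rule_tac x="A \<inter> Aa" in exI, auto)
    qed
    then have "indep_var borel Y borel (\<lambda>\<omega>. g (?D \<omega>))"
      unfolding indep_var_eq using F_measurable_imp[OF st(1) Y(1)] g(1) D by simp
    from indep_var_lebesgue_integral[OF this Y(2) g(2)] indep_var_integrable[OF this Y(2) g(2)]
    show ?thesis by simp
  qed
  then show "integrable M (\<lambda>\<omega>. Y \<omega> * g (B t \<omega> - B s \<omega>))"
    and "expectation (\<lambda>\<omega>. Y \<omega> * g (B t \<omega> - B s \<omega>))
       = expectation Y * expectation (\<lambda>\<omega>. g (B t \<omega> - B s \<omega>))" by auto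
qed

lemma integral_mult_increment_zero:
  assumes st: "0 \<le> s" "s \<le> t" and Y: "Y \<in> borel_measurable (F s)" "integrable M Y"
  shows "integrable M (\<lambda>\<omega>. Y \<omega> * (B t \<omega> - B s \<omega>))"
    and "expectation (\<lambda>\<omega>. Y \<omega> * (B t \<omega> - B s \<omega>)) = 0"
  using integral_mult_increment[OF st Y, of "\<lambda>x. x"] integrable_increment_power[OF st, of 1]
    increment_mean[OF st] by auto

lemma integral_mult_increment_square:
  assumes st: "0 \<le> s" "s \<le> t" and Y: "Y \<in> borel_measurable (F s)" "integrable M Y"
  shows "integrable M (\<lambda>\<omega>. Y \<omega> * (B t \<omega> - B s \<omega>)\<^sup>2)"
    and "expectation (\<lambda>\<omega>. Y \<omega> * (B t \<omega> - B s \<omega>)\<^sup>2) = expectation Y * (t - s)"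
  using integral_mult_increment[OF st Y, of "\<lambda>x. x\<^sup>2"] integrable_increment_power[OF st, of 2]
    increment_variance[OF st] by auto

text \<open>The factor \<open>max 0 (min b d - max a c)\<close> is the length of the overlap of the
  two intervals, zero if they are disjoint. This is the covariance behind the Ito isometry, kept in
  bilinear form so that overlapping steps need no common partition.\<close>

lemma increment_product_product_ordered:
  assumes ab: "0 \<le> a" "a \<le> b" and cd: "a \<le> c" "c \<le> d"
    and \<phi>: "\<phi> \<in> borel_measurable (F a)" "\<And>\<omega>. \<omega> \<in> space M \<Longrightarrow> \<bar>\<phi> \<omega>\<bar> \<le> C"
    and \<psi>: "\<psi> \<in> borel_measurable (F c)" "\<And>\<omega>. \<omega> \<in> space M \<Longrightarrow> \<bar>\<psi> \<omega>\<bar> \<le> C'"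
  shows "integrable M (\<lambda>\<omega>. (\<phi> \<omega> * (B b \<omega> - B a \<omega>)) * (\<psi> \<omega> * (B d \<omega> - B c \<omega>))) \<and>
    expectation (\<lambda>\<omega>. (\<phi> \<omega> * (B b \<omega> - B a \<omega>)) * (\<psi> \<omega> * (B d \<omega> - B c \<omega>)))
      = expectation (\<lambda>\<omega>. \<phi> \<omega> * \<psi> \<omega>) * max 0 (min b d - max a c)"
proof -
  have ac: "a \<le> c" and cd: "0 \<le> c" "c \<le> d" using ab cd by auto
  let ?p = "\<lambda>\<omega>. \<phi> \<omega> * \<psi> \<omega>"
  have \<phi>c: "\<phi> \<in> borel_measurable (F c)"
    using F_measurable_mono[OF ab(1) ac \<phi>(1)] .
  have p: "?p \<in> borel_measurable (F c)" using \<phi>c \<psi>(1) by simp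
  have pb: "\<bar>?p \<omega>\<bar> \<le> C * C'" if "\<omega> \<in> space M" for \<omega>
    unfolding abs_mult using \<phi>(2)[OF that] \<psi>(2)[OF that] by (intro mult_mono) linarith+
  have pM: "?p \<in> borel_measurable M" by (rule F_measurable_imp[OF cd(1) p])
  have pi: "integrable M (\<lambda>\<omega>. ?p \<omega> * Y \<omega>)" if "integrable M Y" for Y
  proof (rule Bochner_Integration.integrable_bound[of _ "\<lambda>\<omega>. (C * C') * Y \<omega>"])
    show "AE \<omega> in M. norm (?p \<omega> * Y \<omega>) \<le> norm (C * C' * Y \<omega>)"
    proof (rule AE_I2)
      fix \<omega> assume "\<omega> \<in> space M"
      from pb[OF this] have "\<bar>?p \<omega>\<bar> * \<bar>Y \<omega>\<bar> \<le> \<bar>C * C'\<bar> * \<bar>Y \<omega>\<bar>"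
        by (intro mult_right_mono) auto
      then show "norm (?p \<omega> * Y \<omega>) \<le> norm (C * C' * Y \<omega>)" by (simp add: abs_mult)
    qed
  qed (use that pM in auto)
  note inc = integrable_increment
  show ?thesis
  proof (cases "b \<le> c")
    case True
    let ?Y = "\<lambda>\<omega>. ?p \<omega> * (B b \<omega> - B a \<omega>)"
    have Y: "?Y \<in> borel_measurable (F c)"
      by (intro borel_measurable_times p increment_F_measurable ab True)
    have "integrable M ?Y" by (rule pi[OF inc]) (use ab in auto)
    from integral_mult_increment_zero[OF cd Y this]
    have "integrable M (\<lambda>\<omega>. (\<phi> \<omega> * (B b \<omega> - B a \<omega>)) * (\<psi> \<omega> * (B d \<omega> - B c \<omega>)))"
      "expectation (\<lambda>\<omega>. (\<phi> \<omega> * (B b \<omega> - B a \<omega>)) * (\<psi> \<omega> * (B d \<omega> - B c \<omega>))) = 0"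
      by (simp_all add: mult_ac)
    moreover have "max 0 (min b d - max a c) = 0" using True by (auto simp: max_def min_def)
    ultimately show ?thesis by simp
  next
    case False
    then have cb: "c \<le> b" by simp
    let ?Y = "\<lambda>\<omega>. ?p \<omega> * (B c \<omega> - B a \<omega>)"
    have Y: "?Y \<in> borel_measurable (F c)"
      by (intro borel_measurable_times p increment_F_measurable ab ac order_refl)
    have Yi: "integrable M ?Y" by (rule pi[OF inc]) (use ab ac in auto)
    note Z1 = integral_mult_increment_zero[OF cd Y Yi]
    \<comment> \<open>The product of increments is cut at \<open>c\<close>, \<open>e\<close> and
      \<open>f\<close>: one square over the overlap \<open>[c, e]\<close> and two products whose
      last factor is an increment independent of the others. Only the square has a nonzero
      mean.\<close>
    define e where "e = min b d"
    define f where "f = max b d"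
    have ce: "0 \<le> c" "c \<le> e" "0 \<le> e" "e \<le> f" using cb cd by (auto simp: e_def f_def)
    have pint: "integrable M ?p" using pi[of "\<lambda>_. 1"] by simp
    note Z2 = integral_mult_increment_square[OF ce(1,2) p pint]
    let ?W = "\<lambda>\<omega>. ?p \<omega> * (B e \<omega> - B c \<omega>)"
    have W: "?W \<in> borel_measurable (F e)"
      by (intro borel_measurable_times F_measurable_mono[OF ce(1,2) p] increment_F_measurable ce order_refl)
    have Wi: "integrable M ?W" by (rule pi[OF inc]) (use ce in auto)
    note Z3 = integral_mult_increment_zero[OF ce(3,4) W Wi]
    have eq: "(\<phi> \<omega> * (B b \<omega> - B a \<omega>)) * (\<psi> \<omega> * (B d \<omega> - B c \<omega>)) =
       ?Y \<omega> * (B d \<omega> - B c \<omega>) + ?p \<omega> * (B e \<omega> - B c \<omega>)\<^sup>2 + ?W \<omega> * (B f \<omega> - B e \<omega>)" for \<omega>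
    proof (cases "b \<le> d")
      case True
      then have "e = b" "f = d" by (auto simp: e_def f_def)
      then show ?thesis by (simp add: power2_eq_square algebra_simps)
    next
      case False
      then have "e = d" "f = b" by (auto simp: e_def f_def)
      then show ?thesis by (simp add: power2_eq_square algebra_simps)
    qed
    have "max 0 (min b d - max a c) = e - c"
      using ac ce by (auto simp: e_def max_def)
    then show ?thesis
      unfolding eq using Z1 Z2 Z3 by simp
  qed
qed

lemma increment_product_product:
  assumes ab: "0 \<le> a" "a \<le> b" and cd: "0 \<le> c" "c \<le> d"
    and \<phi>: "\<phi> \<in> borel_measurable (F a)" "\<And>\<omega>. \<omega> \<in> space M \<Longrightarrow> \<bar>\<phi> \<omega>\<bar> \<le> C"
    and \<psi>: "\<psi> \<in> borel_measurable (F c)" "\<And>\<omega>. \<omega> \<in> space M \<Longrightarrow> \<bar>\<psi> \<omega>\<bar> \<le> C'"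
  shows "integrable M (\<lambda>\<omega>. (\<phi> \<omega> * (B b \<omega> - B a \<omega>)) * (\<psi> \<omega> * (B d \<omega> - B c \<omega>))) \<and>
    expectation (\<lambda>\<omega>. (\<phi> \<omega> * (B b \<omega> - B a \<omega>)) * (\<psi> \<omega> * (B d \<omega> - B c \<omega>)))
      = expectation (\<lambda>\<omega>. \<phi> \<omega> * \<psi> \<omega>) * max 0 (min b d - max a c)"
proof (cases "a \<le> c")
  case True
  show ?thesis by (rule increment_product_product_ordered[OF ab True cd(2) \<phi> \<psi>])
next
  case False
  then have "c \<le> a" by simp
  from increment_product_product_ordered[OF cd this ab(2) \<psi> \<phi>] show ?thesis
    by (simp add: mult.commute min.commute max.commute)
qed

end

section \<open>Elementary stochastic integrals\<close>

text \<open>Taken in \<open>ennreal\<close>, so second-moment estimates and limits carry no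
  integrability side conditions.\<close>

abbreviation mean_square :: "'b measure \<Rightarrow> ('b \<Rightarrow> real) \<Rightarrow> ennreal" where
  "mean_square N f \<equiv> \<integral>\<^sup>+x. ennreal ((f x)\<^sup>2) \<partial>N"

context brownian_motion
begin

text \<open>Integrand and integral are generated together, one step at a time, and the intervals may
  overlap. Sums then need no common refinement of partitions, and no independence of the
  representation has to be shown.\<close>

inductive elementary :: "('a \<times> real \<Rightarrow> real) \<Rightarrow> ('a \<Rightarrow> real) \<Rightarrow> bool" where
  elementary_zero: "elementary (\<lambda>_. 0) (\<lambda>_. 0)"
| elementary_add: "elementary P J \<Longrightarrow> 0 \<le> a \<Longrightarrow> a \<le> b \<Longrightarrow> \<phi> \<in> borel_measurable (F a) \<Longrightarrow>
    (\<And>\<omega>. \<omega> \<in> space M \<Longrightarrow> \<bar>\<phi> \<omega>\<bar> \<le> C) \<Longrightarrow>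
    elementary (\<lambda>(\<omega>, s). P (\<omega>, s) + \<phi> \<omega> * indicator {a<..b} s)
      (\<lambda>\<omega>. J \<omega> + \<phi> \<omega> * (B b \<omega> - B a \<omega>))"

lemma elementary_sum:
  assumes "elementary P J" "elementary P' J'"
  shows "elementary (\<lambda>z. P z + P' z) (\<lambda>\<omega>. J \<omega> + J' \<omega>)"
  using assms(2)
proof induction
  case elementary_zero
  then show ?case using assms(1) by simp
next
  case (elementary_add P' J' a b \<phi> C)
  from elementary.elementary_add[OF elementary_add.IH elementary_add.hyps(2-4), of C] elementary_add.hyps(5) show ?case
    by (simp add: add.assoc case_prod_unfold)
qed

lemma elementary_step:
  assumes "0 \<le> a" "a \<le> b" "\<phi> \<in> borel_measurable (F a)" "\<And>\<omega>. \<omega> \<in> space M \<Longrightarrow> \<bar>\<phi> \<omega>\<bar> \<le> C"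
  shows "elementary (\<lambda>(\<omega>, s). \<phi> \<omega> * indicator {a<..b} s) (\<lambda>\<omega>. \<phi> \<omega> * (B b \<omega> - B a \<omega>))"
  using elementary_add[OF elementary_zero assms(1-3), of C] assms(4) by simp

lemma elementary_uminus:
  assumes "elementary P J"
  shows "elementary (\<lambda>z. - P z) (\<lambda>\<omega>. - J \<omega>)"
  using assms
proof induction
  case elementary_zero
  then show ?case by (simp add: elementary.elementary_zero)
next
  case (elementary_add P J a b \<phi> C)
  from elementary.elementary_add[OF elementary_add.IH elementary_add.hyps(2-3), of "\<lambda>\<omega>. - \<phi> \<omega>" C] elementary_add.hyps(4,5)
  show ?case by (simp add: case_prod_unfold)
qed

lemma elementary_finite_sum:
  assumes "\<And>i. i < k \<Longrightarrow> elementary (P i) (J i)"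
  shows "elementary (\<lambda>z. \<Sum>i<(k::nat). P i z) (\<lambda>\<omega>. \<Sum>i<k. J i \<omega>)"
  using assms
proof (induction k)
  case 0
  then show ?case by (simp add: elementary_zero)
next
  case (Suc k)
  then show ?case using elementary_sum[OF Suc.IH Suc.prems[of k]] by simp
qed

text \<open>Multiplying by an \<open>F u\<close>-measurable factor keeps a step adapted only after
  time \<open>u\<close>, so the integrand is first cut off there. A single \<open>J'\<close> serves
  all \<open>Z\<close>, because the integral of the product must be \<open>Z\<close> times one fixed
  random variable.\<close>

lemma elementary_restrict:
  assumes "elementary P J" "0 \<le> u"
  shows "\<exists>J'. elementary (\<lambda>(\<omega>, s). indicator {u<..} s * P (\<omega>, s)) J' \<and>
    (\<forall>Z C. Z \<in> borel_measurable (F u) \<longrightarrow> (\<forall>\<omega>\<in>space M. \<bar>Z \<omega>\<bar> \<le> C) \<longrightarrow>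
      elementary (\<lambda>(\<omega>, s). Z \<omega> * (indicator {u<..} s * P (\<omega>, s))) (\<lambda>\<omega>. Z \<omega> * J' \<omega>))"
  using assms(1)
proof induction
  case elementary_zero
  then show ?case by (intro exI[of _ "\<lambda>_. 0"]) (simp add: elementary.elementary_zero case_prod_unfold)
next
  case (elementary_add P J a b \<phi> C)
  from elementary_add.IH obtain J' where J': "elementary (\<lambda>(\<omega>, s). indicator {u<..} s * P (\<omega>, s)) J'"
    "\<And>Z C. Z \<in> borel_measurable (F u) \<Longrightarrow> (\<forall>\<omega>\<in>space M. \<bar>Z \<omega>\<bar> \<le> C) \<Longrightarrow>
      elementary (\<lambda>(\<omega>, s). Z \<omega> * (indicator {u<..} s * P (\<omega>, s))) (\<lambda>\<omega>. Z \<omega> * J' \<omega>)" by blast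
  \<comment> \<open>The step on \<open>(a, b]\<close> meets the times after \<open>u\<close> in
    \<open>(a', b']\<close>. Taking \<open>max b a'\<close> instead of \<open>b\<close> makes the
    interval empty when \<open>b \<le> u\<close> and keeps \<open>a' \<le> b'\<close>.\<close>
  define a' where "a' = max a u"
  define b' where "b' = max b a'"
  have ab': "0 \<le> a'" "a' \<le> b'" "a \<le> a'" "u \<le> a'" using elementary_add.hyps by (auto simp: a'_def b'_def)
  have ind: "indicator {u<..} s * (x * indicator {a<..b} s) = x * indicator {a'<..b'} s" for s x :: real
    by (auto simp: indicator_def a'_def b'_def max_def)
  have \<phi>: "\<phi> \<in> borel_measurable (F a')"
    by (rule F_measurable_mono[OF elementary_add.hyps(2) ab'(3) elementary_add.hyps(4)])
  have 1: "elementary (\<lambda>(\<omega>, s). indicator {u<..} s * (P (\<omega>, s) + \<phi> \<omega> * indicator {a<..b} s))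
    (\<lambda>\<omega>. J' \<omega> + \<phi> \<omega> * (B b' \<omega> - B a' \<omega>))"
    using elementary.elementary_add[OF J'(1) ab'(1,2) \<phi> elementary_add.hyps(5)]
    by (simp add: ring_distribs ind case_prod_unfold)
  have 2: "elementary (\<lambda>(\<omega>, s). Z \<omega> * (indicator {u<..} s * (P (\<omega>, s) + \<phi> \<omega> * indicator {a<..b} s)))
    (\<lambda>\<omega>. Z \<omega> * (J' \<omega> + \<phi> \<omega> * (B b' \<omega> - B a' \<omega>)))"
    if Z: "Z \<in> borel_measurable (F u)" "\<forall>\<omega>\<in>space M. \<bar>Z \<omega>\<bar> \<le> D" for Z D
  proof -
    have "(\<lambda>\<omega>. Z \<omega> * \<phi> \<omega>) \<in> borel_measurable (F a')"
      by (rule borel_measurable_times[OF F_measurable_mono[OF assms(2) ab'(4) Z(1)] \<phi>])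
    moreover have "\<bar>Z \<omega> * \<phi> \<omega>\<bar> \<le> D * C" if "\<omega> \<in> space M" for \<omega>
      unfolding abs_mult using Z(2) elementary_add.hyps(5)[OF that] that by (intro mult_mono) force+
    ultimately show ?thesis
      using elementary.elementary_add[OF J'(2)[OF Z] ab'(1,2), of "\<lambda>\<omega>. Z \<omega> * \<phi> \<omega>" "D * C"]
      by (simp add: ring_distribs ind case_prod_unfold mult.assoc)
  qed
  show ?case
    by (rule exI[of _ "\<lambda>\<omega>. J' \<omega> + \<phi> \<omega> * (B b' \<omega> - B a' \<omega>)"])
      (use 1 2 in \<open>simp add: case_prod_unfold\<close>)
qed

text \<open>By Fubini the integral over the product space is the mean of
  \<open>\<phi> \<psi>\<close> times the overlap length, which is exactly the covariance of the two
  stochastic steps.\<close>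

lemma elementary_product:
  assumes \<phi>: "\<phi> \<in> borel_measurable (F a)" "\<And>\<omega>. \<omega> \<in> space M \<Longrightarrow> \<bar>\<phi> \<omega>\<bar> \<le> C" and ab: "0 \<le> a" "a \<le> b"
    and \<psi>: "\<psi> \<in> borel_measurable (F c)" "\<And>\<omega>. \<omega> \<in> space M \<Longrightarrow> \<bar>\<psi> \<omega>\<bar> \<le> C'" and cd: "0 \<le> c" "c \<le> d"
  shows "integrable (M \<Otimes>\<^sub>M lborel) (\<lambda>(\<omega>, s). (\<phi> \<omega> * indicator {a<..b} s) * (\<psi> \<omega> * indicator {c<..d} s))"
    and "(\<integral>z. (case z of (\<omega>, s) \<Rightarrow> (\<phi> \<omega> * indicator {a<..b} s) * (\<psi> \<omega> * indicator {c<..d} s)) \<partial>(M \<Otimes>\<^sub>M lborel))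
      = expectation (\<lambda>\<omega>. (\<phi> \<omega> * (B b \<omega> - B a \<omega>)) * (\<psi> \<omega> * (B d \<omega> - B c \<omega>)))"
proof -
  interpret P: pair_sigma_finite M lborel ..
  have m: "\<phi> \<in> borel_measurable M" "\<psi> \<in> borel_measurable M"
    using F_measurable_imp \<phi> \<psi> ab cd by auto
  have pb: "\<bar>\<phi> \<omega> * \<psi> \<omega>\<bar> \<le> C * C'" if "\<omega> \<in> space M" for \<omega>
    unfolding abs_mult using \<phi>(2)[OF that] \<psi>(2)[OF that] by (intro mult_mono) linarith+
  have p: "integrable M (\<lambda>\<omega>. \<phi> \<omega> * \<psi> \<omega>)"
    using m pb by (intro integrable_const_bound[of _ "C * C'"]) auto
  have i: "integrable lborel (\<lambda>s. indicator {max a c<..min b d} s :: real)"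
    by (intro integrable_real_indicator emeasure_bounded_finite) auto
  have eq: "(\<lambda>(\<omega>, s). (\<phi> \<omega> * indicator {a<..b} s) * (\<psi> \<omega> * indicator {c<..d} s))
    = (\<lambda>(\<omega>, s). (\<phi> \<omega> * \<psi> \<omega>) * indicator {max a c<..min b d} s)"
    by (auto simp: indicator_def fun_eq_iff)
  show "integrable (M \<Otimes>\<^sub>M lborel) (\<lambda>(\<omega>, s). (\<phi> \<omega> * indicator {a<..b} s) * (\<psi> \<omega> * indicator {c<..d} s))"
    unfolding eq
  proof (rule P.Fubini_integrable)
    show "(\<lambda>(\<omega>, s). \<phi> \<omega> * \<psi> \<omega> * indicator {max a c<..min b d} s) \<in> borel_measurable (M \<Otimes>\<^sub>M lborel)"
      using m by measurable
    show "integrable M (\<lambda>\<omega>. \<integral>s. norm (case (\<omega>, s) of (\<omega>, s) \<Rightarrow> \<phi> \<omega> * \<psi> \<omega> * indicator {max a c<..min b d} s) \<partial>lborel)"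
      using integrable_abs[OF p] by (simp add: abs_mult)
    show "AE \<omega> in M. integrable lborel (\<lambda>s. case (\<omega>, s) of (\<omega>, s) \<Rightarrow> \<phi> \<omega> * \<psi> \<omega> * indicator {max a c<..min b d} s)"
      using i by (auto intro: integrable_mult_right)
  qed
  then have "(\<integral>z. (case z of (\<omega>, s) \<Rightarrow> (\<phi> \<omega> * indicator {a<..b} s) * (\<psi> \<omega> * indicator {c<..d} s)) \<partial>(M \<Otimes>\<^sub>M lborel))
    = expectation (\<lambda>\<omega>. \<integral>s. \<phi> \<omega> * \<psi> \<omega> * indicator {max a c<..min b d} s \<partial>lborel)"
    unfolding eq by (simp add: P.integral_fst'[symmetric])
  also have "\<dots> = expectation (\<lambda>\<omega>. \<phi> \<omega> * \<psi> \<omega>) * max 0 (min b d - max a c)"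
  proof -
    have "measure lborel {max a c<..min b d} = max 0 (min b d - max a c)"
      by (cases "max a c \<le> min b d") (auto simp: max_absorb1)
    then show ?thesis by simp
  qed
  also have "\<dots> = expectation (\<lambda>\<omega>. (\<phi> \<omega> * (B b \<omega> - B a \<omega>)) * (\<psi> \<omega> * (B d \<omega> - B c \<omega>)))"
    using increment_product_product[OF ab cd \<phi> \<psi>] by simp
  finally show "(\<integral>z. (case z of (\<omega>, s) \<Rightarrow> (\<phi> \<omega> * indicator {a<..b} s) * (\<psi> \<omega> * indicator {c<..d} s)) \<partial>(M \<Otimes>\<^sub>M lborel))
      = expectation (\<lambda>\<omega>. (\<phi> \<omega> * (B b \<omega> - B a \<omega>)) * (\<psi> \<omega> * (B d \<omega> - B c \<omega>)))" .
qed

lemma elementary_isometry_step: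
  assumes "elementary P J" and \<psi>: "\<psi> \<in> borel_measurable (F c)" "\<And>\<omega>. \<omega> \<in> space M \<Longrightarrow> \<bar>\<psi> \<omega>\<bar> \<le> C'"
    and cd: "0 \<le> c" "c \<le> d"
  shows "integrable (M \<Otimes>\<^sub>M lborel) (\<lambda>(\<omega>, s). P (\<omega>, s) * (\<psi> \<omega> * indicator {c<..d} s)) \<and>
    integrable M (\<lambda>\<omega>. J \<omega> * (\<psi> \<omega> * (B d \<omega> - B c \<omega>))) \<and>
    (\<integral>z. (case z of (\<omega>, s) \<Rightarrow> P (\<omega>, s) * (\<psi> \<omega> * indicator {c<..d} s)) \<partial>(M \<Otimes>\<^sub>M lborel))
      = expectation (\<lambda>\<omega>. J \<omega> * (\<psi> \<omega> * (B d \<omega> - B c \<omega>)))"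
  using assms(1)
proof induction
  case elementary_zero
  then show ?case by (simp add: case_prod_unfold)
next
  case (elementary_add P J a b \<phi> C)
  note p = elementary_product[OF elementary_add.hyps(4,5,2,3) \<psi> cd]
  note e = increment_product_product[OF elementary_add.hyps(2,3) cd elementary_add.hyps(4,5) \<psi>]
  from p e elementary_add.IH show ?case
    by (simp add: distrib_right case_prod_unfold)
qed

text \<open>The Ito isometry in polarised form: both sides are bilinear, so steps can be added one
  at a time in each argument, whereas an induction on squares would leave cross terms.\<close>

lemma elementary_isometry_product:
  assumes "elementary P J" "elementary P' J'"
  shows "integrable (M \<Otimes>\<^sub>M lborel) (\<lambda>z. P z * P' z) \<and> integrable M (\<lambda>\<omega>. J \<omega> * J' \<omega>) \<and>
    (\<integral>z. P z * P' z \<partial>(M \<Otimes>\<^sub>M lborel)) = expectation (\<lambda>\<omega>. J \<omega> * J' \<omega>)"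
  using assms(2)
proof induction
  case elementary_zero
  then show ?case by simp
next
  case (elementary_add P' J' a b \<phi> C)
  from elementary_isometry_step[OF assms(1) elementary_add.hyps(4,5,2,3)] elementary_add.IH show ?case
    by (simp add: distrib_left case_prod_unfold)
qed

lemma elementary_measurable:
  assumes "elementary P J"
  shows "P \<in> borel_measurable (M \<Otimes>\<^sub>M lborel)" "J \<in> borel_measurable M"
  using assms
proof (induction)
  case (elementary_add P J a b \<phi> C)
  note [measurable] = F_measurable_imp[OF elementary_add.hyps(2,4)] elementary_add.IH
  have [simp]: "0 \<le> b" using elementary_add.hyps by simp
  { case 1 show ?case by (simp add: case_prod_unfold) }
  { case 2 show ?case using elementary_add.hyps by measurable }
qed simp_all

lemma elementary_isometry:
  assumes "elementary P J"
  shows "mean_square M J = mean_square (M \<Otimes>\<^sub>M lborel) P"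
  using elementary_isometry_product[OF assms assms]
  by (simp add: power2_eq_square nn_integral_eq_integral)

text \<open>The extension of the Ito integral to L2 limits, with no fixed time horizon: the time
  interval sits in \<open>P\<close> as an indicator, so integrals up to different times can be
  added. Adaptedness is carried by the approximants and not stated for \<open>P\<close>.\<close>

definition ito_closure :: "('a \<times> real \<Rightarrow> real) \<Rightarrow> ('a \<Rightarrow> real) \<Rightarrow> bool" where
  "ito_closure P J \<longleftrightarrow> P \<in> borel_measurable (M \<Otimes>\<^sub>M lborel) \<and> J \<in> borel_measurable M \<and>
    (\<exists>Pn Jn. (\<forall>n::nat. elementary (Pn n) (Jn n)) \<and>
      (\<lambda>n. mean_square (M \<Otimes>\<^sub>M lborel) (\<lambda>z. Pn n z - P z)) \<longlonglongrightarrow> 0 \<and>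
      (\<lambda>n. mean_square M (\<lambda>\<omega>. Jn n \<omega> - J \<omega>)) \<longlonglongrightarrow> 0)"

end

section \<open>Ito integrals\<close>

lemma nn_integral_square_add_le:
  fixes f g :: "'b \<Rightarrow> real"
  assumes [measurable]: "f \<in> borel_measurable N" "g \<in> borel_measurable N"
  shows "mean_square N (\<lambda>x. f x + g x)
    \<le> 2 * mean_square N f + 2 * mean_square N g"
proof -
  have "ennreal ((f x + g x)\<^sup>2) \<le> 2 * ennreal ((f x)\<^sup>2) + 2 * ennreal ((g x)\<^sup>2)" for x
  proof -
    have "(f x + g x)\<^sup>2 \<le> 2 * (f x)\<^sup>2 + 2 * (g x)\<^sup>2"
      using sum_squares_ge_zero[of "f x - g x" 0] by (simp add: power2_eq_square algebra_simps)
    then have "ennreal ((f x + g x)\<^sup>2) \<le> ennreal (2 * (f x)\<^sup>2 + 2 * (g x)\<^sup>2)"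
      by (rule ennreal_leI)
    then show ?thesis by (simp add: ennreal_plus ennreal_mult)
  qed
  then have "mean_square N (\<lambda>x. f x + g x)
      \<le> (\<integral>\<^sup>+x. 2 * ennreal ((f x)\<^sup>2) + 2 * ennreal ((g x)\<^sup>2) \<partial>N)"
    by (rule nn_integral_mono)
  also have "\<dots> = 2 * mean_square N f + 2 * mean_square N g"
    by (simp add: nn_integral_add nn_integral_cmult)
  finally show ?thesis .
qed

lemma nn_integral_square_scale_le:
  fixes f g :: "'b \<Rightarrow> real"
  assumes [measurable]: "f \<in> borel_measurable N"
    and le: "\<And>x. x \<in> space N \<Longrightarrow> \<bar>g x\<bar> \<le> C * \<bar>f x\<bar>"
  shows "mean_square N g \<le> ennreal (C\<^sup>2) * mean_square N f"
proof -
  have "ennreal ((g x)\<^sup>2) \<le> ennreal (C\<^sup>2) * ennreal ((f x)\<^sup>2)" if "x \<in> space N" for x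
  proof -
    have "(g x)\<^sup>2 \<le> (C * \<bar>f x\<bar>)\<^sup>2"
      using le[OF that] by (metis abs_ge_zero power2_abs power_mono)
    then show ?thesis by (simp add: power_mult_distrib ennreal_mult[symmetric])
  qed
  then have "mean_square N g \<le> (\<integral>\<^sup>+x. ennreal (C\<^sup>2) * ennreal ((f x)\<^sup>2) \<partial>N)"
    by (rule nn_integral_mono)
  then show ?thesis by (simp add: nn_integral_cmult)
qed

lemma tendsto_zero_ennreal_cmult:
  fixes f :: "nat \<Rightarrow> ennreal"
  assumes "f \<longlonglongrightarrow> 0" "c < top"
  shows "(\<lambda>n. c * f n) \<longlonglongrightarrow> 0"
  using ennreal_tendsto_cmult[OF assms(2,1)] by simp

lemma tendsto_zero_ennreal_le:
  fixes f g :: "nat \<Rightarrow> ennreal"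
  assumes "g \<longlonglongrightarrow> 0" "\<And>n. f n \<le> g n"
  shows "f \<longlonglongrightarrow> 0"
  by (rule tendsto_sandwich[OF _ _ tendsto_const assms(1)]) (auto simp: assms(2))

lemma tendsto_zero_ennreal_comb:
  fixes f g :: "nat \<Rightarrow> ennreal"
  assumes "f \<longlonglongrightarrow> 0" "g \<longlonglongrightarrow> 0" "c < top" "d < top"
  shows "(\<lambda>n. c * f n + d * g n) \<longlonglongrightarrow> 0"
  using tendsto_add[OF tendsto_zero_ennreal_cmult[OF assms(1,3)] tendsto_zero_ennreal_cmult[OF assms(2,4)]]
  by simp

context brownian_motion
begin

lemma ito_measurable:
  assumes "ito_closure P J"
  shows "P \<in> borel_measurable (M \<Otimes>\<^sub>M lborel)" "J \<in> borel_measurable M"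
  using assms unfolding ito_closure_def by auto

text \<open>The crude factor \<open>4\<close> avoids passing to the limit in the isometry; only an upper bound is needed.\<close>

lemma ito_bound:
  assumes "ito_closure P J"
  shows "mean_square M J \<le> 4 * mean_square (M \<Otimes>\<^sub>M lborel) P"
proof -
  from assms obtain Pn Jn where A: "\<And>n::nat. elementary (Pn n) (Jn n)"
    "(\<lambda>n. mean_square (M \<Otimes>\<^sub>M lborel) (\<lambda>z. Pn n z - P z)) \<longlonglongrightarrow> 0" (is "?e \<longlonglongrightarrow> 0")
    "(\<lambda>n. mean_square M (\<lambda>\<omega>. Jn n \<omega> - J \<omega>)) \<longlonglongrightarrow> 0" (is "?d \<longlonglongrightarrow> 0")
    unfolding ito_closure_def by blast
  note m[measurable] = ito_measurable[OF assms] elementary_measurable[OF A(1)]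
  let ?c = "mean_square (M \<Otimes>\<^sub>M lborel) P"
  have "mean_square M J \<le> (2 * ?d n + 4 * ?e n) + 4 * ?c" for n
  proof -
    have "mean_square M J \<le> 2 * mean_square M (\<lambda>\<omega>. J \<omega> - Jn n \<omega>)
        + 2 * mean_square M (Jn n)"
      using nn_integral_square_add_le[of "\<lambda>\<omega>. J \<omega> - Jn n \<omega>" M "Jn n"] by simp
    also have "\<dots> \<le> 2 * mean_square M (\<lambda>\<omega>. J \<omega> - Jn n \<omega>) + 2 * (2 * ?e n + 2 * ?c)"
    proof (intro add_left_mono mult_left_mono)
      show "mean_square M (Jn n) \<le> 2 * ?e n + 2 * ?c"
        unfolding elementary_isometry[OF A(1)]
        using nn_integral_square_add_le[of "\<lambda>z. Pn n z - P z" "M \<Otimes>\<^sub>M lborel" P] by simp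
    qed simp
    finally show ?thesis
      by (simp add: power2_commute[of "J _"] distrib_left mult.assoc[symmetric] add.assoc)
  qed
  moreover have "(\<lambda>n. (2 * ?d n + 4 * ?e n) + 4 * ?c) \<longlonglongrightarrow> 0 + 4 * ?c"
    by (intro tendsto_add tendsto_const tendsto_zero_ennreal_comb A) auto
  ultimately show ?thesis
    by (simp add: LIMSEQ_le_const)
qed

lemma ito_elementary: "elementary P J \<Longrightarrow> ito_closure P J"
  unfolding ito_closure_def using elementary_measurable[of P J]
  by (auto intro!: exI[of _ "\<lambda>_. P"] exI[of _ "\<lambda>_. J"])

lemma ito_add:
  assumes "ito_closure P J" "ito_closure P' J'"
  shows "ito_closure (\<lambda>z. P z + P' z) (\<lambda>\<omega>. J \<omega> + J' \<omega>)"
proof -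
  from assms(1) obtain Pn Jn where A: "\<And>n::nat. elementary (Pn n) (Jn n)"
    "(\<lambda>n. mean_square (M \<Otimes>\<^sub>M lborel) (\<lambda>z. Pn n z - P z)) \<longlonglongrightarrow> 0"
    "(\<lambda>n. mean_square M (\<lambda>\<omega>. Jn n \<omega> - J \<omega>)) \<longlonglongrightarrow> 0"
    unfolding ito_closure_def by blast
  note m[measurable] = ito_measurable[OF assms(1)] elementary_measurable[OF A(1)]
  from assms(2) obtain Pn' Jn' where A': "\<And>n::nat. elementary (Pn' n) (Jn' n)"
    "(\<lambda>n. mean_square (M \<Otimes>\<^sub>M lborel) (\<lambda>z. Pn' n z - P' z)) \<longlonglongrightarrow> 0"
    "(\<lambda>n. mean_square M (\<lambda>\<omega>. Jn' n \<omega> - J' \<omega>)) \<longlonglongrightarrow> 0"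
    unfolding ito_closure_def by blast
  note m'[measurable] = ito_measurable[OF assms(2)] elementary_measurable[OF A'(1)]
  have e: "elementary (\<lambda>z. Pn n z + Pn' n z) (\<lambda>\<omega>. Jn n \<omega> + Jn' n \<omega>)" for n
    by (rule elementary_sum[OF A(1) A'(1)])
  have 1: "(\<lambda>n. mean_square (M \<Otimes>\<^sub>M lborel) (\<lambda>z. Pn n z + Pn' n z - (P z + P' z))) \<longlonglongrightarrow> 0"
  proof (rule tendsto_zero_ennreal_le[OF tendsto_zero_ennreal_comb[OF A(2) A'(2)]])
    show "mean_square (M \<Otimes>\<^sub>M lborel) (\<lambda>z. Pn n z + Pn' n z - (P z + P' z)) \<le>
      2 * mean_square (M \<Otimes>\<^sub>M lborel) (\<lambda>z. Pn n z - P z) + 2 * mean_square (M \<Otimes>\<^sub>M lborel) (\<lambda>z. Pn' n z - P' z)" for n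
      using nn_integral_square_add_le[of "\<lambda>z. Pn n z - P z" "M \<Otimes>\<^sub>M lborel" "\<lambda>z. Pn' n z - P' z"]
      by (simp add: algebra_simps)
  qed auto
  have 2: "(\<lambda>n. mean_square M (\<lambda>z. Jn n z + Jn' n z - (J z + J' z))) \<longlonglongrightarrow> 0"
  proof (rule tendsto_zero_ennreal_le[OF tendsto_zero_ennreal_comb[OF A(3) A'(3)]])
    show "mean_square M (\<lambda>z. Jn n z + Jn' n z - (J z + J' z)) \<le>
      2 * mean_square M (\<lambda>z. Jn n z - J z) + 2 * mean_square M (\<lambda>z. Jn' n z - J' z)" for n
      using nn_integral_square_add_le[of "\<lambda>z. Jn n z - J z" "M" "\<lambda>z. Jn' n z - J' z"]
      by (simp add: algebra_simps)
  qed auto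
  have "(\<lambda>z. P z + P' z) \<in> borel_measurable (M \<Otimes>\<^sub>M lborel)" "(\<lambda>\<omega>. J \<omega> + J' \<omega>) \<in> borel_measurable M"
    by measurable
  then show ?thesis unfolding ito_closure_def using e 1 2
    by (intro conjI exI[of _ "\<lambda>n z. Pn n z + Pn' n z"] exI[of _ "\<lambda>n \<omega>. Jn n \<omega> + Jn' n \<omega>"]) auto
qed

lemma ito_sum:
  assumes "\<And>i. i < k \<Longrightarrow> ito_closure (P i) (J i)"
  shows "ito_closure (\<lambda>z. \<Sum>i<(k::nat). P i z) (\<lambda>\<omega>. \<Sum>i<k. J i \<omega>)"
  using assms
proof (induction k)
  case 0
  then show ?case by (simp add: elementary_zero ito_elementary)
next
  case (Suc k)
  then show ?case using ito_add[OF Suc.IH Suc.prems[of k]] by simp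
qed

text \<open>The integrand lives after \<open>u\<close>, but its elementary approximants need not,
  and before \<open>u\<close> multiplication by \<open>Z\<close> would destroy adaptedness. They are
  therefore cut off at \<open>u\<close>, and the isometry shows that the cut costs nothing in the
  limit.\<close>

lemma ito_mult:
  assumes "ito_closure P J" and u: "0 \<le> u" and supp: "\<And>\<omega> s. s \<le> u \<Longrightarrow> P (\<omega>, s) = 0"
    and Z: "Z \<in> borel_measurable (F u)" "\<And>\<omega>. \<omega> \<in> space M \<Longrightarrow> \<bar>Z \<omega>\<bar> \<le> C"
  shows "ito_closure (\<lambda>(\<omega>, s::real). Z \<omega> * P (\<omega>, s)) (\<lambda>\<omega>. Z \<omega> * J \<omega>)"
proof -
  from assms(1) obtain Pn Jn where A: "\<And>n::nat. elementary (Pn n) (Jn n)"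
    "(\<lambda>n. mean_square (M \<Otimes>\<^sub>M lborel) (\<lambda>z. Pn n z - P z)) \<longlonglongrightarrow> 0"
    "(\<lambda>n. mean_square M (\<lambda>\<omega>. Jn n \<omega> - J \<omega>)) \<longlonglongrightarrow> 0"
    unfolding ito_closure_def by blast
  note m[measurable] = ito_measurable[OF assms(1)] elementary_measurable[OF A(1)]
  have Zm[measurable]: "Z \<in> borel_measurable M" by (rule F_measurable_imp[OF u Z(1)])
  define Q :: "nat \<Rightarrow> 'a \<times> real \<Rightarrow> real" where "Q n = (\<lambda>(\<omega>, s). indicator {u<..} s * Pn n (\<omega>, s))" for n
  have "\<exists>J'. elementary (Q n) J' \<and> elementary (\<lambda>(\<omega>, s::real). Z \<omega> * Q n (\<omega>, s)) (\<lambda>\<omega>. Z \<omega> * J' \<omega>)" for n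
  proof -
    from elementary_restrict[OF A(1)[of n] u] obtain J' where
      1: "elementary (\<lambda>(\<omega>, s). indicator {u<..} s * Pn n (\<omega>, s)) J'"
      and 2: "\<And>Z C. Z \<in> borel_measurable (F u) \<Longrightarrow> \<forall>\<omega>\<in>space M. \<bar>Z \<omega>\<bar> \<le> C \<Longrightarrow>
        elementary (\<lambda>(\<omega>, s). Z \<omega> * (indicator {u<..} s * Pn n (\<omega>, s))) (\<lambda>\<omega>. Z \<omega> * J' \<omega>)"
      by blast
    show ?thesis
      using 1 2[OF Z(1), of C] Z(2) by (intro exI[of _ J']) (simp add: Q_def)
  qed
  then obtain J' where J': "\<And>n. elementary (Q n) (J' n)"
      "\<And>n. elementary (\<lambda>(\<omega>, s::real). Z \<omega> * Q n (\<omega>, s)) (\<lambda>\<omega>. Z \<omega> * J' n \<omega>)" by metis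
  have [measurable]: "Q n \<in> borel_measurable (M \<Otimes>\<^sub>M lborel)" "J' n \<in> borel_measurable M" for n
    using elementary_measurable[OF J'(1)] by auto
  have 1: "(\<lambda>n. mean_square (M \<Otimes>\<^sub>M lborel) (\<lambda>z. (case z of (\<omega>, s::real) \<Rightarrow> Z \<omega> * Q n (\<omega>, s)) - (case z of (\<omega>, s::real) \<Rightarrow> Z \<omega> * P (\<omega>, s)))) \<longlonglongrightarrow> 0"
  proof (rule tendsto_zero_ennreal_le[OF tendsto_zero_ennreal_cmult[OF A(2)]])
    fix n
    show "mean_square (M \<Otimes>\<^sub>M lborel) (\<lambda>z. (case z of (\<omega>, s::real) \<Rightarrow> Z \<omega> * Q n (\<omega>, s)) - (case z of (\<omega>, s::real) \<Rightarrow> Z \<omega> * P (\<omega>, s)))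
      \<le> ennreal (C\<^sup>2) * mean_square (M \<Otimes>\<^sub>M lborel) (\<lambda>z. Pn n z - P z)"
    proof (rule nn_integral_square_scale_le)
      fix z :: "'a \<times> real" assume "z \<in> space (M \<Otimes>\<^sub>M lborel)"
      then obtain \<omega> s where z: "z = (\<omega>, s)" "\<omega> \<in> space M" by (auto simp: space_pair_measure)
      have "\<bar>Q n (\<omega>, s) - P (\<omega>, s)\<bar> \<le> \<bar>Pn n (\<omega>, s) - P (\<omega>, s)\<bar>"
        using supp[of s \<omega>] by (auto simp: Q_def indicator_def)
      then have "\<bar>Z \<omega>\<bar> * \<bar>Q n (\<omega>, s) - P (\<omega>, s)\<bar> \<le> C * \<bar>Pn n (\<omega>, s) - P (\<omega>, s)\<bar>"
        using Z(2)[OF z(2)] by (intro mult_mono) auto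
      then show "\<bar>(case z of (\<omega>, s::real) \<Rightarrow> Z \<omega> * Q n (\<omega>, s)) - (case z of (\<omega>, s::real) \<Rightarrow> Z \<omega> * P (\<omega>, s))\<bar>
          \<le> C * \<bar>Pn n z - P z\<bar>"
        by (simp add: z right_diff_distrib[symmetric] abs_mult)
    qed measurable
  qed auto
  \<comment> \<open>The part removed by the cut lies where \<open>P\<close> vanishes, so
    \<open>\<bar>Q n - Pn n\<bar> \<le> \<bar>Pn n - P\<bar>\<close> pointwise, and the isometry
    carries this over to \<open>J' n - Jn n\<close>.\<close>
  have J'J: "(\<lambda>n. mean_square M (\<lambda>\<omega>. J' n \<omega> - J \<omega>)) \<longlonglongrightarrow> 0"
  proof (rule tendsto_zero_ennreal_le[OF tendsto_zero_ennreal_comb[OF A(2) A(3)]])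
    fix n
    have "elementary (\<lambda>z. Q n z + - Pn n z) (\<lambda>\<omega>. J' n \<omega> + - Jn n \<omega>)"
      by (rule elementary_sum[OF J'(1) elementary_uminus[OF A(1)]])
    from elementary_isometry[OF this]
    have "mean_square M (\<lambda>\<omega>. J' n \<omega> - Jn n \<omega>) = mean_square (M \<Otimes>\<^sub>M lborel) (\<lambda>z. Q n z - Pn n z)"
      by simp
    also have "\<dots> \<le> ennreal (1\<^sup>2) * mean_square (M \<Otimes>\<^sub>M lborel) (\<lambda>z. Pn n z - P z)"
      by (rule nn_integral_square_scale_le) (auto simp: Q_def indicator_def supp)
    finally have *: "mean_square M (\<lambda>\<omega>. J' n \<omega> - Jn n \<omega>) \<le> mean_square (M \<Otimes>\<^sub>M lborel) (\<lambda>z. Pn n z - P z)"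
      by simp
    have "mean_square M (\<lambda>\<omega>. J' n \<omega> - J \<omega>) \<le> 2 * mean_square M (\<lambda>\<omega>. J' n \<omega> - Jn n \<omega>)
       + 2 * mean_square M (\<lambda>\<omega>. Jn n \<omega> - J \<omega>)"
      using nn_integral_square_add_le[of "\<lambda>\<omega>. J' n \<omega> - Jn n \<omega>" M "\<lambda>\<omega>. Jn n \<omega> - J \<omega>"] by simp
    also have "\<dots> \<le> 2 * mean_square (M \<Otimes>\<^sub>M lborel) (\<lambda>z. Pn n z - P z) + 2 * mean_square M (\<lambda>\<omega>. Jn n \<omega> - J \<omega>)"
      by (intro add_right_mono mult_left_mono *) auto
    finally show "mean_square M (\<lambda>\<omega>. J' n \<omega> - J \<omega>) \<le> 2 * mean_square (M \<Otimes>\<^sub>M lborel) (\<lambda>z. Pn n z - P z) + 2 * mean_square M (\<lambda>\<omega>. Jn n \<omega> - J \<omega>)" .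
  qed auto
  have 2: "(\<lambda>n. mean_square M (\<lambda>\<omega>. Z \<omega> * J' n \<omega> - Z \<omega> * J \<omega>)) \<longlonglongrightarrow> 0"
  proof (rule tendsto_zero_ennreal_le[OF tendsto_zero_ennreal_cmult[OF J'J]])
    fix n
    show "mean_square M (\<lambda>\<omega>. Z \<omega> * J' n \<omega> - Z \<omega> * J \<omega>) \<le> ennreal (C\<^sup>2) * mean_square M (\<lambda>\<omega>. J' n \<omega> - J \<omega>)"
      by (rule nn_integral_square_scale_le)
        (auto simp: right_diff_distrib[symmetric] abs_mult intro!: mult_right_mono Z)
  qed auto
  have 3: "(\<lambda>(\<omega>, s::real). Z \<omega> * P (\<omega>, s)) \<in> borel_measurable (M \<Otimes>\<^sub>M lborel)"
    "(\<lambda>\<omega>. Z \<omega> * J \<omega>) \<in> borel_measurable M"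
    by measurable
  show ?thesis unfolding ito_closure_def
    by (intro conjI exI[of _ "\<lambda>n (\<omega>, s::real). Z \<omega> * Q n (\<omega>, s)"] exI[of _ "\<lambda>n \<omega>. Z \<omega> * J' n \<omega>"]
        allI J'(2) 1 2 3)
qed

lemma ito_uminus:
  assumes "ito_closure P J"
  shows "ito_closure (\<lambda>z. - P z) (\<lambda>\<omega>. - J \<omega>)"
proof -
  from assms obtain Pn Jn where A: "\<And>n::nat. elementary (Pn n) (Jn n)"
    "(\<lambda>n. mean_square (M \<Otimes>\<^sub>M lborel) (\<lambda>z. Pn n z - P z)) \<longlonglongrightarrow> 0"
    "(\<lambda>n. mean_square M (\<lambda>\<omega>. Jn n \<omega> - J \<omega>)) \<longlonglongrightarrow> 0"
    unfolding ito_closure_def by blast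
  note m[measurable] = ito_measurable[OF assms] elementary_measurable[OF A(1)]
  have eq: "(- x - - y)\<^sup>2 = (x - y)\<^sup>2" for x y :: real by (simp add: power2_eq_square algebra_simps)
  show ?thesis unfolding ito_closure_def
  proof (intro conjI exI[of _ "\<lambda>n z. - Pn n z"] exI[of _ "\<lambda>n \<omega>. - Jn n \<omega>"] allI)
    show "(\<lambda>n. mean_square (M \<Otimes>\<^sub>M lborel) (\<lambda>z. - Pn n z - - P z)) \<longlonglongrightarrow> 0"
      unfolding eq by (rule A(2))
    show "(\<lambda>n. mean_square M (\<lambda>\<omega>. - Jn n \<omega> - - J \<omega>)) \<longlonglongrightarrow> 0"
      unfolding eq by (rule A(3))
  qed (simp_all add: elementary_uminus[OF A(1)])
qed

lemma simple_integrand_elementary: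
  assumes "simple_integrand M F T k p \<phi>"
  shows "elementary (\<lambda>(\<omega>, s). simple_process k p \<phi> s \<omega>) (simple_ito_integral B k p \<phi>)"
proof -
  from assms have p: "p 0 = 0" "\<And>i. i < k \<Longrightarrow> p i < p (i + 1)"
    and \<phi>: "\<And>i. i < k \<Longrightarrow> \<phi> i \<in> borel_measurable (F (p i))"
      "\<And>i. i < k \<Longrightarrow> \<exists>C. \<forall>\<omega>\<in>space M. \<bar>\<phi> i \<omega>\<bar> \<le> C"
    unfolding simple_integrand_def by blast+
  have pos: "i \<le> k \<Longrightarrow> 0 \<le> p i" for i
  proof (induction i)
    case (Suc i)
    then show ?case using p(2)[of i] by auto
  qed (simp add: p)
  have "elementary (\<lambda>z. case z of (\<omega>, s) \<Rightarrow> \<phi> i \<omega> * indicator {p i<..p (i + 1)} s)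
      (\<lambda>\<omega>. \<phi> i \<omega> * (B (p (i + 1)) \<omega> - B (p i) \<omega>))" if i: "i < k" for i
  proof -
    obtain C where "\<forall>\<omega>\<in>space M. \<bar>\<phi> i \<omega>\<bar> \<le> C" using \<phi>(2)[OF i] by auto
    then show ?thesis
      using elementary_step[of "p i" "p (i + 1)" "\<phi> i" C] pos[of i] p(2)[OF i] \<phi>(1)[OF i] i by simp
  qed
  from elementary_finite_sum[of k, OF this] show ?thesis
    unfolding simple_process_def simple_ito_integral_def[abs_def] by (simp add: case_prod_unfold)
qed

lemma progressive_measurable:
  assumes "progressive F T H" "0 \<le> T"
  shows "(\<lambda>(\<omega>, s). indicator {0<..T} s * H s \<omega>) \<in> borel_measurable (M \<Otimes>\<^sub>M lborel)"
proof -
  \<comment> \<open>Clamping times to \<open>[0, T]\<close> gives a total measurable map into the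
    restricted space on which \<open>progressive\<close> speaks; the indicator hides the clamped
    values.\<close>
  define c where "c s = max 0 (min s T)" for s :: real
  have H: "(\<lambda>(s, \<omega>). H s \<omega>) \<in> borel_measurable (restrict_space borel {0..T} \<Otimes>\<^sub>M F T)"
    using assms unfolding progressive_def by auto
  have c: "c \<in> borel \<rightarrow>\<^sub>M restrict_space borel {0..T}"
    unfolding c_def using assms(2) by (intro measurable_restrict_space2) auto
  have id: "(\<lambda>\<omega>. \<omega>) \<in> M \<rightarrow>\<^sub>M F T"
    by (rule measurable_from_subalg[OF subalgebra_F[OF assms(2)]]) simp
  have "(\<lambda>z. (c (snd z), fst z)) \<in> M \<Otimes>\<^sub>M lborel \<rightarrow>\<^sub>M restrict_space borel {0..T} \<Otimes>\<^sub>M F T"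
    using measurable_compose[OF measurable_snd, of c lborel _ M] measurable_compose[OF measurable_fst id] c
    by (intro measurable_Pair) (auto simp: comp_def)
  from measurable_compose[OF this H]
  have [measurable]: "(\<lambda>z. H (c (snd z)) (fst z)) \<in> borel_measurable (M \<Otimes>\<^sub>M lborel)" by simp
  have "(\<lambda>z. indicator {0<..T} (snd z) * H (c (snd z)) (fst z)) \<in> borel_measurable (M \<Otimes>\<^sub>M lborel)"
    by measurable
  also have "(\<lambda>z. indicator {0<..T} (snd z) * H (c (snd z)) (fst z)) = (\<lambda>(\<omega>, s). indicator {0<..T} s * H s \<omega>)"
    by (auto simp: c_def indicator_def fun_eq_iff)
  finally show ?thesis .
qed

lemma simple_process_support:
  assumes "simple_integrand M F T k p \<phi>" "s \<notin> {0<..T}"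
  shows "simple_process k p \<phi> s \<omega> = 0"
proof -
  from assms have p: "p 0 = 0" "p k = T" "\<And>i. i < k \<Longrightarrow> p i < p (i + 1)"
    unfolding simple_integrand_def by blast+
  have mono: "p i \<le> p j" if "i \<le> j" "j \<le> k" for i j
    using that
  proof (induction rule: dec_induct)
    case (step j)
    then show ?case using p(3)[of j] by simp
  qed simp
  have "s \<notin> {p i<..p (i + 1)}" if i: "i < k" for i
    using mono[of 0 i] mono[of "i + 1" "k"] i assms(2) p(1,2) by auto
  then show ?thesis unfolding simple_process_def by (intro sum.neutral) auto
qed

text \<open>The half-open interval matches the steps of simple processes. Outside it the
  approximants and the limit are both zero, so the error over all times is bounded pointwise by the
  error over \<open>{0..T}\<close>.\<close>

lemma has_ito_integral_ito:
  assumes "has_ito_integral M F B T H I" "0 \<le> T"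
  shows "ito_closure (\<lambda>(\<omega>, s). indicator {0<..T} s * H s \<omega>) I"
proof -
  note h = assms(1)[unfolded has_ito_integral_def]
  let ?P = "\<lambda>(\<omega>, s). indicator {0<..T} s * H s \<omega>"
  have P: "?P \<in> borel_measurable (M \<Otimes>\<^sub>M lborel)"
    by (rule progressive_measurable[OF h[THEN conjunct1] assms(2)])
  from h[THEN conjunct2, THEN conjunct2] obtain k p \<phi> where
    A: "(\<forall>n. simple_integrand M F T (k n) (p n) (\<phi> n)) \<and>
      (\<lambda>n. \<integral>\<^sup>+\<omega>. (\<integral>\<^sup>+s\<in>{0..T}. ennreal ((simple_process (k n) (p n) (\<phi> n) s \<omega> - H s \<omega>)\<^sup>2) \<partial>lborel) \<partial>M)
          \<longlonglongrightarrow> 0 \<and>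
      (\<lambda>n. mean_square M (\<lambda>\<omega>. simple_ito_integral B (k n) (p n) (\<phi> n) \<omega> - I \<omega>)) \<longlonglongrightarrow> 0"
    by (elim exE)
  have si: "simple_integrand M F T (k n) (p n) (\<phi> n)" for n
    using A by blast
  define Pn :: "nat \<Rightarrow> 'a \<times> real \<Rightarrow> real" where "Pn n = (\<lambda>(\<omega>, s). simple_process (k n) (p n) (\<phi> n) s \<omega>)" for n
  have el: "elementary (Pn n) (simple_ito_integral B (k n) (p n) (\<phi> n))" for n
    unfolding Pn_def by (rule simple_integrand_elementary[OF si])
  have Pn: "Pn n \<in> borel_measurable (M \<Otimes>\<^sub>M lborel)" for n
    by (rule elementary_measurable(1)[OF el])
  have conv: "(\<lambda>n. mean_square (M \<Otimes>\<^sub>M lborel) (\<lambda>z. Pn n z - ?P z)) \<longlonglongrightarrow> 0"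
  proof (rule tendsto_zero_ennreal_le[OF A[THEN conjunct2, THEN conjunct1]])
    fix n
    have "mean_square (M \<Otimes>\<^sub>M lborel) (\<lambda>z. Pn n z - ?P z)
      = (\<integral>\<^sup>+\<omega>. (\<integral>\<^sup>+s. ennreal ((Pn n (\<omega>, s) - ?P (\<omega>, s))\<^sup>2) \<partial>lborel) \<partial>M)"
      by (rule lborel.nn_integral_fst[symmetric])
        (intro measurable_compose[OF _ measurable_ennreal] borel_measurable_power borel_measurable_diff Pn P)
    also have "\<dots> \<le> (\<integral>\<^sup>+\<omega>. (\<integral>\<^sup>+s\<in>{0..T}. ennreal ((simple_process (k n) (p n) (\<phi> n) s \<omega> - H s \<omega>)\<^sup>2) \<partial>lborel) \<partial>M)"
    proof (intro nn_integral_mono)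
      fix \<omega> s
      show "ennreal ((Pn n (\<omega>, s) - ?P (\<omega>, s))\<^sup>2)
         \<le> ennreal ((simple_process (k n) (p n) (\<phi> n) s \<omega> - H s \<omega>)\<^sup>2) * indicator {0..T} s"
        using simple_process_support[OF si, of s n \<omega>] by (cases "s \<in> {0<..T}") (auto simp: Pn_def)
    qed
    finally show "mean_square (M \<Otimes>\<^sub>M lborel) (\<lambda>z. Pn n z - ?P z)
      \<le> (\<integral>\<^sup>+\<omega>. (\<integral>\<^sup>+s\<in>{0..T}. ennreal ((simple_process (k n) (p n) (\<phi> n) s \<omega> - H s \<omega>)\<^sup>2) \<partial>lborel) \<partial>M)" .
  qed
  show ?thesis unfolding ito_closure_def
    by (intro conjI exI[of _ Pn] exI[of _ "\<lambda>n. simple_ito_integral B (k n) (p n) (\<phi> n)"] allI el conv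
      A[THEN conjunct2, THEN conjunct2] P h[THEN conjunct2, THEN conjunct1])
qed

end

section \<open>Convergence to zero in probability\<close>

lemma ennreal_tendsto_zero_iff:
  fixes f :: "nat \<Rightarrow> ennreal"
  shows "f \<longlonglongrightarrow> 0 \<longleftrightarrow> (\<forall>e>0. \<forall>\<^sub>F n in sequentially. f n \<le> ennreal e)"
proof
  assume "f \<longlonglongrightarrow> 0"
  then show "\<forall>e>0. \<forall>\<^sub>F n in sequentially. f n \<le> ennreal e"
    by (intro allI impI eventually_mono[OF order_tendstoD(2)[of f 0 sequentially] less_imp_le]) auto
next
  assume a: "\<forall>e>0. \<forall>\<^sub>F n in sequentially. f n \<le> ennreal e"
  show "f \<longlonglongrightarrow> 0"
  proof (rule order_tendstoI)
    fix y :: ennreal assume "0 < y"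
    from dense[OF this] obtain z where z: "0 < z" "z < y" by auto
    define e where "e = enn2real z"
    have "ennreal e = z" using z by (simp add: e_def order_less_le_trans[OF z(2)])
    with z have e: "0 < e" "ennreal e < y" by auto
    then show "\<forall>\<^sub>F n in sequentially. f n < y"
      using a e(2) by (auto elim!: eventually_mono)
  qed simp
qed

context prob_space
begin

text \<open>Convergence in probability rather than in \<open>L\<^sup>1\<close>: the drift \<open>V' X\<close> is not known to be integrable.\<close>

definition null_in_prob :: "(nat \<Rightarrow> 'a \<Rightarrow> real) \<Rightarrow> bool" where
  "null_in_prob Y \<longleftrightarrow> (\<forall>n. Y n \<in> borel_measurable M) \<and>
     (\<lambda>n. \<integral>\<^sup>+\<omega>. ennreal (min 1 \<bar>Y n \<omega>\<bar>) \<partial>M) \<longlonglongrightarrow> 0"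

lemma null_in_prob_mono:
  assumes "null_in_prob Z" "\<And>n. Y n \<in> borel_measurable M" "\<And>n \<omega>. \<omega> \<in> space M \<Longrightarrow> \<bar>Y n \<omega>\<bar> \<le> \<bar>Z n \<omega>\<bar>"
  shows "null_in_prob Y"
  unfolding null_in_prob_def
proof (intro conjI allI assms(2))
  show "(\<lambda>n. \<integral>\<^sup>+\<omega>. ennreal (min 1 \<bar>Y n \<omega>\<bar>) \<partial>M) \<longlonglongrightarrow> 0"
  proof (rule tendsto_zero_ennreal_le)
    show "(\<lambda>n. \<integral>\<^sup>+\<omega>. ennreal (min 1 \<bar>Z n \<omega>\<bar>) \<partial>M) \<longlonglongrightarrow> 0"
      using assms(1) unfolding null_in_prob_def by simp
    show "(\<integral>\<^sup>+\<omega>. ennreal (min 1 \<bar>Y n \<omega>\<bar>) \<partial>M) \<le> (\<integral>\<^sup>+\<omega>. ennreal (min 1 \<bar>Z n \<omega>\<bar>) \<partial>M)" for n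
      using assms(3) by (intro nn_integral_mono ennreal_leI min.mono) auto
  qed
qed

lemma null_in_prob_add:
  assumes "null_in_prob Y" "null_in_prob Z"
  shows "null_in_prob (\<lambda>n \<omega>. Y n \<omega> + Z n \<omega>)"
proof -
  have [measurable]: "Y n \<in> borel_measurable M" "Z n \<in> borel_measurable M" for n
    using assms unfolding null_in_prob_def by auto
  have "(\<lambda>n. \<integral>\<^sup>+\<omega>. ennreal (min 1 \<bar>Y n \<omega> + Z n \<omega>\<bar>) \<partial>M) \<longlonglongrightarrow> 0"
  proof (rule tendsto_zero_ennreal_le)
    show "(\<lambda>n. 1 * (\<integral>\<^sup>+\<omega>. ennreal (min 1 \<bar>Y n \<omega>\<bar>) \<partial>M) + 1 * (\<integral>\<^sup>+\<omega>. ennreal (min 1 \<bar>Z n \<omega>\<bar>) \<partial>M)) \<longlonglongrightarrow> 0"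
      using assms unfolding null_in_prob_def by (intro tendsto_zero_ennreal_comb) auto
    fix n
    have "(\<integral>\<^sup>+\<omega>. ennreal (min 1 \<bar>Y n \<omega> + Z n \<omega>\<bar>) \<partial>M)
       \<le> (\<integral>\<^sup>+\<omega>. ennreal (min 1 \<bar>Y n \<omega>\<bar>) + ennreal (min 1 \<bar>Z n \<omega>\<bar>) \<partial>M)"
      by (intro nn_integral_mono) (auto simp: ennreal_plus[symmetric] simp del: ennreal_plus intro!: ennreal_leI)
    then show "(\<integral>\<^sup>+\<omega>. ennreal (min 1 \<bar>Y n \<omega> + Z n \<omega>\<bar>) \<partial>M)
      \<le> 1 * (\<integral>\<^sup>+\<omega>. ennreal (min 1 \<bar>Y n \<omega>\<bar>) \<partial>M) + 1 * (\<integral>\<^sup>+\<omega>. ennreal (min 1 \<bar>Z n \<omega>\<bar>) \<partial>M)"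
      by (simp add: nn_integral_add)
  qed
  then show ?thesis unfolding null_in_prob_def by simp
qed

lemma null_in_prob_AE:
  assumes [measurable]: "\<And>n. Y n \<in> borel_measurable M" and "AE \<omega> in M. (\<lambda>n. Y n \<omega>) \<longlonglongrightarrow> 0"
  shows "null_in_prob Y"
proof -
  have "(\<lambda>n. \<integral>\<^sup>+\<omega>. ennreal (min 1 \<bar>Y n \<omega>\<bar>) \<partial>M) \<longlonglongrightarrow> (\<integral>\<^sup>+\<omega>. 0 \<partial>M)"
  proof (rule nn_integral_dominated_convergence[where w="\<lambda>_. 1"])
    show "AE \<omega> in M. (\<lambda>n. ennreal (min 1 \<bar>Y n \<omega>\<bar>)) \<longlonglongrightarrow> 0"
      using assms(2)
    proof eventually_elim
      case (elim \<omega>)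
      have "(\<lambda>n. min 1 \<bar>Y n \<omega>\<bar>) \<longlonglongrightarrow> min 1 \<bar>0\<bar>"
        by (intro tendsto_min tendsto_const tendsto_rabs elim)
      then show ?case using tendsto_ennrealI by fastforce
    qed
  qed (auto simp: emeasure_space_1)
  then show ?thesis unfolding null_in_prob_def using assms(1) by simp
qed

lemma null_in_prob_L1:
  assumes [measurable]: "\<And>n. Y n \<in> borel_measurable M" and "(\<lambda>n. \<integral>\<^sup>+\<omega>. ennreal \<bar>Y n \<omega>\<bar> \<partial>M) \<longlonglongrightarrow> 0"
  shows "null_in_prob Y"
  unfolding null_in_prob_def
proof (intro conjI allI assms(1))
  show "(\<lambda>n. \<integral>\<^sup>+\<omega>. ennreal (min 1 \<bar>Y n \<omega>\<bar>) \<partial>M) \<longlonglongrightarrow> 0"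
    by (rule tendsto_zero_ennreal_le[OF assms(2)]) (intro nn_integral_mono ennreal_leI, simp)
qed

text \<open>In place of Cauchy-Schwarz, the pointwise bound
  \<open>\<bar>y\<bar> \<le> e / 2 + (2 / e) y\<^sup>2\<close>, valid for every
  \<open>e > 0\<close>, turns a small second moment into a small first moment without leaving
  \<open>ennreal\<close>.\<close>

lemma L1_tendsto_zero_of_L2:
  fixes Y :: "nat \<Rightarrow> 'a \<Rightarrow> real"
  assumes [measurable]: "\<And>n. Y n \<in> borel_measurable M" and lim: "(\<lambda>n. mean_square M (Y n)) \<longlonglongrightarrow> 0"
  shows "(\<lambda>n. \<integral>\<^sup>+\<omega>. ennreal \<bar>Y n \<omega>\<bar> \<partial>M) \<longlonglongrightarrow> 0"
  unfolding ennreal_tendsto_zero_iff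
proof (intro allI impI)
  fix e :: real assume e: "e > 0"
  have le: "(\<integral>\<^sup>+\<omega>. ennreal \<bar>Y n \<omega>\<bar> \<partial>M) \<le> ennreal (e / 2) + ennreal (2 / e) * mean_square M (Y n)" for n
  proof -
    have "ennreal \<bar>y\<bar> \<le> ennreal (e / 2) + ennreal (2 / e) * ennreal (y\<^sup>2)" for y :: real
    proof -
      have "\<bar>y\<bar> \<le> e / 2 + 2 / e * y\<^sup>2"
      proof (cases "\<bar>y\<bar> \<le> e / 2")
        case True
        moreover have "0 \<le> 2 / e * y\<^sup>2" using e by simp
        ultimately show ?thesis by linarith
      next
        case False
        then have "\<bar>y\<bar> * (e / 2) \<le> \<bar>y\<bar> * \<bar>y\<bar>" by (intro mult_left_mono) auto
        then have "\<bar>y\<bar> \<le> 2 / e * y\<^sup>2" using e by (simp add: field_simps power2_eq_square)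
        then show ?thesis using e by simp
      qed
      then show ?thesis
        using e by (simp add: ennreal_plus[symmetric] ennreal_mult[symmetric] del: ennreal_plus)
    qed
    then have "(\<integral>\<^sup>+\<omega>. ennreal \<bar>Y n \<omega>\<bar> \<partial>M) \<le> (\<integral>\<^sup>+\<omega>. ennreal (e / 2) + ennreal (2 / e) * ennreal ((Y n \<omega>)\<^sup>2) \<partial>M)"
      by (intro nn_integral_mono)
    then show ?thesis by (simp add: nn_integral_add nn_integral_cmult emeasure_space_1)
  qed
  have "(\<lambda>n. ennreal (2 / e) * mean_square M (Y n)) \<longlonglongrightarrow> 0"
    by (rule tendsto_zero_ennreal_cmult[OF lim]) simp
  then have "\<forall>\<^sub>F n in sequentially. ennreal (2 / e) * mean_square M (Y n) \<le> ennreal (e / 2)"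
    using e unfolding ennreal_tendsto_zero_iff by simp
  then show "\<forall>\<^sub>F n in sequentially. (\<integral>\<^sup>+\<omega>. ennreal \<bar>Y n \<omega>\<bar> \<partial>M) \<le> ennreal e"
  proof eventually_elim
    case (elim n)
    have "(\<integral>\<^sup>+\<omega>. ennreal \<bar>Y n \<omega>\<bar> \<partial>M) \<le> ennreal (e / 2) + ennreal (e / 2)"
      by (rule order_trans[OF le add_left_mono[OF elim]])
    then show ?case using e by (simp add: ennreal_plus[symmetric] del: ennreal_plus)
  qed
qed

lemma null_in_prob_L2:
  assumes "\<And>n. Y n \<in> borel_measurable M" "(\<lambda>n. mean_square M (Y n)) \<longlonglongrightarrow> 0"
  shows "null_in_prob Y"
  by (rule null_in_prob_L1[OF assms(1) L1_tendsto_zero_of_L2[OF assms]])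

text \<open>A uniform bound on second moments gives uniform integrability, so convergence in
  probability forces the expectations to zero, and they are constant. Pointwise,
  \<open>\<bar>y\<bar> \<le> K min 1 \<bar>y\<bar> + y\<^sup>2 / K\<close> for
  \<open>K \<ge> 1\<close>.\<close>

lemma null_in_prob_expectation_const:
  assumes Y: "null_in_prob Y" and L2: "\<And>n. mean_square M (Y n) \<le> ennreal C" and "0 \<le> C"
    and const: "\<And>n. expectation (Y n) = c"
  shows "c = 0"
proof (rule ccontr)
  assume "c \<noteq> 0"
  then have c: "\<bar>c\<bar> > 0" by simp
  have [measurable]: "Y n \<in> borel_measurable M" for n using Y unfolding null_in_prob_def by simp
  \<comment> \<open>Chosen so that \<open>\<bar>c\<bar> K = \<bar>c\<bar> + 2 C\<close>, hence
    \<open>C / K < \<bar>c\<bar> / 2\<close>; the summand 1 gives \<open>K \<ge> 1\<close> and the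
    strict inequality.\<close>
  define K where "K = 1 + 2 * C / \<bar>c\<bar>"
  have K: "K > 0" unfolding K_def using assms(3) by (intro add_pos_nonneg) auto
  have "\<bar>c\<bar> * K = \<bar>c\<bar> + 2 * C" unfolding K_def using \<open>c \<noteq> 0\<close> by (simp add: ring_distribs)
  then have CK: "C / K < \<bar>c\<bar> / 2" using K c by (simp add: field_simps)
  have le: "ennreal \<bar>c\<bar> \<le> ennreal K * (\<integral>\<^sup>+\<omega>. ennreal (min 1 \<bar>Y n \<omega>\<bar>) \<partial>M) + ennreal (C / K)" for n
  proof -
    have K1: "K \<ge> 1" unfolding K_def using assms(3) by simp
    have "ennreal \<bar>y\<bar> \<le> ennreal K * ennreal (min 1 \<bar>y\<bar>) + ennreal (1 / K) * ennreal (y\<^sup>2)" for y :: real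
    proof -
      have "\<bar>y\<bar> \<le> K * min 1 \<bar>y\<bar> + 1 / K * y\<^sup>2"
      proof (cases "\<bar>y\<bar> \<le> K")
        case True
        have "\<bar>y\<bar> \<le> K * min 1 \<bar>y\<bar>"
          using True K1 mult_right_mono[OF K1, of "\<bar>y\<bar>"] by (auto simp: min_def)
        moreover have "0 \<le> 1 / K * y\<^sup>2" using K by simp
        ultimately show ?thesis by linarith
      next
        case False
        then have "\<bar>y\<bar> * K \<le> \<bar>y\<bar> * \<bar>y\<bar>" by (intro mult_left_mono) auto
        then have "\<bar>y\<bar> \<le> 1 / K * y\<^sup>2" using K by (simp add: field_simps power2_eq_square)
        moreover have "0 \<le> K * min 1 \<bar>y\<bar>" using K by simp
        ultimately show ?thesis by linarith
      qed
      then show ?thesis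
        using K by (simp add: ennreal_plus[symmetric] ennreal_mult[symmetric] del: ennreal_plus)
    qed
    then have "(\<integral>\<^sup>+\<omega>. ennreal \<bar>Y n \<omega>\<bar> \<partial>M)
       \<le> (\<integral>\<^sup>+\<omega>. ennreal K * ennreal (min 1 \<bar>Y n \<omega>\<bar>) + ennreal (1 / K) * ennreal ((Y n \<omega>)\<^sup>2) \<partial>M)"
      by (intro nn_integral_mono)
    also have "\<dots> = ennreal K * (\<integral>\<^sup>+\<omega>. ennreal (min 1 \<bar>Y n \<omega>\<bar>) \<partial>M)
        + ennreal (1 / K) * mean_square M (Y n)"
      by (simp add: nn_integral_add nn_integral_cmult)
    also have "\<dots> \<le> ennreal K * (\<integral>\<^sup>+\<omega>. ennreal (min 1 \<bar>Y n \<omega>\<bar>) \<partial>M) + ennreal (1 / K) * ennreal C"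
      by (intro add_left_mono mult_left_mono L2) simp
    also have "ennreal (1 / K) * ennreal C = ennreal (C / K)"
      using K assms(3) by (simp add: ennreal_mult[symmetric])
    finally have "(\<integral>\<^sup>+\<omega>. ennreal \<bar>Y n \<omega>\<bar> \<partial>M)
      \<le> ennreal K * (\<integral>\<^sup>+\<omega>. ennreal (min 1 \<bar>Y n \<omega>\<bar>) \<partial>M) + ennreal (C / K)" .
    \<comment> \<open>A non-integrable \<open>Y n\<close> would have expectation 0, so a nonzero
      \<open>c\<close> forces integrability and the norm bound applies.\<close>
    moreover have "ennreal \<bar>c\<bar> \<le> (\<integral>\<^sup>+\<omega>. ennreal \<bar>Y n \<omega>\<bar> \<partial>M)"
      using integral_norm_bound_ennreal[of M "Y n"] const[of n] \<open>c \<noteq> 0\<close> not_integrable_integral_eq[of M "Y n"] by fastforce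
    ultimately show ?thesis by (rule order_trans[rotated])
  qed
  have "(\<lambda>n. ennreal K * (\<integral>\<^sup>+\<omega>. ennreal (min 1 \<bar>Y n \<omega>\<bar>) \<partial>M) + ennreal (C / K)) \<longlonglongrightarrow> 0 + ennreal (C / K)"
    using Y unfolding null_in_prob_def by (intro tendsto_add tendsto_const tendsto_zero_ennreal_cmult) auto
  from LIMSEQ_le_const[OF this] le have "ennreal \<bar>c\<bar> \<le> ennreal (C / K)" by auto
  then have "\<bar>c\<bar> \<le> C / K" using K assms(3) by simp
  then show False using CK c by linarith
qed

end

section \<open>Second-order Taylor expansion along a grid\<close>

text \<open>Two bounds for one remainder: the quadratic one serves increments whose squares have a
  small sum, the cubic one serves Brownian increments, whose squares do not. Lipschitz continuity of
  \<open>f''\<close> replaces a third derivative.\<close>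

lemma second_order_taylor:
  fixes f f' f'' :: "real \<Rightarrow> real"
  assumes f: "\<And>x. (f has_real_derivative f' x) (at x)" "\<And>x. (f' has_real_derivative f'' x) (at x)"
    and bdd: "\<And>x. \<bar>f'' x\<bar> \<le> K" and lip: "\<And>x y. \<bar>f'' x - f'' y\<bar> \<le> K * \<bar>x - y\<bar>"
  shows "\<bar>f (x + u) - f x - f' x * u - f'' x / 2 * u\<^sup>2\<bar> \<le> K * u\<^sup>2"
    and "\<bar>f (x + u) - f x - f' x * u - f'' x / 2 * u\<^sup>2\<bar> \<le> K * \<bar>u\<bar> ^ 3"
proof -
  have K: "K \<ge> 0" using bdd[of 0] by linarith
  have "\<bar>f (x + u) - f x - f' x * u - f'' x / 2 * u\<^sup>2\<bar> \<le> K * u\<^sup>2 \<and>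
    \<bar>f (x + u) - f x - f' x * u - f'' x / 2 * u\<^sup>2\<bar> \<le> K * \<bar>u\<bar> ^ 3"
  proof (cases "u = 0")
    case False
    define D where "D m = (if m = 0 then f else if m = Suc 0 then f' else f'')" for m :: nat
    have "\<exists>t. (if x + u < x then x + u < t \<and> t < x else x < t \<and> t < x + u) \<and>
      f (x + u) = (\<Sum>m<2. D m x / fact m * (x + u - x) ^ m) + D 2 t / fact 2 * (x + u - x) ^ 2"
      using False f
      by (intro Taylor[where a="min x (x + u)" and b="max x (x + u)"]) (auto simp: D_def less_Suc_eq numeral_2_eq_2)
    then obtain t where tx: "if x + u < x then x + u < t \<and> t < x else x < t \<and> t < x + u"
      and "f (x + u) = (\<Sum>m<2. D m x / fact m * (x + u - x) ^ m) + D 2 t / fact 2 * (x + u - x) ^ 2" by blast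
    then have t: "\<bar>t - x\<bar> \<le> \<bar>u\<bar>" "f (x + u) = f x + f' x * u + f'' t / 2 * u\<^sup>2"
      by (auto simp: D_def numeral_2_eq_2 split: if_splits)
    have eq: "\<bar>f (x + u) - f x - f' x * u - f'' x / 2 * u\<^sup>2\<bar> = \<bar>f'' t - f'' x\<bar> / 2 * u\<^sup>2"
      unfolding t(2) by (simp add: left_diff_distrib[symmetric] abs_mult diff_divide_distrib[symmetric])
    have 1: "\<bar>f'' t - f'' x\<bar> / 2 \<le> K" using bdd[of t] bdd[of x] abs_triangle_ineq4[of "f'' t" "f'' x"] by argo
    have "K * \<bar>t - x\<bar> \<le> K * \<bar>u\<bar>" using t(1) K by (rule mult_left_mono)
    moreover have "0 \<le> K * \<bar>u\<bar>" using K by simp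
    ultimately have 2: "\<bar>f'' t - f'' x\<bar> / 2 \<le> K * \<bar>u\<bar>" using lip[of t x] by argo
    have "\<bar>f'' t - f'' x\<bar> / 2 * u\<^sup>2 \<le> K * u\<^sup>2" by (rule mult_right_mono[OF 1]) simp
    moreover have "\<bar>f'' t - f'' x\<bar> / 2 * u\<^sup>2 \<le> K * \<bar>u\<bar> * u\<^sup>2" by (rule mult_right_mono[OF 2]) simp
    moreover have "K * \<bar>u\<bar> * u\<^sup>2 = K * \<bar>u\<bar> ^ 3" by (simp add: power3_eq_cube power2_eq_square)
    ultimately show ?thesis unfolding eq by simp
  qed (use K in simp)
  then show "\<bar>f (x + u) - f x - f' x * u - f'' x / 2 * u\<^sup>2\<bar> \<le> K * u\<^sup>2"
    and "\<bar>f (x + u) - f x - f' x * u - f'' x / 2 * u\<^sup>2\<bar> \<le> K * \<bar>u\<bar> ^ 3" by auto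
qed

text \<open>Here \<open>a\<close> is the drift, \<open>e\<close> the freezing error and
  \<open>z\<close> the Brownian term. Only \<open>z\<^sup>2\<close> is kept at second order; all
  other quadratic terms go into the bound.\<close>

lemma ito_taylor_remainder:
  fixes f f' f'' :: "real \<Rightarrow> real"
  assumes f: "\<And>x. (f has_real_derivative f' x) (at x)" "\<And>x. (f' has_real_derivative f'' x) (at x)"
    and bdd: "\<And>x. \<bar>f'' x\<bar> \<le> K" and lip: "\<And>x y. \<bar>f'' x - f'' y\<bar> \<le> K * \<bar>x - y\<bar>"
  shows "\<bar>f (x + (a + e + z)) - f x - f' x * (a + e + z) - f'' x / 2 * z\<^sup>2\<bar>
    \<le> 27 * K * (a\<^sup>2 + e\<^sup>2 + \<bar>a\<bar> * \<bar>z\<bar> + \<bar>e\<bar> * \<bar>z\<bar> + \<bar>z\<bar> ^ 3)"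
proof -
  define u where "u = a + e + z"
  have K: "K \<ge> 0" using bdd[of 0] by linarith
  let ?R = "f (x + u) - f x - f' x * u - f'' x / 2 * u\<^sup>2"
  have R: "\<bar>?R\<bar> \<le> K * (9 * a\<^sup>2 + 9 * e\<^sup>2 + 27 * \<bar>z\<bar> ^ 3)"
  proof -
    \<comment> \<open>One of the three summands is at least a third of \<open>u\<close> in size;
      replacing \<open>u\<close> by three times that summand produces the factors 9 and 27.\<close>
    consider "\<bar>u\<bar> \<le> 3 * \<bar>a\<bar>" | "\<bar>u\<bar> \<le> 3 * \<bar>e\<bar>" | "\<bar>u\<bar> \<le> 3 * \<bar>z\<bar>"
      unfolding u_def by linarith
    then have "\<bar>?R\<bar> \<le> K * (9 * a\<^sup>2) \<or> \<bar>?R\<bar> \<le> K * (9 * e\<^sup>2) \<or> \<bar>?R\<bar> \<le> K * (27 * \<bar>z\<bar> ^ 3)"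
    proof cases
      case 1
      then have "\<bar>u\<bar>\<^sup>2 \<le> (3 * \<bar>a\<bar>)\<^sup>2" by (intro power_mono) auto
      then have "K * u\<^sup>2 \<le> K * (9 * a\<^sup>2)" using K by (intro mult_left_mono) (auto simp: power_mult_distrib)
      then show ?thesis using second_order_taylor(1)[OF f bdd lip, of x u] by linarith
    next
      case 2
      then have "\<bar>u\<bar>\<^sup>2 \<le> (3 * \<bar>e\<bar>)\<^sup>2" by (intro power_mono) auto
      then have "K * u\<^sup>2 \<le> K * (9 * e\<^sup>2)" using K by (intro mult_left_mono) (auto simp: power_mult_distrib)
      then show ?thesis using second_order_taylor(1)[OF f bdd lip, of x u] by linarith
    next
      case 3
      then have "\<bar>u\<bar> ^ 3 \<le> (3 * \<bar>z\<bar>) ^ 3" by (intro power_mono) auto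
      then have "K * \<bar>u\<bar> ^ 3 \<le> K * (27 * \<bar>z\<bar> ^ 3)" using K by (intro mult_left_mono) (auto simp: power_mult_distrib)
      then show ?thesis using second_order_taylor(2)[OF f bdd lip, of x u] by linarith
    qed
    moreover have "0 \<le> K * a\<^sup>2" "0 \<le> K * e\<^sup>2" "0 \<le> K * \<bar>z\<bar> ^ 3" using K by auto
    ultimately show ?thesis by (auto simp: algebra_simps)
  qed
  have uz: "\<bar>u\<^sup>2 - z\<^sup>2\<bar> \<le> 2 * a\<^sup>2 + 2 * e\<^sup>2 + 2 * (\<bar>a\<bar> * \<bar>z\<bar>) + 2 * (\<bar>e\<bar> * \<bar>z\<bar>)"
  proof -
    have "u\<^sup>2 - z\<^sup>2 = a\<^sup>2 + e\<^sup>2 + 2 * (a * e) + 2 * (a * z) + 2 * (e * z)"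
      unfolding u_def by (simp add: power2_eq_square algebra_simps)
    moreover have "2 * \<bar>a * e\<bar> \<le> a\<^sup>2 + e\<^sup>2"
      using sum_squares_bound[of "\<bar>a\<bar>" "\<bar>e\<bar>"] by (simp add: abs_mult)
    moreover have "\<bar>a * z\<bar> = \<bar>a\<bar> * \<bar>z\<bar>" "\<bar>e * z\<bar> = \<bar>e\<bar> * \<bar>z\<bar>" by (auto simp: abs_mult)
    moreover have "0 \<le> a\<^sup>2" "0 \<le> e\<^sup>2" by auto
    ultimately show ?thesis by linarith
  qed
  have "\<bar>f'' x / 2 * (u\<^sup>2 - z\<^sup>2)\<bar> \<le> K / 2 * (2 * a\<^sup>2 + 2 * e\<^sup>2 + 2 * (\<bar>a\<bar> * \<bar>z\<bar>) + 2 * (\<bar>e\<bar> * \<bar>z\<bar>))"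
    unfolding abs_mult using bdd[of x] uz by (intro mult_mono) auto
  moreover have "f (x + u) - f x - f' x * u - f'' x / 2 * z\<^sup>2 = ?R + f'' x / 2 * (u\<^sup>2 - z\<^sup>2)"
    by (simp add: right_diff_distrib)
  ultimately have "\<bar>f (x + u) - f x - f' x * u - f'' x / 2 * z\<^sup>2\<bar>
    \<le> K * (9 * a\<^sup>2 + 9 * e\<^sup>2 + 27 * \<bar>z\<bar> ^ 3) + K / 2 * (2 * a\<^sup>2 + 2 * e\<^sup>2 + 2 * (\<bar>a\<bar> * \<bar>z\<bar>) + 2 * (\<bar>e\<bar> * \<bar>z\<bar>))"
    using R by linarith
  also have "\<dots> \<le> 27 * K * (a\<^sup>2 + e\<^sup>2 + \<bar>a\<bar> * \<bar>z\<bar> + \<bar>e\<bar> * \<bar>z\<bar> + \<bar>z\<bar> ^ 3)"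
  proof -
    have "0 \<le> K * a\<^sup>2" "0 \<le> K * e\<^sup>2" "0 \<le> K * (\<bar>a\<bar> * \<bar>z\<bar>)" "0 \<le> K * (\<bar>e\<bar> * \<bar>z\<bar>)" using K by auto
    then show ?thesis by (simp add: ring_distribs)
  qed
  finally show ?thesis unfolding u_def .
qed

text \<open>Division by zero gives 0, so all facts below except \<open>grid_last\<close> hold for
  \<open>N = 0\<close> as well.\<close>

definition grid :: "nat \<Rightarrow> nat \<Rightarrow> real" where
  "grid N i = real i / real N"

lemma grid_simps: "grid N 0 = 0" "0 \<le> grid N i" "grid N i \<le> grid N (Suc i)"
  by (auto simp: grid_def divide_right_mono)

lemma grid_diff: "grid N (Suc i) - grid N i = 1 / real N"
  by (simp add: grid_def add_divide_distrib diff_divide_distrib[symmetric])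

lemma grid_last: "N > 0 \<Longrightarrow> grid N N = 1"
  by (simp add: grid_def)

lemma grid_le_one: "i \<le> N \<Longrightarrow> grid N i \<le> 1"
  by (cases "N = 0") (auto simp: grid_def)

lemma grid_increment_small:
  fixes w :: "real \<Rightarrow> real"
  assumes cont: "continuous_on {0..1} w" and e: "e > 0"
  shows "\<forall>\<^sub>F n in sequentially. \<forall>i<Suc n. \<forall>s\<in>{grid (Suc n) i..grid (Suc n) (Suc i)}.
     \<bar>w s - w (grid (Suc n) i)\<bar> \<le> e"
proof -
  have "uniformly_continuous_on {0..1} w"
    by (rule compact_uniformly_continuous[OF cont]) simp
  then obtain d where d: "d > 0" "\<And>s s'. s \<in> {0..1} \<Longrightarrow> s' \<in> {0..1} \<Longrightarrow> dist s' s < d \<Longrightarrow> dist (w s') (w s) < e"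
    using e unfolding uniformly_continuous_on_def by metis
  obtain m where m: "1 / d < real m" using reals_Archimedean2 by blast
  show ?thesis
    using eventually_ge_at_top[of m]
  proof eventually_elim
    case (elim n)
    have "1 / d < real (Suc n)" using m elim by simp
    then have n: "1 / real (Suc n) < d" using d(1) by (simp add: field_simps)
    show ?case
    proof (intro allI impI ballI)
      fix i s assume i: "i < Suc n" and s: "s \<in> {grid (Suc n) i..grid (Suc n) (Suc i)}"
      have "grid (Suc n) (Suc i) \<le> 1" "grid (Suc n) i \<le> 1" "0 \<le> grid (Suc n) i"
        using i grid_le_one[of i "Suc n"] grid_le_one[of "Suc i" "Suc n"] grid_simps(2) by auto
      then have "s \<in> {0..1}" "grid (Suc n) i \<in> {0..1}" using s by auto
      moreover have "dist s (grid (Suc n) i) < d"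
        using s n grid_diff[of "Suc n" i] by (auto simp: dist_real_def simp del: of_nat_Suc)
      ultimately have "dist (w s) (w (grid (Suc n) i)) < e" by (intro d(2))
      then show "\<bar>w s - w (grid (Suc n) i)\<bar> \<le> e" by (simp add: dist_real_def)
    qed
  qed
qed

lemma set_integral_near_const:
  fixes w :: "real \<Rightarrow> real"
  assumes cont: "continuous_on {u..v} w" and "u \<le> v" and le: "\<And>s. s \<in> {u..v} \<Longrightarrow> \<bar>w s - c\<bar> \<le> e"
  shows "\<bar>(LINT s:{u..v}|lborel. w s) - c * (v - u)\<bar> \<le> e * (v - u)"
proof -
  have "set_integrable lborel {u..v} w" by (rule borel_integrable_atLeastAtMost'[OF cont])
  from set_borel_integral_eq_integral(2)[OF this]
  have eq: "(LINT s:{u..v}|lborel. w s) = integral {u..v} w" .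
  have i: "w integrable_on {u..v}" by (rule integrable_continuous_real[OF cont])
  have "((\<lambda>s. w s - c) has_integral (integral {u..v} w - (v - u) *\<^sub>R c)) {u..v}"
    using integrable_integral[OF i] has_integral_const_real[of c u v] assms(2)
    by (intro has_integral_diff) auto
  from has_integral_bound_real[OF _ _ this, of e "{}"]
  have "norm (integral {u..v} w - (v - u) *\<^sub>R c) \<le> e * (v - u)"
    using le le[of u] assms(2) by force
  then show ?thesis unfolding eq by (simp add: mult.commute)
qed

text \<open>Each \<open>a n i\<close> is of size \<open>1 / (n + 1)\<close>, so the sum of
  \<open>n + 1\<close> such terms, each times a uniformly small factor, tends to zero. In the
  application \<open>b\<close> is a Brownian path: its modulus of continuity supplies the small
  factor, and \<open>a\<close> supplies the mesh.\<close>

lemma pathwise_drift: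
  fixes w b :: "real \<Rightarrow> real" and a :: "nat \<Rightarrow> nat \<Rightarrow> real"
  assumes w: "continuous_on {0..1} w" and b: "continuous_on {0..1} b"
    and a: "\<And>n i. i < Suc n \<Longrightarrow>
      a n i = (LINT s:{grid (Suc n) i..grid (Suc n) (Suc i)}|lborel. w s)"
  shows "(\<lambda>n. \<Sum>i<Suc n. \<bar>a n i - w (grid (Suc n) i) / real (Suc n)\<bar>) \<longlonglongrightarrow> 0"
    and "(\<lambda>n. \<Sum>i<Suc n. (a n i)\<^sup>2 + \<bar>a n i\<bar> * \<bar>b (grid (Suc n) (Suc i)) - b (grid (Suc n) i)\<bar>) \<longlonglongrightarrow> 0"
proof -
  let ?t = "\<lambda>n i. grid (Suc n) i"
  have t: "?t n (Suc i) - ?t n i = 1 / real (Suc n)" "0 \<le> ?t n i" "?t n i \<le> ?t n (Suc i)" for n i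
    by (rule grid_diff, rule grid_simps, rule grid_simps)
  have t1: "?t n (Suc i) \<le> 1" if "i < Suc n" for n i using that by (intro grid_le_one) simp
  have cont: "continuous_on {?t n i..?t n (Suc i)} w" if "i < Suc n" for n i
    by (rule continuous_on_subset[OF w]) (use t(2)[of n i] t1[OF that] in auto)
  show "(\<lambda>n. \<Sum>i<Suc n. \<bar>a n i - w (?t n i) / real (Suc n)\<bar>) \<longlonglongrightarrow> 0"
  proof (rule LIMSEQ_I)
    fix r :: real assume r: "r > 0"
    have "\<forall>\<^sub>F n in sequentially. norm ((\<Sum>i<Suc n. \<bar>a n i - w (?t n i) / real (Suc n)\<bar>) - 0) < r"
      using grid_increment_small[OF w, of "r / 2"] r
    proof (simp del: of_nat_Suc sum.lessThan_Suc, elim eventually_mono, goal_cases)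
      case (1 n)
      have "\<bar>a n i - w (?t n i) / real (Suc n)\<bar> \<le> r / 2 * (1 / real (Suc n))" if i: "i < Suc n" for i
      proof -
        have "\<bar>w s - w (?t n i)\<bar> \<le> r / 2" if "s \<in> {?t n i..?t n (Suc i)}" for s
          using 1 i that by fastforce
        from set_integral_near_const[OF cont[OF i] t(3) this]
        show ?thesis unfolding a[OF i] t(1) by (simp del: of_nat_Suc)
      qed
      then have "(\<Sum>i<Suc n. \<bar>a n i - w (?t n i) / real (Suc n)\<bar>) \<le> (\<Sum>i<Suc n. r / 2 * (1 / real (Suc n)))"
        by (intro sum_mono) auto
      also have "\<dots> = r / 2" by (simp add: field_simps del: sum.lessThan_Suc of_nat_Suc)
      finally show ?case using r by (simp add: sum_nonneg del: sum.lessThan_Suc of_nat_Suc)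
    qed
    then show "\<exists>no. \<forall>n\<ge>no. norm ((\<Sum>i<Suc n. \<bar>a n i - w (?t n i) / real (Suc n)\<bar>) - 0) < r"
      unfolding eventually_sequentially .
  qed
  have "bounded (w ` {0..1})" using compact_continuous_image[OF w] by (simp add: compact_imp_bounded)
  then obtain W where W: "\<And>s. s \<in> {0..1} \<Longrightarrow> \<bar>w s\<bar> \<le> W" "W > 0"
    unfolding bounded_pos by (metis imageI real_norm_def)
  have aW: "\<bar>a n i\<bar> \<le> W * (1 / real (Suc n))" if i: "i < Suc n" for n i
  proof -
    have "\<bar>w s - 0\<bar> \<le> W" if "s \<in> {?t n i..?t n (Suc i)}" for s
      using W(1)[of s] that t(2)[of n i] t1[OF i] by auto
    from set_integral_near_const[OF cont[OF i] t(3) this]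
    show ?thesis unfolding a[OF i] t(1) by simp
  qed
  show "(\<lambda>n. \<Sum>i<Suc n. (a n i)\<^sup>2 + \<bar>a n i\<bar> * \<bar>b (?t n (Suc i)) - b (?t n i)\<bar>) \<longlonglongrightarrow> 0"
  proof (rule LIMSEQ_I)
    fix r :: real assume r: "r > 0"
    \<comment> \<open>With \<open>n + 1\<close> terms bounded by \<open>W / (n + 1) * 2 e\<close>,
      the sum is at most \<open>2 W e = r / 2\<close>.\<close>
    define e where "e = r / (4 * W)"
    have e: "e > 0" using r W by (simp add: e_def)
    obtain m where m: "W / e < real m" using reals_Archimedean2 by blast
    have "\<forall>\<^sub>F n in sequentially. n \<ge> m \<and> (\<forall>i<Suc n. \<forall>s\<in>{?t n i..?t n (Suc i)}. \<bar>b s - b (?t n i)\<bar> \<le> e)"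
      using eventually_ge_at_top[of m] grid_increment_small[OF b e] by eventually_elim blast
    then have "\<forall>\<^sub>F n in sequentially.
      norm ((\<Sum>i<Suc n. (a n i)\<^sup>2 + \<bar>a n i\<bar> * \<bar>b (?t n (Suc i)) - b (?t n i)\<bar>) - 0) < r"
    proof eventually_elim
      case (elim n)
      have "W / e < real (Suc n)" using m elim by simp
      then have n: "W * (1 / real (Suc n)) \<le> e" using e by (simp add: field_simps)
      have "(a n i)\<^sup>2 + \<bar>a n i\<bar> * \<bar>b (?t n (Suc i)) - b (?t n i)\<bar> \<le> W * (1 / real (Suc n)) * (2 * e)" if i: "i < Suc n" for i
      proof -
        have "(a n i)\<^sup>2 + \<bar>a n i\<bar> * \<bar>b (?t n (Suc i)) - b (?t n i)\<bar> = \<bar>a n i\<bar> * (\<bar>a n i\<bar> + \<bar>b (?t n (Suc i)) - b (?t n i)\<bar>)"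
          by (simp add: power2_eq_square algebra_simps del: of_nat_Suc)
        also have "\<dots> \<le> W * (1 / real (Suc n)) * (2 * e)"
        proof (intro mult_mono)
          show "\<bar>a n i\<bar> \<le> W * (1 / real (Suc n))" by (rule aW[OF i])
          have "\<bar>b (?t n (Suc i)) - b (?t n i)\<bar> \<le> e" using elim i t(3)[of n i] by (auto simp del: of_nat_Suc)
          then show "\<bar>a n i\<bar> + \<bar>b (?t n (Suc i)) - b (?t n i)\<bar> \<le> 2 * e" using aW[OF i] n by linarith
        qed (use W in auto)
        finally show ?thesis .
      qed
      then have "(\<Sum>i<Suc n. (a n i)\<^sup>2 + \<bar>a n i\<bar> * \<bar>b (?t n (Suc i)) - b (?t n i)\<bar>)
         \<le> (\<Sum>i<Suc n. W * (1 / real (Suc n)) * (2 * e))" by (intro sum_mono) auto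
      also have "\<dots> = r / 2" using W by (simp add: e_def field_simps del: sum.lessThan_Suc of_nat_Suc)
      finally show ?case using r by (simp add: sum_nonneg del: sum.lessThan_Suc of_nat_Suc)
    qed
    then show "\<exists>no. \<forall>n\<ge>no. norm ((\<Sum>i<Suc n. (a n i)\<^sup>2 + \<bar>a n i\<bar> * \<bar>b (?t n (Suc i)) - b (?t n i)\<bar>) - 0) < r"
      unfolding eventually_sequentially .
  qed
qed

section \<open>Discretization of Ito integrals\<close>

lemma sum_square_disjoint:
  fixes x :: "nat \<Rightarrow> real"
  assumes "\<And>i j. i < N \<Longrightarrow> j < N \<Longrightarrow> i \<noteq> j \<Longrightarrow> x i = 0 \<or> x j = 0"
  shows "(\<Sum>i<N. x i)\<^sup>2 = (\<Sum>i<N. (x i)\<^sup>2)"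
proof (cases "\<exists>i<N. x i \<noteq> 0")
  case True
  then obtain j where j: "j < N" "x j \<noteq> 0" by auto
  then have "x i = 0" if "i < N" "i \<noteq> j" for i using assms[of i j] that by auto
  then have "(\<Sum>i<N. x i) = x j" "(\<Sum>i<N. (x i)\<^sup>2) = (x j)\<^sup>2"
    using j(1) by (auto simp: sum.remove[of "{..<N}" j])
  then show ?thesis by simp
next
  case False
  then show ?thesis by simp
qed

lemma Ioc_disjoint:
  fixes t :: "nat \<Rightarrow> real"
  assumes "\<And>i. i < N \<Longrightarrow> t i \<le> t (Suc i)" "i < N" "j < N" "i \<noteq> j" "s \<in> {t i<..t (Suc i)}"
  shows "s \<notin> {t j<..t (Suc j)}"
proof -
  have mono: "t k \<le> t l" if "k \<le> l" "l \<le> N" for k l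
    using that
  proof (induction rule: dec_induct)
    case (step l) then show ?case using assms(1)[of l] by simp
  qed simp
  show ?thesis
  proof (cases "i < j")
    case True then show ?thesis using mono[of "Suc i" j] assms by auto
  next
    case False then show ?thesis using mono[of "Suc j" i] assms by auto
  qed
qed

context brownian_motion
begin

text \<open>Martingale differences are orthogonal: the cross term has mean zero because
  \<open>\<psi> k S k\<close> is \<open>F (t k)\<close>-measurable and the increment factor is
  centred. Measurability of \<open>S k\<close> is therefore part of the induction. The lemma is
  applied with the identity and with the centred square for \<open>g\<close>.\<close>

lemma sum_increment_square_bound:
  fixes g :: "real \<Rightarrow> real"
  assumes t: "0 \<le> t 0" "\<And>i. i < N \<Longrightarrow> t i \<le> t (Suc i)"
    and \<psi>: "\<And>i. i < N \<Longrightarrow> \<psi> i \<in> borel_measurable (F (t i))"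
      "\<And>i \<omega>. i < N \<Longrightarrow> \<omega> \<in> space M \<Longrightarrow> \<bar>\<psi> i \<omega>\<bar> \<le> C"
    and g: "g \<in> borel_measurable borel"
      "\<And>i. i < N \<Longrightarrow> integrable M (\<lambda>\<omega>. (g (B (t (Suc i)) \<omega> - B (t i) \<omega>))\<^sup>2)"
      "\<And>i. i < N \<Longrightarrow> expectation (\<lambda>\<omega>. g (B (t (Suc i)) \<omega> - B (t i) \<omega>)) = 0"
      "\<And>i. i < N \<Longrightarrow> expectation (\<lambda>\<omega>. (g (B (t (Suc i)) \<omega> - B (t i) \<omega>))\<^sup>2) = v"
  defines "S k \<omega> \<equiv> \<Sum>i<k. \<psi> i \<omega> * g (B (t (Suc i)) \<omega> - B (t i) \<omega>)"
  assumes "k \<le> N"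
  shows "S k \<in> borel_measurable (F (t k)) \<and> integrable M (\<lambda>\<omega>. (S k \<omega>)\<^sup>2) \<and> expectation (S k) = 0 \<and>
    expectation (\<lambda>\<omega>. (S k \<omega>)\<^sup>2) \<le> C\<^sup>2 * real k * v"
  using \<open>k \<le> N\<close>
proof (induction k)
  case 0
  then show ?case by (simp add: S_def)
next
  case (Suc k)
  then have k: "k < N" by simp
  have tpos: "j \<le> N \<Longrightarrow> 0 \<le> t j" for j
  proof (induction j)
    case (Suc j) then show ?case using t(2)[of j] by simp
  qed (use t in simp)
  have tk: "0 \<le> t k" "t k \<le> t (Suc k)" using tpos[of k] t(2)[OF k] k by auto
  let ?D = "\<lambda>\<omega>. g (B (t (Suc k)) \<omega> - B (t k) \<omega>)"
  have D: "?D \<in> borel_measurable (F (t (Suc k)))"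
    using measurable_compose[OF increment_F_measurable[OF tk order_refl] g(1)] .
  note DM[measurable] = F_measurable_imp[OF order_trans[OF tk] D]
  have IH: "S k \<in> borel_measurable (F (t k))" "integrable M (\<lambda>\<omega>. (S k \<omega>)\<^sup>2)" "expectation (S k) = 0"
    "expectation (\<lambda>\<omega>. (S k \<omega>)\<^sup>2) \<le> C\<^sup>2 * real k * v"
    using Suc.IH k by auto
  note SM[measurable] = F_measurable_imp[OF tk(1) IH(1)]
  note \<psi>M[measurable] = F_measurable_imp[OF tk(1) \<psi>(1)[OF k]]
  have D1: "integrable M ?D" by (rule square_integrable_imp_integrable[OF DM g(2)[OF k]])
  have Si: "integrable M (S k)" by (rule square_integrable_imp_integrable[OF SM IH(2)])
  have bdd: "integrable M (\<lambda>\<omega>. \<psi> k \<omega> * Y \<omega>)" if "integrable M Y" for Y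
  proof (rule Bochner_Integration.integrable_bound[of _ "\<lambda>\<omega>. C * Y \<omega>"])
    show "AE \<omega> in M. norm (\<psi> k \<omega> * Y \<omega>) \<le> norm (C * Y \<omega>)"
      using \<psi>(2)[OF k] by (intro AE_I2) (force simp: abs_mult intro: mult_right_mono)
  qed (use that in auto)
  have \<psi>i: "integrable M (\<psi> k)" using bdd[of "\<lambda>_. 1"] by simp
  have Y: "integrable M (\<lambda>\<omega>. \<psi> k \<omega> * S k \<omega>)" by (rule bdd[OF Si])
  have Ym: "(\<lambda>\<omega>. \<psi> k \<omega> * S k \<omega>) \<in> borel_measurable (F (t k))"
    using IH(1) \<psi>(1)[OF k] by simp
  note c1 = integral_mult_increment[OF tk Ym Y g(1) D1]
  note c2 = integral_mult_increment[OF tk \<psi>(1)[OF k] \<psi>i g(1) D1]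
  have sq: "(\<psi> k \<omega> * ?D \<omega>)\<^sup>2 = \<psi> k \<omega> * (\<psi> k \<omega> * (?D \<omega>)\<^sup>2)" for \<omega>
    by (simp add: power2_eq_square)
  have c3: "integrable M (\<lambda>\<omega>. (\<psi> k \<omega> * ?D \<omega>)\<^sup>2)"
    unfolding sq by (intro bdd g(2) k)
  have "expectation (\<lambda>\<omega>. (\<psi> k \<omega> * ?D \<omega>)\<^sup>2) \<le> expectation (\<lambda>\<omega>. C\<^sup>2 * (?D \<omega>)\<^sup>2)"
  proof (rule integral_mono[OF c3])
    show "integrable M (\<lambda>\<omega>. C\<^sup>2 * (?D \<omega>)\<^sup>2)" using g(2)[OF k] by simp
    show "(\<psi> k \<omega> * ?D \<omega>)\<^sup>2 \<le> C\<^sup>2 * (?D \<omega>)\<^sup>2" if "\<omega> \<in> space M" for \<omega>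
      unfolding power_mult_distrib using \<psi>(2)[OF k that]
      by (intro mult_right_mono) (auto simp: abs_le_square_iff[symmetric])
  qed
  then have c4: "expectation (\<lambda>\<omega>. (\<psi> k \<omega> * ?D \<omega>)\<^sup>2) \<le> C\<^sup>2 * v"
    using g(4)[OF k] by simp
  have SS: "S (Suc k) = (\<lambda>\<omega>. S k \<omega> + \<psi> k \<omega> * ?D \<omega>)"
    by (simp add: S_def fun_eq_iff)
  have eq: "(S (Suc k) \<omega>)\<^sup>2 = (S k \<omega>)\<^sup>2 + 2 * (\<psi> k \<omega> * S k \<omega> * ?D \<omega>) + (\<psi> k \<omega> * ?D \<omega>)\<^sup>2" for \<omega>
    unfolding SS by (simp add: power2_eq_square algebra_simps)
  have m: "S (Suc k) \<in> borel_measurable (F (t (Suc k)))"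
    unfolding SS by (intro borel_measurable_add borel_measurable_times D F_measurable_mono[OF tk] IH(1) \<psi>(1) k)
  have "expectation (S (Suc k)) = 0"
    unfolding SS using Si c2 IH(3) g(3)[OF k] by simp
  moreover have "integrable M (\<lambda>\<omega>. (S (Suc k) \<omega>)\<^sup>2)"
    unfolding eq using IH(2) c1 c3 by simp
  moreover have "expectation (\<lambda>\<omega>. (S (Suc k) \<omega>)\<^sup>2) \<le> C\<^sup>2 * real (Suc k) * v"
    unfolding eq using IH(2,4) c1 c3 c4 g(3)[OF k] by (simp add: algebra_simps)
  ultimately show ?case using m by blast
qed

text \<open>Two integrals started at time 0 and one elementary step combine into a single integral
  over \<open>(t0, t1]\<close>, whose integrand is the error of freezing \<open>S\<close> at
  \<open>t0\<close>.\<close>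

lemma ito_increment_error:
  assumes N: "0 \<le> t0" "t0 \<le> t1"
    and I: "has_ito_integral M F B t0 S I0" "has_ito_integral M F B t1 S I1"
    and S: "S t0 \<in> borel_measurable (F t0)" "\<And>\<omega>. \<omega> \<in> space M \<Longrightarrow> \<bar>S t0 \<omega>\<bar> \<le> C"
  shows "ito_closure (\<lambda>(\<omega>, s). indicator {t0<..t1} s * (S s \<omega> - S t0 \<omega>))
    (\<lambda>\<omega>. I1 \<omega> - I0 \<omega> - S t0 \<omega> * (B t1 \<omega> - B t0 \<omega>))"
proof -
  have t1: "0 \<le> t1" using N by simp
  note a1 = has_ito_integral_ito[OF I(2) t1]
  note a2 = ito_uminus[OF has_ito_integral_ito[OF I(1) N(1)]]
  note a3 = ito_uminus[OF ito_elementary[OF elementary_step[OF N S]]]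
  from ito_add[OF ito_add[OF a1 a2] a3]
  have "ito_closure (\<lambda>z. (case z of (\<omega>, s) \<Rightarrow> indicator {0<..t1} s * S s \<omega>) + - (case z of (\<omega>, s) \<Rightarrow> indicator {0<..t0} s * S s \<omega>)
      + - (case z of (\<omega>, s) \<Rightarrow> S t0 \<omega> * indicator {t0<..t1} s))
    (\<lambda>\<omega>. I1 \<omega> + - I0 \<omega> + - (S t0 \<omega> * (B t1 \<omega> - B t0 \<omega>)))" .
  also have "(\<lambda>z. (case z of (\<omega>, s) \<Rightarrow> indicator {0<..t1} s * S s \<omega>) + - (case z of (\<omega>, s) \<Rightarrow> indicator {0<..t0} s * S s \<omega>)
      + - (case z of (\<omega>, s) \<Rightarrow> S t0 \<omega> * indicator {t0<..t1} s))
     = (\<lambda>(\<omega>, s). indicator {t0<..t1} s * (S s \<omega> - S t0 \<omega>))"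
    using N by (auto simp: fun_eq_iff indicator_def)
  finally show ?thesis by simp
qed

text \<open>\<open>\<epsilon>\<close> is the mean-square error of freezing \<open>S\<close> at the
  left end points. The last bound carries no factor \<open>N\<close>: each \<open>Z i\<close> moves
  inside an integral of a process supported after \<open>t i\<close>, and the supports for different
  \<open>i\<close> are disjoint, so the square of the sum is the sum of the squares.\<close>

lemma discretization_error_bounds:
  assumes t: "0 \<le> t 0" "\<And>i. i < N \<Longrightarrow> t i \<le> t (Suc i)"
    and I: "\<And>i. i \<le> N \<Longrightarrow> has_ito_integral M F B (t i) S (I i)"
    and S: "\<And>i. i < N \<Longrightarrow> S (t i) \<in> borel_measurable (F (t i))"
      "\<And>s \<omega>. \<omega> \<in> space M \<Longrightarrow> \<bar>S s \<omega>\<bar> \<le> K"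
  defines "e i \<omega> \<equiv> I (Suc i) \<omega> - I i \<omega> - S (t i) \<omega> * (B (t (Suc i)) \<omega> - B (t i) \<omega>)"
    and "\<epsilon> \<equiv> \<integral>\<^sup>+\<omega>. (\<integral>\<^sup>+s. ennreal (\<Sum>i<N. indicator {t i<..t (Suc i)} s * (S s \<omega> - S (t i) \<omega>)\<^sup>2) \<partial>lborel) \<partial>M"
  shows "\<And>i. i < N \<Longrightarrow> e i \<in> borel_measurable M"
    and "(\<lambda>\<omega>. \<integral>\<^sup>+s. ennreal (\<Sum>i<N. indicator {t i<..t (Suc i)} s * (S s \<omega> - S (t i) \<omega>)\<^sup>2) \<partial>lborel)
      \<in> borel_measurable M"
    and "(\<integral>\<^sup>+\<omega>. ennreal (\<Sum>i<N. (e i \<omega>)\<^sup>2) \<partial>M) \<le> 4 * \<epsilon>"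
    and "\<And>Z C. (\<And>i. i < N \<Longrightarrow> Z i \<in> borel_measurable (F (t i))) \<Longrightarrow>
        (\<And>i \<omega>. i < N \<Longrightarrow> \<omega> \<in> space M \<Longrightarrow> \<bar>Z i \<omega>\<bar> \<le> C) \<Longrightarrow>
        (mean_square M (\<lambda>\<omega>. \<Sum>i<N. Z i \<omega> * e i \<omega>)) \<le> 4 * ennreal (C\<^sup>2) * \<epsilon>"
proof -
  have tpos: "j \<le> N \<Longrightarrow> 0 \<le> t j" for j
  proof (induction j)
    case (Suc j) then show ?case using t(2)[of j] by simp
  qed (use t in simp)
  define P :: "nat \<Rightarrow> 'a \<times> real \<Rightarrow> real"
    where "P i = (\<lambda>(\<omega>, s). indicator {t i<..t (Suc i)} s * (S s \<omega> - S (t i) \<omega>))" for i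
  have ito_closure: "ito_closure (P i) (e i)" if "i < N" for i
    unfolding P_def e_def using that tpos[of i] t(2)[of i] I[of i] I[of "Suc i"] S
    by (intro ito_increment_error) auto
  note meas = ito_measurable[OF ito_closure]
  show em: "e i \<in> borel_measurable M" if "i < N" for i using meas(2)[OF that] .
  have sqP: "(P i (\<omega>, s))\<^sup>2 = indicator {t i<..t (Suc i)} s * (S s \<omega> - S (t i) \<omega>)\<^sup>2" for i \<omega> s
    by (auto simp: P_def indicator_def)
  have sumP_meas: "(\<lambda>z. ennreal (\<Sum>i<N. (P i z)\<^sup>2)) \<in> borel_measurable (M \<Otimes>\<^sub>M lborel)"
      using meas(1) by (intro measurable_compose[OF _ measurable_ennreal] borel_measurable_sum borel_measurable_power) auto
  from lborel.borel_measurable_nn_integral_fst[OF this]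
  show "(\<lambda>\<omega>. \<integral>\<^sup>+s. ennreal (\<Sum>i<N. indicator {t i<..t (Suc i)} s * (S s \<omega> - S (t i) \<omega>)\<^sup>2) \<partial>lborel)
      \<in> borel_measurable M"
    by (simp add: sqP)
  have \<epsilon>: "\<epsilon> = (\<integral>\<^sup>+z. ennreal (\<Sum>i<N. (P i z)\<^sup>2) \<partial>(M \<Otimes>\<^sub>M lborel))"
    using lborel.nn_integral_fst[OF sumP_meas] unfolding \<epsilon>_def sqP by simp
  have sumP: "\<epsilon> = (\<Sum>i<N. mean_square (M \<Otimes>\<^sub>M lborel) (P i))"
  proof -
    have "\<epsilon> = (\<integral>\<^sup>+z. (\<Sum>i<N. ennreal ((P i z)\<^sup>2)) \<partial>(M \<Otimes>\<^sub>M lborel))"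
      unfolding \<epsilon> by (simp add: sum_ennreal)
    also have "\<dots> = (\<Sum>i<N. mean_square (M \<Otimes>\<^sub>M lborel) (P i))"
      using meas(1) by (intro nn_integral_sum measurable_compose[OF _ measurable_ennreal] borel_measurable_power) auto
    finally show ?thesis .
  qed
  have "(\<integral>\<^sup>+\<omega>. ennreal (\<Sum>i<N. (e i \<omega>)\<^sup>2) \<partial>M) = (\<integral>\<^sup>+\<omega>. (\<Sum>i<N. ennreal ((e i \<omega>)\<^sup>2)) \<partial>M)"
    by (simp add: sum_ennreal)
  also have "\<dots> = (\<Sum>i<N. mean_square M (e i))"
    using em by (intro nn_integral_sum measurable_compose[OF _ measurable_ennreal] borel_measurable_power) auto
  also have "\<dots> \<le> (\<Sum>i<N. 4 * mean_square (M \<Otimes>\<^sub>M lborel) (P i))"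
    using ito_bound[OF ito_closure] by (intro sum_mono) auto
  finally show "(\<integral>\<^sup>+\<omega>. ennreal (\<Sum>i<N. (e i \<omega>)\<^sup>2) \<partial>M) \<le> 4 * \<epsilon>"
    unfolding sumP by (simp add: sum_distrib_left)
  fix Z :: "nat \<Rightarrow> 'a \<Rightarrow> real" and C :: real
  assume Z: "\<And>i. i < N \<Longrightarrow> Z i \<in> borel_measurable (F (t i))"
    "\<And>i \<omega>. i < N \<Longrightarrow> \<omega> \<in> space M \<Longrightarrow> \<bar>Z i \<omega>\<bar> \<le> C"
  have "ito_closure (\<lambda>z. case z of (\<omega>, s) \<Rightarrow> Z i \<omega> * P i (\<omega>, s)) (\<lambda>\<omega>. Z i \<omega> * e i \<omega>)" if i: "i < N" for i
    by (rule ito_mult[OF ito_closure[OF i] tpos[of i]]) (use i Z in \<open>auto simp: P_def\<close>)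
  from ito_bound[OF ito_sum[of N, OF this]]
  have "mean_square M (\<lambda>\<omega>. \<Sum>i<N. Z i \<omega> * e i \<omega>)
    \<le> 4 * mean_square (M \<Otimes>\<^sub>M lborel) (\<lambda>z. \<Sum>i<N. case z of (\<omega>, s) \<Rightarrow> Z i \<omega> * P i (\<omega>, s))" .
  also have "\<dots> \<le> 4 * (\<integral>\<^sup>+z. ennreal (C\<^sup>2) * ennreal (\<Sum>i<N. (P i z)\<^sup>2) \<partial>(M \<Otimes>\<^sub>M lborel))"
  proof (intro mult_left_mono nn_integral_mono)
    fix z :: "'a \<times> real" assume "z \<in> space (M \<Otimes>\<^sub>M lborel)"
    then obtain \<omega> s where z: "z = (\<omega>, s)" "\<omega> \<in> space M" by (auto simp: space_pair_measure)
    have "(\<Sum>i<N. Z i \<omega> * P i (\<omega>, s))\<^sup>2 = (\<Sum>i<N. (Z i \<omega> * P i (\<omega>, s))\<^sup>2)"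
    proof (rule sum_square_disjoint)
      fix i j assume "i < N" "j < N" "i \<noteq> j"
      then show "Z i \<omega> * P i (\<omega>, s) = 0 \<or> Z j \<omega> * P j (\<omega>, s) = 0"
        using Ioc_disjoint[where t=t and N=N and i=i and j=j and s=s, OF t(2)] by (auto simp: P_def indicator_def)
    qed
    also have "\<dots> \<le> (\<Sum>i<N. C\<^sup>2 * (P i (\<omega>, s))\<^sup>2)"
      unfolding power_mult_distrib using order_trans[OF Z(2)[OF _ z(2)] abs_ge_self]
      by (intro sum_mono mult_right_mono) (auto simp: abs_le_square_iff[symmetric])
    finally have "(\<Sum>i<N. Z i \<omega> * P i (\<omega>, s))\<^sup>2 \<le> C\<^sup>2 * (\<Sum>i<N. (P i (\<omega>, s))\<^sup>2)"
      by (simp add: sum_distrib_left)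
    then show "ennreal ((\<Sum>i<N. case z of (\<omega>, s) \<Rightarrow> Z i \<omega> * P i (\<omega>, s))\<^sup>2) \<le> ennreal (C\<^sup>2) * ennreal (\<Sum>i<N. (P i z)\<^sup>2)"
      by (simp add: z ennreal_mult[symmetric] sum_nonneg ennreal_leI)
  qed simp
  also have "(\<integral>\<^sup>+z. ennreal (C\<^sup>2) * ennreal (\<Sum>i<N. (P i z)\<^sup>2) \<partial>(M \<Otimes>\<^sub>M lborel)) = ennreal (C\<^sup>2) * \<epsilon>"
    unfolding \<epsilon> using meas(1)
    by (intro nn_integral_cmult measurable_compose[OF _ measurable_ennreal] borel_measurable_sum borel_measurable_power) auto
  finally show "mean_square M (\<lambda>\<omega>. \<Sum>i<N. Z i \<omega> * e i \<omega>) \<le> 4 * ennreal (C\<^sup>2) * \<epsilon>"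
    by (simp add: mult.assoc)
qed

end

lemma nn_integral_grid_le:
  fixes x :: "nat \<Rightarrow> real \<Rightarrow> real"
  assumes "N > 0" "0 \<le> c" and le: "\<And>i s. i < N \<Longrightarrow> s \<in> {grid N i<..grid N (Suc i)} \<Longrightarrow> x i s \<le> c"
  shows "(\<integral>\<^sup>+s. ennreal (\<Sum>i<N. indicator {grid N i<..grid N (Suc i)} s * x i s) \<partial>lborel) \<le> ennreal c"
proof -
  have "(\<integral>\<^sup>+s. ennreal (\<Sum>i<N. indicator {grid N i<..grid N (Suc i)} s * x i s) \<partial>lborel)
    \<le> (\<integral>\<^sup>+s. (\<Sum>i<N. ennreal c * indicator {grid N i<..grid N (Suc i)} s) \<partial>lborel)"
  proof (intro nn_integral_mono)
    fix s
    have "(\<Sum>i<N. indicator {grid N i<..grid N (Suc i)} s * x i s) \<le> (\<Sum>i<N. c * indicator {grid N i<..grid N (Suc i)} s)"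
      using le by (intro sum_mono) (auto simp: indicator_def)
    then have "ennreal (\<Sum>i<N. indicator {grid N i<..grid N (Suc i)} s * x i s) \<le> ennreal (\<Sum>i<N. c * indicator {grid N i<..grid N (Suc i)} s)"
      by (rule ennreal_leI)
    also have "\<dots> = (\<Sum>i<N. ennreal (c * indicator {grid N i<..grid N (Suc i)} s))"
      using assms(2) by (intro sum_ennreal[symmetric]) auto
    also have "\<dots> = (\<Sum>i<N. ennreal c * indicator {grid N i<..grid N (Suc i)} s)"
      by (intro sum.cong refl) (auto simp: indicator_def)
    finally show "ennreal (\<Sum>i<N. indicator {grid N i<..grid N (Suc i)} s * x i s)
      \<le> (\<Sum>i<N. ennreal c * indicator {grid N i<..grid N (Suc i)} s)" .
  qed
  also have "\<dots> = (\<Sum>i<N. ennreal c * ennreal (1 / real N))"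
  proof (subst nn_integral_sum)
    have "(\<integral>\<^sup>+s. ennreal c * indicator {grid N i<..grid N (Suc i)} s \<partial>lborel) = ennreal c * ennreal (1 / real N)" for i
      using grid_simps(3)[of N i] by (simp add: nn_integral_cmult_indicator grid_diff)
    then show "(\<Sum>i<N. \<integral>\<^sup>+s. ennreal c * indicator {grid N i<..grid N (Suc i)} s \<partial>lborel)
      = (\<Sum>i<N. ennreal c * ennreal (1 / real N))"
      by (rule sum.cong[OF refl])
  qed simp
  also have "\<dots> = ennreal c"
    using assms(1,2) by (simp add: ennreal_of_nat_eq_real_of_nat ennreal_mult[symmetric])
  finally show ?thesis .
qed

context prob_space
begin

text \<open>Uniform continuity of almost every path on \<open>[0, 1]\<close> makes
  \<open>h n\<close> tend to zero, and since \<open>S\<close> is bounded by \<open>K\<close> the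
  constant \<open>(2 K)\<^sup>2\<close> dominates.\<close>

lemma discretization_error_tendsto:
  assumes cont: "AE \<omega> in M. continuous_on {0..1} (\<lambda>s. S s \<omega>)"
    and K: "\<And>s \<omega>. \<omega> \<in> space M \<Longrightarrow> \<bar>S s \<omega>\<bar> \<le> (K::real)"
  defines "h n \<omega> \<equiv> \<integral>\<^sup>+s. ennreal (\<Sum>i<Suc n. indicator {grid (Suc n) i<..grid (Suc n) (Suc i)} s *
      (S s \<omega> - S (grid (Suc n) i) \<omega>)\<^sup>2) \<partial>lborel"
  assumes [measurable]: "\<And>n. h n \<in> borel_measurable M"
  shows "(\<lambda>n. \<integral>\<^sup>+\<omega>. h n \<omega> \<partial>M) \<longlonglongrightarrow> 0"
proof -
  have "(\<lambda>n. \<integral>\<^sup>+\<omega>. h n \<omega> \<partial>M) \<longlonglongrightarrow> (\<integral>\<^sup>+\<omega>. 0 \<partial>M)"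
  proof (rule nn_integral_dominated_convergence[where w="\<lambda>_. ennreal ((2 * K)\<^sup>2)"])
    show "AE \<omega> in M. h n \<omega> \<le> ennreal ((2 * K)\<^sup>2)" for n
    proof (rule AE_I2)
      fix \<omega> assume \<omega>: "\<omega> \<in> space M"
      show "h n \<omega> \<le> ennreal ((2 * K)\<^sup>2)"
        unfolding h_def
      proof (rule nn_integral_grid_le)
        fix i s
        have "\<bar>S s \<omega> - S (grid (Suc n) i) \<omega>\<bar> \<le> 2 * K"
          using K[OF \<omega>, of s] K[OF \<omega>, of "grid (Suc n) i"] by linarith
        then show "(S s \<omega> - S (grid (Suc n) i) \<omega>)\<^sup>2 \<le> (2 * K)\<^sup>2"
          using abs_le_square_iff by fastforce
      qed auto
    qed
    show "AE \<omega> in M. (\<lambda>n. h n \<omega>) \<longlonglongrightarrow> 0"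
      using cont
    proof eventually_elim
      case (elim \<omega>)
      have uc: "uniformly_continuous_on {0..1} (\<lambda>s. S s \<omega>)"
        by (rule compact_uniformly_continuous[OF elim]) simp
      show ?case unfolding ennreal_tendsto_zero_iff
      proof (intro allI impI)
        fix e :: real assume e: "e > 0"
        then obtain d where d: "d > 0" "\<And>s s'. s \<in> {0..1} \<Longrightarrow> s' \<in> {0..1} \<Longrightarrow> dist s' s < d \<Longrightarrow> dist (S s' \<omega>) (S s \<omega>) < sqrt e"
          using uc unfolding uniformly_continuous_on_def by (metis real_sqrt_gt_0_iff)
        obtain m where m: "1 / d < real m" using reals_Archimedean2 by blast
        show "\<forall>\<^sub>F n in sequentially. h n \<omega> \<le> ennreal e"
          using eventually_ge_at_top[of m]
        proof eventually_elim
          case (elim n)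
          have "1 / d < real (Suc n)" using m elim by simp
          then have n: "1 / real (Suc n) < d" using d(1) by (simp add: field_simps)
          show ?case unfolding h_def
          proof (rule nn_integral_grid_le)
            fix i s assume i: "i < Suc n" "s \<in> {grid (Suc n) i<..grid (Suc n) (Suc i)}"
            have "s \<in> {0..1}" "grid (Suc n) i \<in> {0..1}"
              using i grid_le_one[of i "Suc n"] grid_le_one[of "Suc i" "Suc n"] grid_simps(2)[of "Suc n" i] by auto
            moreover have "dist (grid (Suc n) i) s < d"
              using i(2) grid_diff[of "Suc n" i] n by (auto simp: dist_real_def)
            ultimately have "dist (S (grid (Suc n) i) \<omega>) (S s \<omega>) < sqrt e" by (intro d(2))
            then have "\<bar>S s \<omega> - S (grid (Suc n) i) \<omega>\<bar> \<le> sqrt e" by (simp add: dist_real_def)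
            then have "\<bar>S s \<omega> - S (grid (Suc n) i) \<omega>\<bar>\<^sup>2 \<le> (sqrt e)\<^sup>2" by (intro power_mono) auto
            then show "(S s \<omega> - S (grid (Suc n) i) \<omega>)\<^sup>2 \<le> e" using e by simp
          qed (use e in auto)
        qed
      qed
    qed
    show "h n \<in> borel_measurable M" for n by measurable
  qed (auto simp: emeasure_space_1)
  then show ?thesis by simp
qed

end

lemma set_integral_combine:
  fixes g :: "real \<Rightarrow> real"
  assumes g: "continuous_on {0..} g" and uv: "0 \<le> u" "u \<le> v"
  shows "(LINT s:{0..v}|lborel. g s) = (LINT s:{0..u}|lborel. g s) + (LINT s:{u..v}|lborel. g s)"
proof -
  have c: "continuous_on {a..b} g" if "0 \<le> a" for a b
    by (rule continuous_on_subset[OF g]) (use that in auto)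
  have eq: "(LINT s:{a..b}|lborel. g s) = integral {a..b} g" if "0 \<le> a" for a b
    by (rule set_borel_integral_eq_integral(2)[OF borel_integrable_atLeastAtMost'[OF c[OF that]]])
  show ?thesis
    using Henstock_Kurzweil_Integration.integral_combine[OF uv integrable_continuous_real[OF c]] uv
    by (simp add: eq)
qed

context prob_space
begin

lemma null_in_prob_cmult:
  assumes "null_in_prob Y"
  shows "null_in_prob (\<lambda>n \<omega>. c * Y n \<omega>)"
proof -
  have [measurable]: "Y n \<in> borel_measurable M" for n using assms unfolding null_in_prob_def by simp
  have "(\<lambda>n. \<integral>\<^sup>+\<omega>. ennreal (min 1 \<bar>c * Y n \<omega>\<bar>) \<partial>M) \<longlonglongrightarrow> 0"
  proof (rule tendsto_zero_ennreal_le)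
    show "(\<lambda>n. ennreal (1 + \<bar>c\<bar>) * (\<integral>\<^sup>+\<omega>. ennreal (min 1 \<bar>Y n \<omega>\<bar>) \<partial>M)) \<longlonglongrightarrow> 0"
      using assms unfolding null_in_prob_def by (intro tendsto_zero_ennreal_cmult) auto
    have "min 1 \<bar>c * y\<bar> \<le> (1 + \<bar>c\<bar>) * min 1 \<bar>y\<bar>" for y :: real
    proof (cases "\<bar>y\<bar> \<le> 1")
      case True
      then show ?thesis by (auto simp: abs_mult ring_distribs min_def)
    qed simp
    then have "ennreal (min 1 \<bar>c * y\<bar>) \<le> ennreal (1 + \<bar>c\<bar>) * ennreal (min 1 \<bar>y\<bar>)" for y :: real
      by (simp add: ennreal_mult[symmetric] ennreal_leI del: ennreal_plus)
    then have "(\<integral>\<^sup>+\<omega>. ennreal (min 1 \<bar>c * Y n \<omega>\<bar>) \<partial>M) \<le> (\<integral>\<^sup>+\<omega>. ennreal (1 + \<bar>c\<bar>) * ennreal (min 1 \<bar>Y n \<omega>\<bar>) \<partial>M)" for n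
      by (intro nn_integral_mono)
    then show "(\<integral>\<^sup>+\<omega>. ennreal (min 1 \<bar>c * Y n \<omega>\<bar>) \<partial>M) \<le> ennreal (1 + \<bar>c\<bar>) * (\<integral>\<^sup>+\<omega>. ennreal (min 1 \<bar>Y n \<omega>\<bar>) \<partial>M)" for n
      by (simp add: nn_integral_cmult)
  qed
  then show ?thesis unfolding null_in_prob_def by simp
qed

end

context brownian_motion
begin

lemma nn_integral_increment_power:
  assumes "0 \<le> s" "s \<le> t"
  shows "mean_square M (\<lambda>\<omega>. B t \<omega> - B s \<omega>) = ennreal (t - s)"
    and "(\<integral>\<^sup>+\<omega>. ennreal ((B t \<omega> - B s \<omega>) ^ 4) \<partial>M) = ennreal (3 * (t - s)\<^sup>2)"
  using integrable_increment_power[OF assms] increment_variance[OF assms] increment_fourth_moment[OF assms]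
  by (simp_all add: nn_integral_eq_integral)

text \<open>Young's inequality with weight \<open>\<eta>\<close> gives \<open>\<bar>e\<bar>
  \<bar>d\<bar> \<le> e\<^sup>2 / \<eta> + \<eta> d\<^sup>2\<close> and
  \<open>\<bar>d\<bar>^3 \<le> d^4 / \<eta> + \<eta> d\<^sup>2\<close>. The squared increments have
  total mean 1 and the fourth powers total mean \<open>3 / N\<close>, whence
  \<open>2 \<eta> + 3 / (N \<eta>)\<close>.\<close>

lemma remainder_L1_bound:
  assumes N: "N > 0" and [measurable]: "\<And>i. i < N \<Longrightarrow> e i \<in> borel_measurable M" and \<eta>: "\<eta> > 0"
  defines "d i \<omega> \<equiv> B (grid N (Suc i)) \<omega> - B (grid N i) \<omega>"
  shows "(\<integral>\<^sup>+\<omega>. ennreal (\<Sum>i<N. (e i \<omega>)\<^sup>2 + \<bar>e i \<omega>\<bar> * \<bar>d i \<omega>\<bar> + \<bar>d i \<omega>\<bar> ^ 3) \<partial>M)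
    \<le> ennreal (1 + 1 / \<eta>) * (\<integral>\<^sup>+\<omega>. ennreal (\<Sum>i<N. (e i \<omega>)\<^sup>2) \<partial>M) + ennreal (2 * \<eta> + 3 / (real N * \<eta>))"
proof -
  have d[measurable]: "d i \<in> borel_measurable M" for i
    unfolding d_def by (intro borel_measurable_diff B_measurable grid_simps)
  have young: "\<bar>x\<bar> * \<bar>y\<bar> \<le> x\<^sup>2 / \<eta> + \<eta> * y\<^sup>2" for x y :: real
  proof -
    have "0 \<le> (x\<^sup>2 / \<eta> + \<eta> * y\<^sup>2) - \<bar>x\<bar> * \<bar>y\<bar>"
    proof -
      have "0 \<le> (\<bar>x\<bar> - \<eta> * \<bar>y\<bar>)\<^sup>2 + \<eta> * (\<bar>x\<bar> * \<bar>y\<bar>)" using \<eta> by simp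
      also have "\<dots> = x\<^sup>2 + \<eta> * \<eta> * y\<^sup>2 - \<eta> * (\<bar>x\<bar> * \<bar>y\<bar>)"
        by (simp add: power2_diff power_mult_distrib algebra_simps) (simp add: power2_eq_square)
      finally have "0 \<le> (x\<^sup>2 + \<eta> * \<eta> * y\<^sup>2 - \<eta> * (\<bar>x\<bar> * \<bar>y\<bar>)) / \<eta>" using \<eta> by simp
      also have "\<dots> = (x\<^sup>2 / \<eta> + \<eta> * y\<^sup>2) - \<bar>x\<bar> * \<bar>y\<bar>" using \<eta> by (simp add: field_simps)
      finally show ?thesis .
    qed
    then show ?thesis by simp
  qed
  have cube: "\<bar>y\<bar> ^ 3 \<le> y ^ 4 / \<eta> + \<eta> * y\<^sup>2" for y :: real
    using young[of "y\<^sup>2" y] by (simp add: power3_eq_cube power2_eq_square power4_eq_xxxx mult.assoc abs_mult)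
  have pt: "ennreal (\<Sum>i<N. (e i \<omega>)\<^sup>2 + \<bar>e i \<omega>\<bar> * \<bar>d i \<omega>\<bar> + \<bar>d i \<omega>\<bar> ^ 3)
    \<le> ennreal (1 + 1 / \<eta>) * ennreal (\<Sum>i<N. (e i \<omega>)\<^sup>2) + (\<Sum>i<N. ennreal (2 * \<eta>) * ennreal ((d i \<omega>)\<^sup>2) + ennreal (1 / \<eta>) * ennreal ((d i \<omega>) ^ 4))"
    (is "_ \<le> ?r \<omega>") for \<omega>
  proof -
    have "(\<Sum>i<N. (e i \<omega>)\<^sup>2 + \<bar>e i \<omega>\<bar> * \<bar>d i \<omega>\<bar> + \<bar>d i \<omega>\<bar> ^ 3)
      \<le> (\<Sum>i<N. (1 + 1 / \<eta>) * (e i \<omega>)\<^sup>2 + (2 * \<eta> * (d i \<omega>)\<^sup>2 + 1 / \<eta> * (d i \<omega>) ^ 4))"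
    proof (rule sum_mono)
      fix i
      show "(e i \<omega>)\<^sup>2 + \<bar>e i \<omega>\<bar> * \<bar>d i \<omega>\<bar> + \<bar>d i \<omega>\<bar> ^ 3
        \<le> (1 + 1 / \<eta>) * (e i \<omega>)\<^sup>2 + (2 * \<eta> * (d i \<omega>)\<^sup>2 + 1 / \<eta> * (d i \<omega>) ^ 4)"
        using young[of "e i \<omega>" "d i \<omega>"] cube[of "d i \<omega>"] by (simp add: ring_distribs)
    qed
    also have "\<dots> = (1 + 1 / \<eta>) * (\<Sum>i<N. (e i \<omega>)\<^sup>2) + (\<Sum>i<N. 2 * \<eta> * (d i \<omega>)\<^sup>2 + 1 / \<eta> * (d i \<omega>) ^ 4)"
      by (simp only: sum.distrib sum_distrib_left)
    finally have "ennreal (\<Sum>i<N. (e i \<omega>)\<^sup>2 + \<bar>e i \<omega>\<bar> * \<bar>d i \<omega>\<bar> + \<bar>d i \<omega>\<bar> ^ 3)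
      \<le> ennreal ((1 + 1 / \<eta>) * (\<Sum>i<N. (e i \<omega>)\<^sup>2) + (\<Sum>i<N. 2 * \<eta> * (d i \<omega>)\<^sup>2 + 1 / \<eta> * (d i \<omega>) ^ 4))"
      by (rule ennreal_leI)
    also have "\<dots> = ennreal (1 + 1 / \<eta>) * ennreal (\<Sum>i<N. (e i \<omega>)\<^sup>2) + ennreal (\<Sum>i<N. 2 * \<eta> * (d i \<omega>)\<^sup>2 + 1 / \<eta> * (d i \<omega>) ^ 4)"
      using \<eta> by (subst ennreal_plus) (auto intro!: sum_nonneg mult_nonneg_nonneg add_nonneg_nonneg simp: ennreal_mult sum_nonneg simp del: ennreal_plus)
    also have "ennreal (\<Sum>i<N. 2 * \<eta> * (d i \<omega>)\<^sup>2 + 1 / \<eta> * (d i \<omega>) ^ 4)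
      = (\<Sum>i<N. ennreal (2 * \<eta> * (d i \<omega>)\<^sup>2 + 1 / \<eta> * (d i \<omega>) ^ 4))"
      using \<eta> by (intro sum_ennreal[symmetric]) auto
    also have "\<dots> = (\<Sum>i<N. ennreal (2 * \<eta>) * ennreal ((d i \<omega>)\<^sup>2) + ennreal (1 / \<eta>) * ennreal ((d i \<omega>) ^ 4))"
      using \<eta> by (intro sum.cong refl) (subst ennreal_plus, auto simp: ennreal_mult[symmetric])
    finally show ?thesis .
  qed
  have "(\<integral>\<^sup>+\<omega>. ennreal (\<Sum>i<N. (e i \<omega>)\<^sup>2 + \<bar>e i \<omega>\<bar> * \<bar>d i \<omega>\<bar> + \<bar>d i \<omega>\<bar> ^ 3) \<partial>M) \<le> (\<integral>\<^sup>+\<omega>. ?r \<omega> \<partial>M)"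
    by (intro nn_integral_mono pt)
  also have "\<dots> = ennreal (1 + 1 / \<eta>) * (\<integral>\<^sup>+\<omega>. ennreal (\<Sum>i<N. (e i \<omega>)\<^sup>2) \<partial>M) +
     (\<Sum>i<N. ennreal (2 * \<eta>) * mean_square M (d i) + ennreal (1 / \<eta>) * (\<integral>\<^sup>+\<omega>. ennreal ((d i \<omega>) ^ 4) \<partial>M))"
    by (simp add: nn_integral_add nn_integral_cmult nn_integral_sum)
  also have "(\<Sum>i<N. ennreal (2 * \<eta>) * mean_square M (d i) + ennreal (1 / \<eta>) * (\<integral>\<^sup>+\<omega>. ennreal ((d i \<omega>) ^ 4) \<partial>M))
    = (\<Sum>i<N. ennreal (2 * \<eta> * (1 / real N) + 1 / \<eta> * (3 * (1 / real N)\<^sup>2)))"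
    using \<eta> unfolding d_def nn_integral_increment_power[OF grid_simps(2,3)] grid_diff
    by (intro sum.cong refl, subst ennreal_plus) (auto simp: ennreal_mult[symmetric])
  also have "\<dots> = ennreal (\<Sum>i<N. 2 * \<eta> * (1 / real N) + 1 / \<eta> * (3 * (1 / real N)\<^sup>2))"
    using \<eta> by (intro sum_ennreal) auto
  also have "(\<Sum>i<N. 2 * \<eta> * (1 / real N) + 1 / \<eta> * (3 * (1 / real N)\<^sup>2)) = 2 * \<eta> + 3 / (real N * \<eta>)"
    using N \<eta> by (simp add: field_simps power2_eq_square)
  finally show ?thesis .
qed

lemma remainder_L1_tendsto:
  assumes [measurable]: "\<And>n i. i < Suc n \<Longrightarrow> e n i \<in> borel_measurable M"
    and lim: "(\<lambda>n. \<integral>\<^sup>+\<omega>. ennreal (\<Sum>i<Suc n. (e n i \<omega>)\<^sup>2) \<partial>M) \<longlonglongrightarrow> 0"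
  defines "d n i \<omega> \<equiv> B (grid (Suc n) (Suc i)) \<omega> - B (grid (Suc n) i) \<omega>"
  shows "(\<lambda>n. \<integral>\<^sup>+\<omega>. ennreal (\<Sum>i<Suc n. (e n i \<omega>)\<^sup>2 + \<bar>e n i \<omega>\<bar> * \<bar>d n i \<omega>\<bar> + \<bar>d n i \<omega>\<bar> ^ 3) \<partial>M) \<longlonglongrightarrow> 0"
  unfolding ennreal_tendsto_zero_iff
proof (intro allI impI)
  fix r :: real assume r: "r > 0"
  \<comment> \<open>The additive constant of the bound is \<open>2 \<eta> = r / 4\<close> plus a
    term that is at most \<open>r / 4\<close> for large \<open>n\<close>; together they use half of
    \<open>r\<close>.\<close>
  define \<eta> where "\<eta> = r / 8"
  have \<eta>: "\<eta> > 0" using r by (simp add: \<eta>_def)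
  have "(\<lambda>n. ennreal (1 + 1 / \<eta>) * (\<integral>\<^sup>+\<omega>. ennreal (\<Sum>i<Suc n. (e n i \<omega>)\<^sup>2) \<partial>M)) \<longlonglongrightarrow> 0"
    by (rule tendsto_zero_ennreal_cmult[OF lim]) simp
  then have ev: "\<forall>\<^sub>F n in sequentially. ennreal (1 + 1 / \<eta>) * (\<integral>\<^sup>+\<omega>. ennreal (\<Sum>i<Suc n. (e n i \<omega>)\<^sup>2) \<partial>M) \<le> ennreal (r / 2)"
    using r unfolding ennreal_tendsto_zero_iff by simp
  obtain m where m: "3 / (\<eta> * (r / 4)) < real m" using reals_Archimedean2 by blast
  show "\<forall>\<^sub>F n in sequentially. (\<integral>\<^sup>+\<omega>. ennreal (\<Sum>i<Suc n. (e n i \<omega>)\<^sup>2 + \<bar>e n i \<omega>\<bar> * \<bar>d n i \<omega>\<bar> + \<bar>d n i \<omega>\<bar> ^ 3) \<partial>M) \<le> ennreal r"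
    using ev eventually_ge_at_top[of m]
  proof eventually_elim
    case (elim n)
    have "3 / (\<eta> * (r / 4)) < real (Suc n)" using m elim by simp
    then have n: "3 / (real (Suc n) * \<eta>) \<le> r / 4" using \<eta> r by (simp add: field_simps del: of_nat_Suc)
    have "(\<integral>\<^sup>+\<omega>. ennreal (\<Sum>i<Suc n. (e n i \<omega>)\<^sup>2 + \<bar>e n i \<omega>\<bar> * \<bar>d n i \<omega>\<bar> + \<bar>d n i \<omega>\<bar> ^ 3) \<partial>M)
      \<le> ennreal (1 + 1 / \<eta>) * (\<integral>\<^sup>+\<omega>. ennreal (\<Sum>i<Suc n. (e n i \<omega>)\<^sup>2) \<partial>M) + ennreal (2 * \<eta> + 3 / (real (Suc n) * \<eta>))"
      unfolding d_def by (intro remainder_L1_bound \<eta> assms(1)) auto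
    also have "\<dots> \<le> ennreal (r / 2) + ennreal (r / 2)"
      using n by (intro add_mono elim(1) ennreal_leI) (simp add: \<eta>_def del: of_nat_Suc)
    also have "\<dots> = ennreal r" using r by (simp add: ennreal_plus[symmetric] del: ennreal_plus)
    finally show ?case .
  qed
qed

end

section \<open>The generator annihilates a stationary law\<close>

context brownian_motion
begin

text \<open>On a grid of mesh \<open>1 / (n + 1)\<close> the increment of \<open>X\<close> is \<open>a + e + \<sigma> d\<close>: the drift \<open>a\<close>, the error \<open>e\<close>
  of freezing \<open>\<sigma>\<close> at the left end point, and a Brownian increment \<open>d\<close>.  Up to a null sequence, \<open>f (X 1) - f (X 0)\<close>
  minus the Riemann sum of the generator is a martingale bounded in \<open>L\<^sup>2\<close>.  By stationarity the
  expectation of the Riemann sum is the same for every \<open>n\<close>, so no limit of the sum is needed.\<close>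

lemma generator_identity:
  fixes f f' f'' b \<sigma> :: "real \<Rightarrow> real"
  assumes X: "\<And>t. 0 \<le> t \<Longrightarrow> X t \<in> borel_measurable (F t)"
    and cont: "AE \<omega> in M. continuous_on {0..} (\<lambda>t. X t \<omega>)"
    and law: "\<And>t. 0 \<le> t \<Longrightarrow> distr M borel (X t) = \<nu>"
    and b: "continuous_on UNIV b" and \<sigma>: "continuous_on UNIV \<sigma>" "\<And>x. \<bar>\<sigma> x\<bar> \<le> C"
    and sol: "\<And>t. 0 \<le> t \<Longrightarrow> \<exists>I. has_ito_integral M F B t (\<lambda>s \<omega>. \<sigma> (X s \<omega>)) I \<and>
      (AE \<omega> in M. X t \<omega> = \<xi> \<omega> + (LINT s:{0..t}|lborel. b (X s \<omega>)) + I \<omega>)"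
    and f: "\<And>x. (f has_real_derivative f' x) (at x)" "\<And>x. (f' has_real_derivative f'' x) (at x)"
    and lip: "\<And>x y. \<bar>f'' x - f'' y\<bar> \<le> K * \<bar>x - y\<bar>"
    and bdd: "\<And>x. \<bar>f x\<bar> \<le> K" "\<And>x. \<bar>f' x\<bar> \<le> K" "\<And>x. \<bar>f'' x\<bar> \<le> K" "\<And>x. \<bar>f' x * b x\<bar> \<le> K"
  shows "(\<integral>x. f' x * b x + f'' x / 2 * (\<sigma> x)\<^sup>2 \<partial>\<nu>) = 0"
proof -
  note [simp del] = sum.lessThan_Suc of_nat_Suc
  define L where "L x = f' x * b x + f'' x / 2 * (\<sigma> x)\<^sup>2" for x
  have K: "0 \<le> K" using bdd(1)[of 0] by linarith
  have C: "0 \<le> C" using \<sigma>(2)[of 0] by linarith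
  have f_cont: "continuous_on UNIV f" "continuous_on UNIV f'"
    by (intro continuous_at_imp_continuous_on ballI DERIV_isCont[OF f(1)] DERIV_isCont[OF f(2)])+
  have f''_cont: "continuous_on UNIV f''"
  proof -
    have "K-lipschitz_on UNIV f''" using lip K by (auto simp: lipschitz_on_def dist_real_def)
    then show ?thesis by (rule lipschitz_on_continuous_on)
  qed
  note [measurable] = borel_measurable_continuous_onI[OF b] borel_measurable_continuous_onI[OF \<sigma>(1)]
    borel_measurable_continuous_onI[OF f_cont(1)] borel_measurable_continuous_onI[OF f_cont(2)]
    borel_measurable_continuous_onI[OF f''_cont]
  have Lm[measurable]: "L \<in> borel_measurable borel" unfolding L_def[abs_def] by measurable
  have \<sigma>sq: "(\<sigma> x)\<^sup>2 \<le> C\<^sup>2" for x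
    using \<sigma>(2)[of x] C by (simp add: abs_le_square_iff[symmetric])
  have hLb: "\<bar>f'' x / 2 * (\<sigma> x)\<^sup>2\<bar> \<le> K / 2 * C\<^sup>2" for x
    unfolding abs_mult using bdd(3)[of x] \<sigma>sq[of x] by (intro mult_mono) auto
  have Lb: "\<bar>L x\<bar> \<le> K + K / 2 * C\<^sup>2" for x
    unfolding L_def using bdd(4)[of x] hLb[of x] by linarith
  define KL where "KL = K + K / 2 * C\<^sup>2"
  have KL: "0 \<le> KL" using Lb[of 0] unfolding KL_def by linarith
  have XM: "X s \<in> borel_measurable M" if "0 \<le> s" for s
    by (rule F_measurable_imp[OF that X[OF that]])

  have "\<forall>t\<in>{0..}. \<exists>I. has_ito_integral M F B t (\<lambda>s \<omega>. \<sigma> (X s \<omega>)) I \<and>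
      (AE \<omega> in M. X t \<omega> = \<xi> \<omega> + (LINT s:{0..t}|lborel. b (X s \<omega>)) + I \<omega>)"
    using sol by simp
  from bchoice[OF this] obtain I where I': "\<forall>t\<in>{0..}. has_ito_integral M F B t (\<lambda>s \<omega>. \<sigma> (X s \<omega>)) (I t) \<and>
      (AE \<omega> in M. X t \<omega> = \<xi> \<omega> + (LINT s:{0..t}|lborel. b (X s \<omega>)) + I t \<omega>)" ..
  have I: "\<And>t. 0 \<le> t \<Longrightarrow> has_ito_integral M F B t (\<lambda>s \<omega>. \<sigma> (X s \<omega>)) (I t)"
    and eq: "\<And>t. 0 \<le> t \<Longrightarrow> AE \<omega> in M. X t \<omega> = \<xi> \<omega> + (LINT s:{0..t}|lborel. b (X s \<omega>)) + I t \<omega>"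
    using I' by simp_all
  have IM: "I t \<in> borel_measurable M" if "0 \<le> t" for t
    using I[OF that] unfolding has_ito_integral_def by blast

  \<comment> \<open>Drift, freezing error and Brownian increment on the grid\<close>
  define t where "t n i = grid (Suc n) i" for n i
  have t: "0 \<le> t n i" "t n i \<le> t n (Suc i)" "t n 0 = 0" "t n (Suc i) - t n i = 1 / real (Suc n)"
      "t n (Suc n) = 1" for n i
    unfolding t_def by (rule grid_simps, rule grid_simps, rule grid_simps, rule grid_diff, rule grid_last, simp)
  define d where "d n i \<omega> = B (t n (Suc i)) \<omega> - B (t n i) \<omega>" for n i \<omega>
  define e where "e n i \<omega> = I (t n (Suc i)) \<omega> - I (t n i) \<omega> - \<sigma> (X (t n i) \<omega>) * d n i \<omega>" for n i \<omega>
  \<comment> \<open>Defined by subtraction, so that \<open>a n i\<close> is measurable and the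
    decomposition of the increment of \<open>X\<close> holds at every \<open>\<omega>\<close>; that
    it is the integral of the drift holds only almost surely.\<close>
  define a where "a n i \<omega> = X (t n (Suc i)) \<omega> - X (t n i) \<omega> - (I (t n (Suc i)) \<omega> - I (t n i) \<omega>)" for n i \<omega>
  have dm[measurable]: "d n i \<in> borel_measurable M" for n i
    unfolding d_def[abs_def] by (intro borel_measurable_diff B_measurable t)
  have Xtm[measurable]: "X (t n i) \<in> borel_measurable M" for n i by (rule XM[OF t(1)])
  have Itm[measurable]: "I (t n i) \<in> borel_measurable M" for n i by (rule IM[OF t(1)])
  have em[measurable]: "e n i \<in> borel_measurable M" for n i
    unfolding e_def[abs_def] by measurable
  have am[measurable]: "a n i \<in> borel_measurable M" for n i
    unfolding a_def[abs_def] by measurable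

  have g_meas: "(\<lambda>\<omega>. g (X (t n i) \<omega>)) \<in> borel_measurable (F (t n i))" if "g \<in> borel_measurable borel" for g :: "real \<Rightarrow> real" and n i
    by (rule measurable_compose[OF X[OF t(1)] that])

  define \<epsilon> where "\<epsilon> n = (\<integral>\<^sup>+\<omega>. (\<integral>\<^sup>+s. ennreal (\<Sum>i<Suc n. indicator {t n i<..t n (Suc i)} s *
     (\<sigma> (X s \<omega>) - \<sigma> (X (t n i) \<omega>))\<^sup>2) \<partial>lborel) \<partial>M)" for n
  note DE = discretization_error_bounds[where N="Suc n" and t="t n" and S="\<lambda>s \<omega>. \<sigma> (X s \<omega>)" and I="\<lambda>i. I (t n i)" and K=C for n,
    OF t(1) t(2) I[OF t(1)] g_meas \<sigma>(2), folded d_def, folded e_def, folded \<epsilon>_def]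
  have \<epsilon>0: "\<epsilon> \<longlonglongrightarrow> 0"
    unfolding \<epsilon>_def t_def
  proof (rule discretization_error_tendsto[where K=C])
    show "AE \<omega> in M. continuous_on {0..1} (\<lambda>s. \<sigma> (X s \<omega>))"
      using cont
    proof eventually_elim
      case (elim \<omega>)
      have "continuous_on {0..1} (\<lambda>s. X s \<omega>)" by (rule continuous_on_subset[OF elim]) auto
      then show ?case by (rule continuous_on_compose2[OF \<sigma>(1)]) auto
    qed
    show "(\<lambda>\<omega>. \<integral>\<^sup>+s. ennreal (\<Sum>i<Suc n. indicator {grid (Suc n) i<..grid (Suc n) (Suc i)} s *
      (\<sigma> (X s \<omega>) - \<sigma> (X (grid (Suc n) i) \<omega>))\<^sup>2) \<partial>lborel) \<in> borel_measurable M" for n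
      using DE(2)[of n] unfolding t_def by simp
  qed (use \<sigma>(2) in auto)
  have e_L2: "(\<lambda>n. \<integral>\<^sup>+\<omega>. ennreal (\<Sum>i<Suc n. (e n i \<omega>)\<^sup>2) \<partial>M) \<longlonglongrightarrow> 0"
    by (rule tendsto_zero_ennreal_le[OF tendsto_zero_ennreal_cmult[OF \<epsilon>0] DE(3)]) auto

  \<comment> \<open>Sums that vanish in probability\<close>
  have s1: "null_in_prob (\<lambda>n \<omega>. \<Sum>i<Suc n. f' (X (t n i) \<omega>) * e n i \<omega>)"
  proof (rule null_in_prob_L2)
    \<comment> \<open>Only the squares of the \<open>e n i\<close> are known to have a small sum,
      and Cauchy-Schwarz over the sum would lose a factor \<open>n + 1\<close>. The weighted bound
      avoids this because the underlying integrands have disjoint supports.\<close>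
    show "(\<lambda>n. mean_square M (\<lambda>\<omega>. \<Sum>i<Suc n. f' (X (t n i) \<omega>) * e n i \<omega>)) \<longlonglongrightarrow> 0"
    proof (rule tendsto_zero_ennreal_le[OF tendsto_zero_ennreal_cmult[OF \<epsilon>0, of "4 * ennreal (K\<^sup>2)"]])
      show "mean_square M (\<lambda>\<omega>. \<Sum>i<Suc n. f' (X (t n i) \<omega>) * e n i \<omega>) \<le> 4 * ennreal (K\<^sup>2) * \<epsilon> n" for n
        by (rule DE(4)) (auto intro: g_meas bdd)
    qed (simp add: ennreal_mult_less_top)
  qed measurable
  have s2: "null_in_prob (\<lambda>n \<omega>. \<Sum>i<Suc n. (e n i \<omega>)\<^sup>2 + \<bar>e n i \<omega>\<bar> * \<bar>d n i \<omega>\<bar> + \<bar>d n i \<omega>\<bar> ^ 3)"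
  proof (rule null_in_prob_L1)
    have "(\<lambda>n. \<integral>\<^sup>+\<omega>. ennreal (\<Sum>i<Suc n. (e n i \<omega>)\<^sup>2 + \<bar>e n i \<omega>\<bar> * \<bar>d n i \<omega>\<bar> + \<bar>d n i \<omega>\<bar> ^ 3) \<partial>M) \<longlonglongrightarrow> 0"
      unfolding d_def t_def by (rule remainder_L1_tendsto[OF em e_L2])
    then show "(\<lambda>n. \<integral>\<^sup>+\<omega>. ennreal \<bar>\<Sum>i<Suc n. (e n i \<omega>)\<^sup>2 + \<bar>e n i \<omega>\<bar> * \<bar>d n i \<omega>\<bar> + \<bar>d n i \<omega>\<bar> ^ 3\<bar> \<partial>M) \<longlonglongrightarrow> 0"
      by (simp add: abs_of_nonneg sum_nonneg del: sum.lessThan_Suc)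
  qed measurable

  have path: "AE \<omega> in M. (\<lambda>n. \<Sum>i<Suc n. \<bar>a n i \<omega> - b (X (t n i) \<omega>) / real (Suc n)\<bar>) \<longlonglongrightarrow> 0 \<and>
     (\<lambda>n. \<Sum>i<Suc n. (a n i \<omega>)\<^sup>2 + \<bar>a n i \<omega>\<bar> * \<bar>d n i \<omega>\<bar>) \<longlonglongrightarrow> 0"
  proof -
    \<comment> \<open>The grid points of all meshes together are countable, so one null set serves
      for the integral equation at all of them.\<close>
    have "AE \<omega> in M. \<forall>n i. X (t n i) \<omega> = \<xi> \<omega> + (LINT s:{0..t n i}|lborel. b (X s \<omega>)) + I (t n i) \<omega>"
      unfolding AE_all_countable using eq[OF t(1)] by blast
    then show ?thesis using cont continuous_paths
    proof eventually_elim
      case (elim \<omega>)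
      have bc: "continuous_on {0..} (\<lambda>s. b (X s \<omega>))"
        by (rule continuous_on_compose2[OF b elim(2)]) auto
      have w: "continuous_on {0..1} (\<lambda>s. b (X s \<omega>))" by (rule continuous_on_subset[OF bc]) auto
      have Bc: "continuous_on {0..1} (\<lambda>s. B s \<omega>)" by (rule continuous_on_subset[OF elim(3)]) auto
      have ai: "a n i \<omega> = (LINT s:{grid (Suc n) i..grid (Suc n) (Suc i)}|lborel. b (X s \<omega>))" for n i
        using set_integral_combine[OF bc t(1,2), of n i] elim(1)[rule_format, of n i] elim(1)[rule_format, of n "Suc i"]
        unfolding a_def t_def by linarith
      show ?case
        using pathwise_drift[OF w Bc, of "\<lambda>n i. a n i \<omega>", OF ai] unfolding d_def t_def by blast
    qed
  qed
  have s3: "null_in_prob (\<lambda>n \<omega>. \<Sum>i<Suc n. \<bar>a n i \<omega> - b (X (t n i) \<omega>) / real (Suc n)\<bar>)"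
  proof (rule null_in_prob_AE)
    show "AE \<omega> in M. (\<lambda>n. \<Sum>i<Suc n. \<bar>a n i \<omega> - b (X (t n i) \<omega>) / real (Suc n)\<bar>) \<longlonglongrightarrow> 0"
      using path by eventually_elim blast
  qed measurable
  have s4: "null_in_prob (\<lambda>n \<omega>. \<Sum>i<Suc n. (a n i \<omega>)\<^sup>2 + \<bar>a n i \<omega>\<bar> * \<bar>d n i \<omega>\<bar>)"
  proof (rule null_in_prob_AE)
    show "AE \<omega> in M. (\<lambda>n. \<Sum>i<Suc n. (a n i \<omega>)\<^sup>2 + \<bar>a n i \<omega>\<bar> * \<bar>d n i \<omega>\<bar>) \<longlonglongrightarrow> 0"
      using path by eventually_elim blast
  qed measurable

  define KH where "KH = K / 2 * C\<^sup>2"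
  \<comment> \<open>Squared increments are replaced by the mesh. The variables
    \<open>d\<^sup>2 - 1 / (n + 1)\<close> are centred with variance
    \<open>(3 - 2 + 1) / (n + 1)\<^sup>2\<close>, so the weighted sum has a second moment of order
    \<open>1 / n\<close>.\<close>
  have s5: "null_in_prob (\<lambda>n \<omega>. \<Sum>i<Suc n. f'' (X (t n i) \<omega>) / 2 * (\<sigma> (X (t n i) \<omega>))\<^sup>2 * ((d n i \<omega>)\<^sup>2 - 1 / real (Suc n)))"
  proof (rule null_in_prob_L2)
    fix n
    let ?g = "\<lambda>x::real. x\<^sup>2 - 1 / real (Suc n)"
    let ?S = "\<lambda>\<omega>. \<Sum>i<Suc n. f'' (X (t n i) \<omega>) / 2 * (\<sigma> (X (t n i) \<omega>))\<^sup>2 * ?g (d n i \<omega>)"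
    show "?S \<in> borel_measurable M" by measurable
  next
    have bound: "mean_square M (\<lambda>\<omega>. \<Sum>i<Suc n. f'' (X (t n i) \<omega>) / 2 * (\<sigma> (X (t n i) \<omega>))\<^sup>2 * ((d n i \<omega>)\<^sup>2 - 1 / real (Suc n)))
        \<le> ennreal (KH\<^sup>2 * real (Suc n) * (2 / (real (Suc n))\<^sup>2))" for n
    proof -
      let ?g = "\<lambda>x::real. x\<^sup>2 - 1 / real (Suc n)"
      have p2: "integrable M (\<lambda>\<omega>. (d n i \<omega>)\<^sup>2)" "integrable M (\<lambda>\<omega>. (d n i \<omega>) ^ 4)"
        "expectation (\<lambda>\<omega>. (d n i \<omega>)\<^sup>2) = 1 / real (Suc n)" "expectation (\<lambda>\<omega>. (d n i \<omega>) ^ 4) = 3 * (1 / real (Suc n))\<^sup>2" for i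
        unfolding d_def using integrable_increment_power[OF t(1,2), of n i] increment_variance[OF t(1,2), of n i]
          increment_fourth_moment[OF t(1,2), of n i] by (simp_all add: t(4) del: of_nat_Suc)
      have sq: "(?g x)\<^sup>2 = x ^ 4 - 2 / real (Suc n) * x\<^sup>2 + (1 / real (Suc n))\<^sup>2" for x
        by (simp add: power2_diff power_mult[symmetric] del: of_nat_Suc)
      have "(\<lambda>\<omega>. \<Sum>i<Suc n. f'' (X (t n i) \<omega>) / 2 * (\<sigma> (X (t n i) \<omega>))\<^sup>2 * ?g (d n i \<omega>)) \<in> borel_measurable (F (t n (Suc n))) \<and>
        integrable M (\<lambda>\<omega>. (\<Sum>i<Suc n. f'' (X (t n i) \<omega>) / 2 * (\<sigma> (X (t n i) \<omega>))\<^sup>2 * ?g (d n i \<omega>))\<^sup>2) \<and>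
        expectation (\<lambda>\<omega>. \<Sum>i<Suc n. f'' (X (t n i) \<omega>) / 2 * (\<sigma> (X (t n i) \<omega>))\<^sup>2 * ?g (d n i \<omega>)) = 0 \<and>
        expectation (\<lambda>\<omega>. (\<Sum>i<Suc n. f'' (X (t n i) \<omega>) / 2 * (\<sigma> (X (t n i) \<omega>))\<^sup>2 * ?g (d n i \<omega>))\<^sup>2)
          \<le> KH\<^sup>2 * real (Suc n) * (2 / (real (Suc n))\<^sup>2)"
        unfolding d_def
      proof (rule sum_increment_square_bound[where N="Suc n"])
        show "(\<lambda>\<omega>. f'' (X (t n i) \<omega>) / 2 * (\<sigma> (X (t n i) \<omega>))\<^sup>2) \<in> borel_measurable (F (t n i))" for i
          by (rule g_meas[of "\<lambda>x. f'' x / 2 * (\<sigma> x)\<^sup>2"]) measurable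
        show "\<bar>f'' (X (t n i) \<omega>) / 2 * (\<sigma> (X (t n i) \<omega>))\<^sup>2\<bar> \<le> KH" for i \<omega>
          unfolding KH_def by (rule hLb)
        show "integrable M (\<lambda>\<omega>. (?g (B (t n (Suc i)) \<omega> - B (t n i) \<omega>))\<^sup>2)" for i
          unfolding sq d_def[symmetric] using p2 by (intro Bochner_Integration.integrable_add Bochner_Integration.integrable_diff) auto
        show "expectation (\<lambda>\<omega>. ?g (B (t n (Suc i)) \<omega> - B (t n i) \<omega>)) = 0" for i
          unfolding d_def[symmetric] using p2 by (simp add: prob_space del: of_nat_Suc)
        show "expectation (\<lambda>\<omega>. (?g (B (t n (Suc i)) \<omega> - B (t n i) \<omega>))\<^sup>2) = 2 / (real (Suc n))\<^sup>2" for i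
          unfolding sq d_def[symmetric] using p2 by (simp add: prob_space power2_eq_square del: of_nat_Suc)
      qed (auto simp: t)
      then show ?thesis by (simp add: nn_integral_eq_integral ennreal_leI del: of_nat_Suc sum.lessThan_Suc)
    qed
    show "(\<lambda>n. mean_square M (\<lambda>\<omega>. \<Sum>i<Suc n. f'' (X (t n i) \<omega>) / 2 * (\<sigma> (X (t n i) \<omega>))\<^sup>2 * ((d n i \<omega>)\<^sup>2 - 1 / real (Suc n)))) \<longlonglongrightarrow> 0"
    proof (rule tendsto_zero_ennreal_le[OF _ bound])
      have "(\<lambda>n. 2 * KH\<^sup>2 * (1 / real (Suc n))) \<longlonglongrightarrow> 2 * KH\<^sup>2 * 0"
        by (intro tendsto_mult tendsto_const lim_1_over_n[THEN LIMSEQ_Suc])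
      moreover have "KH\<^sup>2 * real (Suc n) * (2 / (real (Suc n))\<^sup>2) = 2 * KH\<^sup>2 * (1 / real (Suc n))" for n
        by (simp add: power2_eq_square del: of_nat_Suc)
      ultimately show "(\<lambda>n. ennreal (KH\<^sup>2 * real (Suc n) * (2 / (real (Suc n))\<^sup>2))) \<longlonglongrightarrow> 0"
        using tendsto_ennrealI[of "\<lambda>n. 2 * KH\<^sup>2 * (1 / real (Suc n))" 0] by simp
    qed
  qed

  \<comment> \<open>The martingale part and the Riemann sum of the generator\<close>
  define W where "W n \<omega> = (\<Sum>i<Suc n. f' (X (t n i) \<omega>) * \<sigma> (X (t n i) \<omega>) * d n i \<omega>)" for n \<omega>
  \<comment> \<open>\<open>W n\<close> need not tend to zero; what counts is its zero mean and a
    second moment bounded uniformly in \<open>n\<close>.\<close>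
  have W: "integrable M (\<lambda>\<omega>. (W n \<omega>)\<^sup>2)" "expectation (W n) = 0" "expectation (\<lambda>\<omega>. (W n \<omega>)\<^sup>2) \<le> (K * C)\<^sup>2" for n
  proof -
    have p2: "integrable M (\<lambda>\<omega>. (d n i \<omega>)\<^sup>2)" "expectation (\<lambda>\<omega>. (d n i \<omega>)\<^sup>2) = 1 / real (Suc n)" "expectation (d n i) = 0" for i
      unfolding d_def using integrable_increment_power[OF t(1,2), of n i] increment_variance[OF t(1,2), of n i]
        increment_mean[OF t(1,2), of n i] by (simp_all add: t(4) del: of_nat_Suc)
    have "W n \<in> borel_measurable (F (t n (Suc n))) \<and>
        integrable M (\<lambda>\<omega>. (W n \<omega>)\<^sup>2) \<and> expectation (W n) = 0 \<and>
        expectation (\<lambda>\<omega>. (W n \<omega>)\<^sup>2) \<le> (K * C)\<^sup>2 * real (Suc n) * (1 / real (Suc n))"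
      unfolding W_def[abs_def] d_def
    proof (rule sum_increment_square_bound[where N="Suc n" and g="\<lambda>x. x"])
      show "(\<lambda>\<omega>. f' (X (t n i) \<omega>) * \<sigma> (X (t n i) \<omega>)) \<in> borel_measurable (F (t n i))" for i
        by (rule g_meas[of "\<lambda>x. f' x * \<sigma> x"]) measurable
      show "\<bar>f' (X (t n i) \<omega>) * \<sigma> (X (t n i) \<omega>)\<bar> \<le> K * C" for i \<omega>
        unfolding abs_mult using bdd(2) \<sigma>(2) K by (intro mult_mono) auto
    qed (use p2 in \<open>auto simp: t d_def[abs_def] simp del: of_nat_Suc\<close>)
    then show "integrable M (\<lambda>\<omega>. (W n \<omega>)\<^sup>2)" "expectation (W n) = 0" "expectation (\<lambda>\<omega>. (W n \<omega>)\<^sup>2) \<le> (K * C)\<^sup>2"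
      by (auto simp del: of_nat_Suc)
  qed
  have Wm[measurable]: "W n \<in> borel_measurable M" for n unfolding W_def[abs_def] by measurable
  have Wi: "integrable M (W n)" for n by (rule square_integrable_imp_integrable[OF Wm W(1)])

  define D where "D n \<omega> = f (X 1 \<omega>) - f (X 0 \<omega>) - (\<Sum>i<Suc n. L (X (t n i) \<omega>) / real (Suc n))" for n \<omega>
  have X01[measurable]: "X 0 \<in> borel_measurable M" "X 1 \<in> borel_measurable M" by (auto intro: XM)
  have Dm[measurable]: "D n \<in> borel_measurable M" for n unfolding D_def[abs_def] by measurable
  have fi: "integrable M (\<lambda>\<omega>. f (X s \<omega>))" if "0 \<le> s" for s
    using XM[OF that] bdd(1) by (intro integrable_const_bound[of _ K]) auto
  have Li: "integrable M (\<lambda>\<omega>. L (X s \<omega>))" if "0 \<le> s" for s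
    using XM[OF that] Lb by (intro integrable_const_bound[of _ KL]) (auto simp: KL_def)
  have Ef: "expectation (\<lambda>\<omega>. g (X s \<omega>)) = (\<integral>x. g x \<partial>\<nu>)" if "0 \<le> s" "g \<in> borel_measurable borel" for s and g :: "real \<Rightarrow> real"
    using integral_distr[OF XM[OF that(1)] that(2)] law[OF that(1)] by simp
  have Di: "integrable M (D n)" for n
    unfolding D_def[abs_def] using fi[of 0] fi[of 1] Li[OF t(1)] by (auto simp del: sum.lessThan_Suc)
  \<comment> \<open>By stationarity the two values of \<open>f\<close> cancel in the mean, and the
    \<open>n + 1\<close> terms of the Riemann sum have equal means.\<close>
  have ED: "expectation (D n) = - (\<integral>x. L x \<partial>\<nu>)" for n
  proof -
    have "expectation (D n) = expectation (\<lambda>\<omega>. f (X 1 \<omega>)) - expectation (\<lambda>\<omega>. f (X 0 \<omega>))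
       - (\<Sum>i<Suc n. expectation (\<lambda>\<omega>. L (X (t n i) \<omega>)) / real (Suc n))"
      unfolding D_def[abs_def] using fi[of 0] fi[of 1] Li[OF t(1)] by (simp del: sum.lessThan_Suc of_nat_Suc)
    also have "\<dots> = - (\<Sum>i<Suc n. (\<integral>x. L x \<partial>\<nu>) / real (Suc n))"
      by (simp add: Ef t(1) del: sum.lessThan_Suc of_nat_Suc)
    also have "\<dots> = - (\<integral>x. L x \<partial>\<nu>)" by (simp del: sum.lessThan_Suc of_nat_Suc)
    finally show ?thesis .
  qed
  have Db: "\<bar>D n \<omega>\<bar> \<le> 2 * K + KL" for n \<omega>
  proof -
    have "\<bar>\<Sum>i<Suc n. L (X (t n i) \<omega>) / real (Suc n)\<bar> \<le> (\<Sum>i<Suc n. KL / real (Suc n))"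
      using Lb unfolding KL_def
      by (intro order_trans[OF sum_abs] sum_mono) (simp add: divide_right_mono del: of_nat_Suc)
    also have "\<dots> = KL" by (simp del: sum.lessThan_Suc of_nat_Suc)
    finally show ?thesis unfolding D_def using bdd(1)[of "X 1 \<omega>"] bdd(1)[of "X 0 \<omega>"] by linarith
  qed

  \<comment> \<open>The Taylor remainder along the grid\<close>
  define R where "R n \<omega> = (\<Sum>i<Suc n. f (X (t n (Suc i)) \<omega>) - f (X (t n i) \<omega>)
     - f' (X (t n i) \<omega>) * (a n i \<omega> + e n i \<omega> + \<sigma> (X (t n i) \<omega>) * d n i \<omega>)
     - f'' (X (t n i) \<omega>) / 2 * (\<sigma> (X (t n i) \<omega>) * d n i \<omega>)\<^sup>2)" for n \<omega>
  have Xsucc: "X (t n (Suc i)) \<omega> = X (t n i) \<omega> + (a n i \<omega> + e n i \<omega> + \<sigma> (X (t n i) \<omega>) * d n i \<omega>)" for n i \<omega>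
    unfolding a_def e_def by simp
  \<comment> \<open>Enlarged to be at least 1, so that the single factor \<open>C' ^ 3\<close>
    bounds the powers of \<open>\<sigma>\<close> in all five terms of the remainder.\<close>
  define C' where "C' = 1 + C"
  have C': "1 \<le> C'" using C by (simp add: C'_def)
  have Rb: "\<bar>R n \<omega>\<bar> \<le> 27 * K * C' ^ 3 * ((\<Sum>i<Suc n. (a n i \<omega>)\<^sup>2 + \<bar>a n i \<omega>\<bar> * \<bar>d n i \<omega>\<bar>)
      + (\<Sum>i<Suc n. (e n i \<omega>)\<^sup>2 + \<bar>e n i \<omega>\<bar> * \<bar>d n i \<omega>\<bar> + \<bar>d n i \<omega>\<bar> ^ 3))" for n \<omega>
  proof -
    have step_bound: "\<bar>f (X (t n (Suc i)) \<omega>) - f (X (t n i) \<omega>)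
       - f' (X (t n i) \<omega>) * (a n i \<omega> + e n i \<omega> + \<sigma> (X (t n i) \<omega>) * d n i \<omega>)
       - f'' (X (t n i) \<omega>) / 2 * (\<sigma> (X (t n i) \<omega>) * d n i \<omega>)\<^sup>2\<bar>
      \<le> 27 * K * C' ^ 3 * (((a n i \<omega>)\<^sup>2 + \<bar>a n i \<omega>\<bar> * \<bar>d n i \<omega>\<bar>) + ((e n i \<omega>)\<^sup>2 + \<bar>e n i \<omega>\<bar> * \<bar>d n i \<omega>\<bar> + \<bar>d n i \<omega>\<bar> ^ 3))" for i
    proof -
      let ?z = "\<sigma> (X (t n i) \<omega>) * d n i \<omega>" and ?a = "a n i \<omega>" and ?e = "e n i \<omega>" and ?d = "d n i \<omega>"
      have z: "\<bar>?z\<bar> \<le> C' * \<bar>?d\<bar>"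
        unfolding abs_mult C'_def using \<sigma>(2)[of "X (t n i) \<omega>"] by (intro mult_right_mono) auto
      have CC: "C' \<le> C' ^ 3" "1 \<le> C' ^ 3"
        using power_increasing[of 1 3 C'] one_le_power[of C' 3] C' by auto
      have lift: "x \<le> C' ^ 3 * x" if "0 \<le> x" for x :: real
        using mult_right_mono[OF CC(2) that] by simp
      have lift': "x * \<bar>?z\<bar> \<le> C' ^ 3 * (x * \<bar>?d\<bar>)" if "0 \<le> x" for x :: real
      proof -
        have "x * \<bar>?z\<bar> \<le> x * (C' * \<bar>?d\<bar>)" using z that by (rule mult_left_mono)
        also have "\<dots> = C' * (x * \<bar>?d\<bar>)" by simp
        also have "\<dots> \<le> C' ^ 3 * (x * \<bar>?d\<bar>)" using CC(1) that by (intro mult_right_mono) auto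
        finally show ?thesis .
      qed
      have z3: "\<bar>?z\<bar> ^ 3 \<le> C' ^ 3 * \<bar>?d\<bar> ^ 3"
        using power_mono[OF z, of 3] by (simp add: power_mult_distrib)
      have "?a\<^sup>2 + ?e\<^sup>2 + \<bar>?a\<bar> * \<bar>?z\<bar> + \<bar>?e\<bar> * \<bar>?z\<bar> + \<bar>?z\<bar> ^ 3
        \<le> C' ^ 3 * ((?a\<^sup>2 + \<bar>?a\<bar> * \<bar>?d\<bar>) + (?e\<^sup>2 + \<bar>?e\<bar> * \<bar>?d\<bar> + \<bar>?d\<bar> ^ 3))"
        using lift[of "?a\<^sup>2"] lift[of "?e\<^sup>2"] lift'[of "\<bar>?a\<bar>"] lift'[of "\<bar>?e\<bar>"] z3
        unfolding distrib_left by auto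
      then have "27 * K * (?a\<^sup>2 + ?e\<^sup>2 + \<bar>?a\<bar> * \<bar>?z\<bar> + \<bar>?e\<bar> * \<bar>?z\<bar> + \<bar>?z\<bar> ^ 3)
        \<le> 27 * K * (C' ^ 3 * ((?a\<^sup>2 + \<bar>?a\<bar> * \<bar>?d\<bar>) + (?e\<^sup>2 + \<bar>?e\<bar> * \<bar>?d\<bar> + \<bar>?d\<bar> ^ 3)))"
        using K by (intro mult_left_mono) auto
      then show ?thesis
        using ito_taylor_remainder[OF f bdd(3) lip, of "X (t n i) \<omega>" ?a ?e ?z] unfolding Xsucc
        by (simp only: mult.assoc)
    qed
    have "\<bar>R n \<omega>\<bar> \<le> (\<Sum>i<Suc n. 27 * K * C' ^ 3 * (((a n i \<omega>)\<^sup>2 + \<bar>a n i \<omega>\<bar> * \<bar>d n i \<omega>\<bar>) + ((e n i \<omega>)\<^sup>2 + \<bar>e n i \<omega>\<bar> * \<bar>d n i \<omega>\<bar> + \<bar>d n i \<omega>\<bar> ^ 3)))"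
      unfolding R_def by (intro order_trans[OF sum_abs] sum_mono step_bound)
    then show ?thesis by (simp only: sum_distrib_left[symmetric] sum.distrib)
  qed
  have Rm: "R n \<in> borel_measurable M" for n unfolding R_def[abs_def] by measurable
  have s6: "null_in_prob R"
    by (rule null_in_prob_mono[OF null_in_prob_cmult[OF null_in_prob_add[OF s4 s2], of "27 * K * C' ^ 3"] Rm]) (use Rb in \<open>force simp del: sum.lessThan_Suc intro: order_trans[OF _ abs_ge_self]\<close>)
  have s7: "null_in_prob (\<lambda>n \<omega>. \<Sum>i<Suc n. f' (X (t n i) \<omega>) * (a n i \<omega> - b (X (t n i) \<omega>) / real (Suc n)))"
  proof (rule null_in_prob_mono[OF null_in_prob_cmult[OF s3, of K]])
    fix n \<omega>
    have "\<bar>\<Sum>i<Suc n. f' (X (t n i) \<omega>) * (a n i \<omega> - b (X (t n i) \<omega>) / real (Suc n))\<bar>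
      \<le> (\<Sum>i<Suc n. K * \<bar>a n i \<omega> - b (X (t n i) \<omega>) / real (Suc n)\<bar>)"
      using bdd(2) by (intro order_trans[OF sum_abs] sum_mono) (auto simp: abs_mult intro: mult_right_mono)
    also have "\<dots> = K * (\<Sum>i<Suc n. \<bar>a n i \<omega> - b (X (t n i) \<omega>) / real (Suc n)\<bar>)"
      by (simp only: sum_distrib_left)
    also have "\<dots> \<le> \<bar>K * (\<Sum>i<Suc n. \<bar>a n i \<omega> - b (X (t n i) \<omega>) / real (Suc n)\<bar>)\<bar>" by (rule abs_ge_self)
    finally show "\<bar>\<Sum>i<Suc n. f' (X (t n i) \<omega>) * (a n i \<omega> - b (X (t n i) \<omega>) / real (Suc n))\<bar>
      \<le> \<bar>K * (\<Sum>i<Suc n. \<bar>a n i \<omega> - b (X (t n i) \<omega>) / real (Suc n)\<bar>)\<bar>" .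
  qed measurable

  \<comment> \<open>Combination of the null sequences\<close>
  have U: "D n \<omega> - W n \<omega> = R n \<omega> + (\<Sum>i<Suc n. f' (X (t n i) \<omega>) * (a n i \<omega> - b (X (t n i) \<omega>) / real (Suc n)))
      + (\<Sum>i<Suc n. f' (X (t n i) \<omega>) * e n i \<omega>)
      + (\<Sum>i<Suc n. f'' (X (t n i) \<omega>) / 2 * (\<sigma> (X (t n i) \<omega>))\<^sup>2 * ((d n i \<omega>)\<^sup>2 - 1 / real (Suc n)))" for n \<omega>
  proof -
    have tele: "f (X 1 \<omega>) - f (X 0 \<omega>) = (\<Sum>i<Suc n. f (X (t n (Suc i)) \<omega>) - f (X (t n i) \<omega>))"
      by (subst sum_lessThan_telescope[of "\<lambda>i. f (X (t n i) \<omega>)"]) (simp add: t)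
    show ?thesis
      unfolding D_def tele W_def R_def sum.distrib[symmetric] sum_subtractf[symmetric] L_def
      by (intro sum.cong refl) (simp add: algebra_simps power_mult_distrib add_divide_distrib diff_divide_distrib del: of_nat_Suc)
  qed
  \<comment> \<open>The left side of \<open>U\<close> has an expectation independent of
    \<open>n\<close> and bounded second moments, and the right side is a sum of four null sequences;
    hence the common expectation is zero.\<close>
  have sm: "null_in_prob (\<lambda>n \<omega>. D n \<omega> - W n \<omega>)"
    unfolding U by (intro null_in_prob_add s6 s7 s1 s5)
  have l2: "mean_square M (\<lambda>\<omega>. D n \<omega> - W n \<omega>) \<le> ennreal (2 * (2 * K + KL)\<^sup>2 + 2 * (K * C)\<^sup>2)" for n
  proof -
    have "mean_square M (\<lambda>\<omega>. D n \<omega> - W n \<omega>) \<le> 2 * mean_square M (D n) + 2 * mean_square M (W n)"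
      using nn_integral_square_add_le[of "D n" M "\<lambda>\<omega>. - W n \<omega>"] by simp
    also have "\<dots> \<le> 2 * ennreal ((2 * K + KL)\<^sup>2) + 2 * ennreal ((K * C)\<^sup>2)"
    proof (intro add_mono mult_left_mono)
      have "mean_square M (D n) \<le> mean_square M (\<lambda>\<omega>. 2 * K + KL)"
        using Db K KL by (intro nn_integral_mono ennreal_leI) (simp add: abs_le_square_iff[symmetric])
      then show "mean_square M (D n) \<le> ennreal ((2 * K + KL)\<^sup>2)" by (simp add: emeasure_space_1)
      show "mean_square M (W n) \<le> ennreal ((K * C)\<^sup>2)"
        using W by (simp add: nn_integral_eq_integral ennreal_leI)
    qed simp_all
    also have "2 * ennreal ((2 * K + KL)\<^sup>2) + 2 * ennreal ((K * C)\<^sup>2) = ennreal (2 * (2 * K + KL)\<^sup>2 + 2 * (K * C)\<^sup>2)"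
      by (simp add: ennreal_plus ennreal_mult)
    finally show ?thesis .
  qed
  have ex: "expectation (\<lambda>\<omega>. D n \<omega> - W n \<omega>) = - (\<integral>x. L x \<partial>\<nu>)" for n
    using ED[of n] W(2)[of n] Di[of n] Wi[of n] by simp
  have "- (\<integral>x. L x \<partial>\<nu>) = 0"
    by (rule null_in_prob_expectation_const[OF sm l2 _ ex]) auto
  then show ?thesis unfolding L_def by simp
qed

end

section \<open>Stationary densities\<close>

lemma antiderivative_real:
  fixes f :: "real \<Rightarrow> real"
  assumes "continuous_on UNIV f"
  obtains F where "\<And>x. (F has_real_derivative f x) (at x)"
proof -
  have "\<exists>F. \<forall>x :: real. -\<infinity> < ereal x \<longrightarrow> ereal x < \<infinity> \<longrightarrow> (F has_vector_derivative f x) (at x)"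
    using assms by (intro einterval_antiderivative) (auto simp: continuous_on_eq_continuous_at)
  then show ?thesis using that by (auto simp: has_real_derivative_iff_has_vector_derivative)
qed

lemma bounded_of_constant_ends:
  fixes g :: "real \<Rightarrow> real"
  assumes "continuous_on UNIV g" "0 \<le> R" "\<And>x. x \<le> - R \<Longrightarrow> g x = g (- R)" "\<And>x. R \<le> x \<Longrightarrow> g x = g R"
  shows "\<exists>K. \<forall>x. \<bar>g x\<bar> \<le> K"
proof -
  have "bounded (g ` {-R..R})"
    by (intro compact_imp_bounded compact_continuous_image continuous_on_subset[OF assms(1)]) auto
  then obtain K where K: "\<And>x. x \<in> {-R..R} \<Longrightarrow> \<bar>g x\<bar> \<le> K"
    unfolding bounded_iff by (auto simp del: atLeastAtMost_iff)
  have "\<bar>g x\<bar> \<le> K" for x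
    using K[of x] K[of R] K[of "- R"] assms(2) assms(3)[of x] assms(4)[of x]
    by (cases "x \<in> {-R..R}") (auto simp: not_le)
  then show ?thesis by blast
qed

lemma lipschitz_on_mult_Icc:
  fixes f g :: "real \<Rightarrow> real"
  assumes "\<exists>L. L-lipschitz_on {a..b} f" "\<exists>L. L-lipschitz_on {a..b} g"
  shows "\<exists>L. L-lipschitz_on {a..b} (\<lambda>x. f x * g x)"
proof -
  obtain L1 L2 where L: "L1-lipschitz_on {a..b} f" "L2-lipschitz_on {a..b} g" using assms by auto
  have "bounded (f ` {a..b})" "bounded (g ` {a..b})"
    using L by (auto intro!: compact_imp_bounded compact_continuous_image lipschitz_on_continuous_on)
  then obtain K1 K2 where K: "\<And>x. x \<in> {a..b} \<Longrightarrow> \<bar>f x\<bar> \<le> K1" "\<And>x. x \<in> {a..b} \<Longrightarrow> \<bar>g x\<bar> \<le> K2" "K1 > 0" "K2 > 0"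
    unfolding bounded_pos by (auto simp del: atLeastAtMost_iff)
  have "(K1 * L2 + K2 * L1)-lipschitz_on {a..b} (\<lambda>x. f x * g x)"
  proof (rule lipschitz_onI)
    fix x y assume xy: "x \<in> {a..b}" "y \<in> {a..b}"
    have d: "\<bar>f x - f y\<bar> \<le> L1 * \<bar>x - y\<bar>" "\<bar>g x - g y\<bar> \<le> L2 * \<bar>x - y\<bar>"
      using lipschitz_onD[OF L(1) xy] lipschitz_onD[OF L(2) xy] by (auto simp: dist_real_def)
    have "\<bar>f x * g x - f y * g y\<bar> = \<bar>f x * (g x - g y) + g y * (f x - f y)\<bar>" by (simp add: algebra_simps)
    also have "\<dots> \<le> \<bar>f x\<bar> * \<bar>g x - g y\<bar> + \<bar>g y\<bar> * \<bar>f x - f y\<bar>"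
      by (rule order_trans[OF abs_triangle_ineq]) (simp add: abs_mult)
    also have "\<dots> \<le> K1 * (L2 * \<bar>x - y\<bar>) + K2 * (L1 * \<bar>x - y\<bar>)"
      using K xy d by (intro add_mono mult_mono) (auto intro: order_less_imp_le)
    finally show "dist (f x * g x) (f y * g y) \<le> (K1 * L2 + K2 * L1) * dist x y"
      by (simp add: dist_real_def algebra_simps)
  qed (use K lipschitz_on_nonneg[OF L(1)] lipschitz_on_nonneg[OF L(2)] in simp)
  then show ?thesis by blast
qed

lemma lipschitz_on_C1_Icc:
  fixes f f' :: "real \<Rightarrow> real"
  assumes "\<And>x. (f has_real_derivative f' x) (at x)" "continuous_on UNIV f'"
  shows "\<exists>L. L-lipschitz_on {a..b} f"
proof -
  have "bounded (f' ` {a..b})"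
    by (intro compact_imp_bounded compact_continuous_image continuous_on_subset[OF assms(2)]) auto
  then obtain K where K: "\<And>x. x \<in> {a..b} \<Longrightarrow> \<bar>f' x\<bar> \<le> K" "K > 0" unfolding bounded_pos by (auto simp del: atLeastAtMost_iff)
  have "K-lipschitz_on {a..b} f"
  proof (rule lipschitz_onI)
    fix x y assume "x \<in> {a..b}" "y \<in> {a..b}"
    then have "norm (f x - f y) \<le> K * norm (x - y)"
      using assms(1) K by (intro field_differentiable_bound[of "{a..b}" f f' K]) (auto intro: has_field_derivative_at_within)
    then show "dist (f x) (f y) \<le> K * dist x y" by (simp add: dist_real_def)
  qed (use K in simp)
  then show ?thesis by blast
qed

lemma lipschitz_of_compact_support:
  fixes g :: "real \<Rightarrow> real"
  assumes "L-lipschitz_on {-R..R} g" "0 \<le> R" and zero: "\<And>x. R \<le> \<bar>x\<bar> \<Longrightarrow> g x = 0"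
  shows "\<bar>g x - g y\<bar> \<le> L * \<bar>x - y\<bar>"
proof -
  \<comment> \<open>\<open>c\<close> projects onto \<open>[- R, R]\<close>. It leaves the values of
    \<open>g\<close> unchanged, since \<open>g\<close> vanishes from \<open>R\<close> and
    \<open>- R\<close> outwards, and being 1-Lipschitz it transfers the constant
    \<open>L\<close>.\<close>
  define c where "c x = max (- R) (min R x)" for x
  have gc: "g (c x) = g x" for x
    using zero[of x] zero[of R] zero[of "- R"] assms(2) by (auto simp: c_def max_def min_def)
  have "c x \<in> {-R..R}" for x using assms(2) by (auto simp: c_def)
  then have "\<bar>g (c x) - g (c y)\<bar> \<le> L * \<bar>c x - c y\<bar>"
    using lipschitz_onD[OF assms(1)] by (auto simp: dist_real_def)
  also have "\<dots> \<le> L * \<bar>x - y\<bar>"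
    using lipschitz_on_nonneg[OF assms(1)] by (intro mult_left_mono) (auto simp: c_def max_def min_def)
  finally show ?thesis by (simp add: gc)
qed

lemma constant_of_zero_derivative:
  fixes f :: "real \<Rightarrow> real"
  assumes "\<And>x. (f has_real_derivative f' x) (at x)" "\<And>x. R \<le> \<bar>x\<bar> \<Longrightarrow> f' x = 0" "0 \<le> R"
  shows "x \<le> - R \<Longrightarrow> f x = f (- R)" "R \<le> x \<Longrightarrow> f x = f R"
proof -
  show "f x = f (- R)" if "x \<le> - R"
  proof (cases "x = - R")
    case False
    have "continuous_on {x..-R} f"
      by (rule DERIV_continuous_on[of _ _ f']) (auto intro: has_field_derivative_at_within assms(1))
    moreover have "(f has_real_derivative 0) (at z)" if "z < - R" for z
      using assms(1)[of z] assms(2)[of z] that by simp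
    ultimately show ?thesis
      using DERIV_isconst_end[of x "- R" f] that False by simp
  qed simp
  show "f x = f R" if "R \<le> x"
  proof (cases "x = R")
    case False
    have "continuous_on {R..x} f"
      by (rule DERIV_continuous_on[of _ _ f']) (auto intro: has_field_derivative_at_within assms(1))
    moreover have "(f has_real_derivative 0) (at z)" if "R < z" for z
      using assms(1)[of z] assms(2)[of z] that by simp
    ultimately show ?thesis
      using DERIV_isconst_end[of R x f] that False by simp
  qed simp
qed

text \<open>The integrating factor: for \<open>f' = exp (- Q) h\<close> with \<open>h' = k\<close> the generator reduces to a multiple of \<open>k\<close>.\<close>

lemma test_function_exists:
  fixes b b' \<sigma> Q k :: "real \<Rightarrow> real"
  assumes \<sigma>: "C-lipschitz_on UNIV \<sigma>" "0 < \<sigma>l" "\<And>x. \<sigma>l\<^sup>2 \<le> (\<sigma> x)\<^sup>2"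
    and b: "\<And>x. (b has_real_derivative b' x) (at x)" "continuous_on UNIV b'"
    and Q: "\<And>x. (Q has_real_derivative 2 * b x / (\<sigma> x)\<^sup>2) (at x)"
    and k: "L-lipschitz_on UNIV k" "0 \<le> R" "\<And>x. R \<le> \<bar>x\<bar> \<Longrightarrow> k x = 0" "(\<integral>x. k x \<partial>lborel) = 0"
  shows "\<exists>f f' f'' K. (\<forall>x. (f has_real_derivative f' x) (at x)) \<and> (\<forall>x. (f' has_real_derivative f'' x) (at x)) \<and>
    (\<forall>x y. \<bar>f'' x - f'' y\<bar> \<le> K * \<bar>x - y\<bar>) \<and> (\<forall>x. \<bar>f x\<bar> \<le> K) \<and> (\<forall>x. \<bar>f' x\<bar> \<le> K) \<and> (\<forall>x. \<bar>f'' x\<bar> \<le> K) \<and>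
    (\<forall>x. \<bar>f' x * b x\<bar> \<le> K) \<and> (\<forall>x. f' x * b x + f'' x / 2 * (\<sigma> x)\<^sup>2 = exp (- Q x) * (\<sigma> x)\<^sup>2 / 2 * k x)"
proof -
  have \<sigma>_nz: "\<sigma> x \<noteq> 0" for x using \<sigma>(2) \<sigma>(3)[of x] by (auto simp: power2_eq_square mult_le_0_iff)
  have kc: "continuous_on UNIV k" by (rule lipschitz_on_continuous_on[OF k(1)])
  have \<sigma>c: "continuous_on UNIV \<sigma>" by (rule lipschitz_on_continuous_on[OF \<sigma>(1)])
  have bc: "continuous_on UNIV b" by (intro continuous_at_imp_continuous_on ballI DERIV_isCont[OF b(1)])
  have Qc: "continuous_on UNIV Q" by (intro continuous_at_imp_continuous_on ballI DERIV_isCont[OF Q])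
  define q where "q x = 2 * b x / (\<sigma> x)\<^sup>2" for x
  have qc: "continuous_on UNIV q" unfolding q_def[abs_def] using \<sigma>_nz by (intro continuous_intros bc \<sigma>c) auto
  obtain h0 where h0: "\<And>x. (h0 has_real_derivative k x) (at x)" using antiderivative_real[OF kc] by blast
  \<comment> \<open>Normalised to vanish at \<open>- R\<close>. The zero integral of
    \<open>k\<close> then makes it vanish at \<open>R\<close> too, so \<open>h\<close>, and with it
    the derivative of the test function, has compact support.\<close>
  define h where "h x = h0 x - h0 (- R)" for x
  have h: "(h has_real_derivative k x) (at x)" for x unfolding h_def[abs_def] using h0[of x] by (auto intro!: derivative_eq_intros)
  have hc: "continuous_on UNIV h" by (intro continuous_at_imp_continuous_on ballI DERIV_isCont[OF h])
  have hR: "h R = 0"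
  proof -
    have "(\<integral>x. k x * indicator {-R..R} x \<partial>lborel) = h R - h (- R)"
      using k(2) h kc by (intro integral_FTC_Icc_real) (auto simp: continuous_on_eq_continuous_at)
    moreover have "k x * indicator {-R..R} x = k x" for x
    proof (cases "x \<in> {-R..R}")
      case False
      then have "R \<le> \<bar>x\<bar>" by auto
      then show ?thesis using k(3) by simp
    qed simp
    ultimately show ?thesis using k(4) by (simp add: h_def)
  qed
  have h0R: "h x = 0" if "R \<le> \<bar>x\<bar>" for x
    using constant_of_zero_derivative[OF h k(3,2), of x] that hR by (auto simp: h_def abs_if split: if_splits)
  \<comment> \<open>\<open>g\<close> and \<open>g'\<close> take the roles of \<open>f'\<close> and
    \<open>f''\<close>. In the generator the terms containing \<open>h\<close> cancel because
    \<open>Q' \<sigma>\<^sup>2 = 2 b\<close>, and only \<open>k\<close> is left.\<close>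
  define g where "g x = exp (- Q x) * h x" for x
  define g' where "g' x = exp (- Q x) * (k x - q x * h x)" for x
  have g: "(g has_real_derivative g' x) (at x)" for x
    unfolding g_def[abs_def] g'_def q_def using h[of x] Q[of x] by (auto intro!: derivative_eq_intros simp: algebra_simps)
  have gc: "continuous_on UNIV g" by (intro continuous_at_imp_continuous_on ballI DERIV_isCont[OF g])
  have g'c: "continuous_on UNIV g'" unfolding g'_def[abs_def] by (intro continuous_intros Qc kc qc hc)
  have g0: "g x = 0" "g' x = 0" if "R \<le> \<bar>x\<bar>" for x using h0R[OF that] k(3)[OF that] by (auto simp: g_def g'_def)
  obtain f where f: "\<And>x. (f has_real_derivative g x) (at x)" using antiderivative_real[OF gc] by blast
  have fc: "continuous_on UNIV f" by (intro continuous_at_imp_continuous_on ballI DERIV_isCont[OF f])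
  obtain K1 where K1: "\<And>x. \<bar>f x\<bar> \<le> K1"
    using bounded_of_constant_ends[OF fc k(2)] constant_of_zero_derivative[OF f g0(1) k(2)] by blast
  obtain K2 where K2: "\<And>x. \<bar>g x\<bar> \<le> K2"
    using bounded_of_constant_ends[OF gc k(2)] g0(1) k(2) by fastforce
  obtain K3 where K3: "\<And>x. \<bar>g' x\<bar> \<le> K3"
    using bounded_of_constant_ends[OF g'c k(2)] g0(2) k(2) by fastforce
  have "continuous_on UNIV (\<lambda>x. g x * b x)" by (intro continuous_intros gc bc)
  from bounded_of_constant_ends[OF this k(2)] obtain K4 where K4: "\<And>x. \<bar>g x * b x\<bar> \<le> K4"
    using g0(1) k(2) by fastforce
  \<comment> \<open>Through \<open>q\<close>, the function \<open>g'\<close> contains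
    \<open>1 / \<sigma>\<^sup>2\<close>, so Lipschitz is the regularity to aim for. On the bounded
    interval it is built from products of Lipschitz functions, the lower bound
    \<open>\<sigma>l\<close> making \<open>1 / \<sigma>\<close> one of them.\<close>
  have "\<exists>L. L-lipschitz_on {-R..R} g'"
  proof -
    have inv: "\<exists>L. L-lipschitz_on {-R..R} (\<lambda>x. inverse (\<sigma> x))"
    proof -
      have "(C / \<sigma>l\<^sup>2)-lipschitz_on {-R..R} (\<lambda>x. inverse (\<sigma> x))"
      proof (rule lipschitz_onI)
        fix x y
        have s: "\<sigma>l \<le> \<bar>\<sigma> z\<bar>" for z using \<sigma>(2) \<sigma>(3)[of z] by (metis abs_le_square_iff abs_of_pos)
        have "dist (inverse (\<sigma> x)) (inverse (\<sigma> y)) = \<bar>\<sigma> x - \<sigma> y\<bar> / (\<bar>\<sigma> x\<bar> * \<bar>\<sigma> y\<bar>)"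
          using \<sigma>_nz[of x] \<sigma>_nz[of y] by (simp add: dist_real_def inverse_diff_inverse abs_mult divide_inverse abs_minus_commute mult.commute)
        also have "\<dots> \<le> (C * \<bar>x - y\<bar>) / (\<sigma>l * \<sigma>l)"
          using lipschitz_onD[OF \<sigma>(1), of x y] s[of x] s[of y] \<sigma>(2)
          by (intro frac_le mult_mono) (auto simp: dist_real_def lipschitz_on_nonneg[OF \<sigma>(1)])
        finally show "dist (inverse (\<sigma> x)) (inverse (\<sigma> y)) \<le> C / \<sigma>l\<^sup>2 * dist x y"
          by (simp add: dist_real_def power2_eq_square)
      qed (use lipschitz_on_nonneg[OF \<sigma>(1)] in simp)
      then show ?thesis by blast
    qed
    have const: "\<exists>L. L-lipschitz_on {-R..R} (\<lambda>x. c)" for c :: real using lipschitz_on_constant by blast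
    have lb: "\<exists>L. L-lipschitz_on {-R..R} b" by (rule lipschitz_on_C1_Icc[OF b])
    have lk: "\<exists>L. L-lipschitz_on {-R..R} k" using lipschitz_on_subset[OF k(1)] by blast
    have lh: "\<exists>L. L-lipschitz_on {-R..R} h" by (rule lipschitz_on_C1_Icc[OF h kc])
    have le: "\<exists>L. L-lipschitz_on {-R..R} (\<lambda>x. exp (- Q x))"
    proof (rule lipschitz_on_C1_Icc)
      show "((\<lambda>x. exp (- Q x)) has_real_derivative exp (- Q x) * - q x) (at x)" for x
        unfolding q_def using Q[of x] by (auto intro!: derivative_eq_intros)
      show "continuous_on UNIV (\<lambda>x. exp (- Q x) * - q x)" by (intro continuous_intros Qc qc)
    qed
    have lq: "\<exists>L. L-lipschitz_on {-R..R} (\<lambda>x. (2 * b x) * (inverse (\<sigma> x) * inverse (\<sigma> x)))"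
      by (intro lipschitz_on_mult_Icc inv const lb)
    obtain L1 where L1: "L1-lipschitz_on {-R..R} k" using lk by blast
    obtain L2 where L2: "L2-lipschitz_on {-R..R} (\<lambda>x. ((2 * b x) * (inverse (\<sigma> x) * inverse (\<sigma> x))) * h x)"
      using lipschitz_on_mult_Icc[OF lq lh] by blast
    have "\<exists>L. L-lipschitz_on {-R..R} (\<lambda>x. k x - ((2 * b x) * (inverse (\<sigma> x) * inverse (\<sigma> x))) * h x)"
      using lipschitz_on_diff[OF L1 L2] by blast
    from lipschitz_on_mult_Icc[OF le this] show ?thesis
      unfolding g'_def[abs_def] q_def by (simp add: divide_inverse power2_eq_square)
  qed
  then obtain L' where L': "L'-lipschitz_on {-R..R} g'" by blast
  note lip = lipschitz_of_compact_support[OF L' k(2) g0(2)]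
  define K where "K = Max {K1, K2, K3, K4, L'}"
  have KK: "K1 \<le> K" "K2 \<le> K" "K3 \<le> K" "K4 \<le> K" "L' \<le> K" by (auto simp: K_def)
  have "\<bar>g' x - g' y\<bar> \<le> K * \<bar>x - y\<bar>" for x y
    by (rule order_trans[OF lip mult_right_mono[OF KK(5)]]) auto
  moreover have "g x * b x + g' x / 2 * (\<sigma> x)\<^sup>2 = exp (- Q x) * (\<sigma> x)\<^sup>2 / 2 * k x" for x
    unfolding g_def g'_def q_def using \<sigma>_nz[of x] by (simp add: field_simps)
  ultimately show ?thesis
    using f g order_trans[OF K1 KK(1)] order_trans[OF K2 KK(2)] order_trans[OF K3 KK(3)] order_trans[OF K4 KK(4)]
    by (intro exI[of _ f] exI[of _ g] exI[of _ g'] exI[of _ K]) auto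
qed

text \<open>A trapezoid over \<open>[l, u]\<close> with flanks of slope \<open>n\<close>: Lipschitz,
  of compact support, and tending pointwise to the indicator of the open interval.\<close>

definition trapezoid :: "real \<Rightarrow> real \<Rightarrow> nat \<Rightarrow> real \<Rightarrow> real" where
  "trapezoid l u n x = max 0 (min 1 (real n * min (x - l) (u - x)))"

lemma trapezoid_bounds: "0 \<le> trapezoid l u n x" "trapezoid l u n x \<le> 1"
  by (auto simp: trapezoid_def)

lemma trapezoid_outside: "x \<le> l \<or> u \<le> x \<Longrightarrow> trapezoid l u n x = 0"
proof -
  assume "x \<le> l \<or> u \<le> x"
  then have "min (x - l) (u - x) \<le> 0" by auto
  then have "real n * min (x - l) (u - x) \<le> 0" by (intro mult_nonneg_nonpos) auto
  then show ?thesis unfolding trapezoid_def by linarith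
qed

lemma trapezoid_lipschitz: "(real n)-lipschitz_on UNIV (trapezoid l u n)"
proof (rule lipschitz_onI)
  fix x y :: real
  have clip: "\<bar>max 0 (min 1 s) - max 0 (min 1 t)\<bar> \<le> \<bar>s - t\<bar>" for s t :: real by (auto simp: max_def min_def)
  have "\<bar>min (x - l) (u - x) - min (y - l) (u - y)\<bar> \<le> \<bar>x - y\<bar>" by (auto simp: min_def)
  then have "real n * \<bar>min (x - l) (u - x) - min (y - l) (u - y)\<bar> \<le> real n * \<bar>x - y\<bar>" by (rule mult_left_mono) simp
  moreover have "\<bar>real n * min (x - l) (u - x) - real n * min (y - l) (u - y)\<bar> = real n * \<bar>min (x - l) (u - x) - min (y - l) (u - y)\<bar>"
    by (simp add: right_diff_distrib[symmetric] abs_mult del: min_diff_distrib_left)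
  ultimately show "dist (trapezoid l u n x) (trapezoid l u n y) \<le> real n * dist x y"
    unfolding trapezoid_def dist_real_def
    using clip[of "real n * min (x - l) (u - x)" "real n * min (y - l) (u - y)"] by linarith
qed simp

lemma trapezoid_measurable [measurable]: "trapezoid l u n \<in> borel_measurable borel"
  unfolding trapezoid_def[abs_def] by measurable

lemma trapezoid_tendsto: "(\<lambda>n. trapezoid l u n x) \<longlonglongrightarrow> indicator {l<..<u} x"
proof (cases "x \<in> {l<..<u}")
  case True
  define m where "m = min (x - l) (u - x)"
  have m: "m > 0" using True by (auto simp: m_def)
  obtain n0 where n0: "1 / m < real n0" using reals_Archimedean2 by blast
  have "\<forall>\<^sub>F n in sequentially. trapezoid l u n x = 1"
    using eventually_ge_at_top[of n0]
  proof eventually_elim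
    case (elim n)
    then have "1 / m < real n" using n0 by simp
    then have "1 \<le> real n * m" using m by (simp add: field_simps)
    then show ?case by (simp add: trapezoid_def m_def[symmetric])
  qed
  then show ?thesis using True by (simp add: tendsto_eventually)
next
  case False
  then have "trapezoid l u n x = 0" for n by (intro trapezoid_outside) auto
  then show ?thesis using False by simp
qed

lemma trapezoid_dominated: "trapezoid l u n x \<le> indicator {l..u} x"
  using trapezoid_outside[of x l u n] trapezoid_bounds(2)[of l u n x] by (auto simp: indicator_def not_le)

text \<open>A linear functional that kills every test function of zero Lebesgue integral is a
  multiple of the Lebesgue integral. Applied to trapezoids and passed to the limit, this shows that
  \<open>w\<close> times \<open>\<nu>\<close> agrees with a multiple of Lebesgue measure on
  intervals, hence everywhere.\<close>

lemma density_of_test_integrals: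
  fixes \<nu> :: "real measure" and w :: "real \<Rightarrow> real"
  assumes \<nu>: "prob_space \<nu>" "sets \<nu> = sets borel"
    and w: "continuous_on UNIV w" "\<And>x. 0 < w x"
    and test: "\<And>k L R. L-lipschitz_on UNIV k \<Longrightarrow> 0 \<le> R \<Longrightarrow> (\<And>x. R \<le> \<bar>x\<bar> \<Longrightarrow> k x = 0) \<Longrightarrow>
      (\<integral>x. k x \<partial>lborel) = 0 \<Longrightarrow> (\<integral>x. w x * k x \<partial>\<nu>) = 0"
  shows "\<exists>c>0. \<nu> = density lborel (\<lambda>x. ennreal (c / w x))"
proof -
  interpret \<nu>: prob_space \<nu> by fact
  have [measurable_cong]: "sets \<nu> = sets borel" by fact
  have sp: "space \<nu> = UNIV" using sets_eq_imp_space_eq[OF \<nu>(2)] by simp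
  have wm[measurable]: "w \<in> borel_measurable borel" by (rule borel_measurable_continuous_onI[OF w(1)])
  have wbd: "\<exists>W. \<forall>x\<in>{a..b}. w x \<le> W" for a b
  proof -
    have "bounded (w ` {a..b})"
      by (intro compact_imp_bounded compact_continuous_image continuous_on_subset[OF w(1)]) auto
    then obtain W where "\<forall>x\<in>{a..b}. \<bar>w x\<bar> \<le> W" unfolding bounded_iff by auto
    then show ?thesis by (intro exI[of _ W]) force
  qed
  have int\<nu>: "integrable \<nu> (\<lambda>x. w x * k x)" if km: "k \<in> borel_measurable borel" and kb: "\<And>x. \<bar>k x\<bar> \<le> K * indicator {a..b} x" for k K a b
  proof -
    obtain W where W: "\<forall>x\<in>{a..b}. w x \<le> W" using wbd by blast
    have "\<bar>w x * k x\<bar> \<le> W * K" if x: "x \<in> {a..b}" for x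
    proof -
      have "0 < w x" "w x \<le> W" using W x w(2) by auto
      then show ?thesis unfolding abs_mult using kb[of x] x by (intro mult_mono) auto
    qed
    moreover have "w x * k x = 0" if "x \<notin> {a..b}" for x using kb[of x] that by simp
    ultimately have "\<bar>w x * k x\<bar> \<le> \<bar>W * K\<bar>" for x by (metis abs_ge_self abs_ge_zero abs_zero order_trans)
    then show ?thesis using km by (intro \<nu>.integrable_const_bound[of _ "\<bar>W * K\<bar>"]) auto
  qed
  have intl: "integrable lborel k" if "k \<in> borel_measurable borel" "\<And>x. \<bar>k x\<bar> \<le> K * indicator {a..b} x" for k :: "real \<Rightarrow> real" and K a b
  proof (rule Bochner_Integration.integrable_bound[of _ "\<lambda>x. K * indicator {a..b} x"])
    show "AE x in lborel. norm (k x) \<le> norm (K * indicator {a..b} x)"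
      using that(2) by (intro AE_I2) (force intro: order_trans[OF _ abs_ge_self])
    show "integrable lborel (\<lambda>x. K * indicator {a..b} x)"
      by (intro integrable_mult_right integrable_real_indicator emeasure_bounded_finite) auto
  qed (use that(1) in auto)
  note tb = trapezoid_bounds trapezoid_dominated
  have tdom: "\<bar>trapezoid l u n x\<bar> \<le> 1 * indicator {l..u} x" for l u n x
    using tb by (simp add: abs_of_nonneg)

  \<comment> \<open>The reference trapezoid has positive integral: subtracting a multiple of it
    turns any trapezoid into a test function of integral zero, and its own value fixes
    \<open>c\<close>.\<close>
  define I0 where "I0 = (\<integral>x. trapezoid (-1) 1 1 x \<partial>lborel)"
  have I0: "I0 > 0"
  proof -
    have "(\<integral>x. 1 / 2 * indicator {-1/2..1/2::real} x \<partial>lborel) \<le> I0"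
      unfolding I0_def
    proof (rule integral_mono)
      show "integrable lborel (trapezoid (-1) 1 1)" by (rule intl[OF _ tdom]) measurable
      show "integrable lborel (\<lambda>x. 1 / 2 * indicator {-1/2..1/2::real} x :: real)"
        by (intro integrable_mult_right integrable_real_indicator emeasure_bounded_finite) auto
      show "1 / 2 * indicator {-1/2..1/2::real} x \<le> trapezoid (-1) 1 1 x" for x :: real
        by (auto simp: indicator_def trapezoid_def min_def)
    qed
    then show ?thesis by simp
  qed
  define c where "c = (\<integral>x. w x * trapezoid (-1) 1 1 x \<partial>\<nu>) / I0"
  have key: "(\<integral>x. w x * trapezoid l u n x \<partial>\<nu>) = c * (\<integral>x. trapezoid l u n x \<partial>lborel)" for l u n
  proof -
    define J where "J = (\<integral>x. trapezoid l u n x \<partial>lborel)"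
    define k where "k x = trapezoid l u n x - J / I0 * trapezoid (-1) 1 1 x" for x
    define R where "R = Max {1, \<bar>l\<bar>, \<bar>u\<bar>}"
    have R: "1 \<le> R" "\<bar>l\<bar> \<le> R" "\<bar>u\<bar> \<le> R" by (auto simp: R_def)
    have i1: "integrable lborel (trapezoid l u n)" for l u n by (rule intl[OF _ tdom]) measurable
    have i2: "integrable \<nu> (\<lambda>x. w x * trapezoid l u n x)" for l u n by (rule int\<nu>[OF _ tdom]) measurable
    have "(\<integral>x. w x * k x \<partial>\<nu>) = 0"
    proof (rule test)
      show "(real n + \<bar>J / I0\<bar> * real 1)-lipschitz_on UNIV k"
        unfolding k_def[abs_def]
        by (intro lipschitz_on_diff trapezoid_lipschitz lipschitz_on_cmult_real)
      show "k x = 0" if "R \<le> \<bar>x\<bar>" for x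
      proof -
        have "x \<le> l \<or> u \<le> x" "x \<le> -1 \<or> 1 \<le> x" using that R by linarith+
        then show ?thesis by (simp add: k_def trapezoid_outside)
      qed
      show "(\<integral>x. k x \<partial>lborel) = 0"
        unfolding k_def using i1[of l u n] i1[of "-1" 1 1] I0 by (simp add: J_def[symmetric] I0_def[symmetric] del: One_nat_def)
    qed (use R in simp)
    also have "(\<integral>x. w x * k x \<partial>\<nu>) = (\<integral>x. w x * trapezoid l u n x - J / I0 * (w x * trapezoid (-1) 1 1 x) \<partial>\<nu>)"
      by (simp add: k_def right_diff_distrib mult_ac)
    also have "\<dots> = (\<integral>x. w x * trapezoid l u n x \<partial>\<nu>) - J / I0 * (\<integral>x. w x * trapezoid (-1) 1 1 x \<partial>\<nu>)"
      using i2[of l u n] i2[of "-1" 1 1] by simp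
    finally show ?thesis by (simp add: c_def J_def)
  qed
  have box: "(\<integral>x. w x * indicator {l<..<u} x \<partial>\<nu>) = c * (u - l)" if "l \<le> u" for l u
  proof -
    obtain W where W: "\<forall>x\<in>{l..u}. w x \<le> W" using wbd by blast
    have "(\<lambda>n. \<integral>x. w x * trapezoid l u n x \<partial>\<nu>) \<longlonglongrightarrow> (\<integral>x. w x * indicator {l<..<u} x \<partial>\<nu>)"
    proof (rule integral_dominated_convergence[where w="\<lambda>x. w x * indicator {l..u} x"])
      show "integrable \<nu> (\<lambda>x. w x * indicator {l..u} x)" by (rule int\<nu>[of _ 1 l u]) auto
      show "AE x in \<nu>. norm (w x * trapezoid l u n x) \<le> w x * indicator {l..u} x" for n
        using tdom w(2) by (intro AE_I2) (auto simp: abs_mult abs_of_pos intro!: mult_left_mono less_imp_le[OF w(2)])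
      show "AE x in \<nu>. (\<lambda>n. w x * trapezoid l u n x) \<longlonglongrightarrow> w x * indicator {l<..<u} x"
        by (intro AE_I2 tendsto_mult tendsto_const trapezoid_tendsto)
    qed measurable
    moreover have "(\<lambda>n. \<integral>x. trapezoid l u n x \<partial>lborel) \<longlonglongrightarrow> (\<integral>x. indicator {l<..<u} x \<partial>lborel)"
    proof (rule integral_dominated_convergence[where w="\<lambda>x. indicator {l..u} x"])
      show "AE x in lborel. norm (trapezoid l u n x) \<le> indicator {l..u} x" for n
        using tdom by (intro AE_I2) auto
      show "integrable lborel (\<lambda>x. indicator {l..u} x :: real)"
        by (intro integrable_real_indicator emeasure_bounded_finite) auto
    qed (auto intro: trapezoid_tendsto)
    then have "(\<lambda>n. c * (\<integral>x. trapezoid l u n x \<partial>lborel)) \<longlonglongrightarrow> c * (u - l)"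
      using that by (intro tendsto_mult tendsto_const) simp
    ultimately show ?thesis unfolding key by (rule LIMSEQ_unique)
  qed
  have em: "(\<integral>\<^sup>+x. ennreal (w x) * indicator {l<..<u} x \<partial>\<nu>) = ennreal (c * (u - l))" if "l \<le> u" for l u
  proof -
    have "(\<integral>\<^sup>+x. ennreal (w x) * indicator {l<..<u} x \<partial>\<nu>) = (\<integral>\<^sup>+x. ennreal (w x * indicator {l<..<u} x) \<partial>\<nu>)"
      by (intro nn_integral_cong) (auto simp: indicator_def)
    also have "\<dots> = ennreal (\<integral>x. w x * indicator {l<..<u} x \<partial>\<nu>)"
      by (intro nn_integral_eq_integral int\<nu>[of _ 1 l u]) (auto simp: indicator_def less_imp_le[OF w(2)])
    finally show ?thesis using box[OF that] by simp
  qed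
  have c: "c > 0"
  proof -
    have "0 \<le> (\<integral>x. w x * trapezoid (-1) 1 1 x \<partial>\<nu>)"
      by (intro integral_nonneg_AE AE_I2 mult_nonneg_nonneg tb less_imp_le[OF w(2)])
    then have "c \<ge> 0" using I0 by (simp add: c_def)
    \<comment> \<open>If \<open>c\<close> were zero, \<open>w\<close> would vanish almost everywhere
      for the probability measure \<open>\<nu>\<close>, against \<open>w > 0\<close>.\<close>
    moreover have "c \<noteq> 0"
    proof
      assume "c = 0"
      have "AE x in \<nu>. \<forall>n::nat. ennreal (w x) * indicator {- real n<..<real n} x = 0"
        unfolding AE_all_countable
      proof
        fix n :: nat
        have "(\<integral>\<^sup>+x. ennreal (w x) * indicator {- real n<..<real n} x \<partial>\<nu>) = 0"
          using em[of "- real n" "real n"] \<open>c = 0\<close> by simp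
        then show "AE x in \<nu>. ennreal (w x) * indicator {- real n<..<real n} x = 0"
          by (subst (asm) nn_integral_0_iff_AE) auto
      qed
      then have "AE x in \<nu>. False"
      proof eventually_elim
        case (elim x)
        obtain n where "\<bar>x\<bar> < real n" using reals_Archimedean2 by blast
        then have "x \<in> {- real n<..<real n}" by auto
        then show False using elim[rule_format, of n] w(2)[of x] by simp
      qed
      then show False by simp
    qed
    ultimately show ?thesis by simp
  qed
  \<comment> \<open>\<open>\<nu>\<close> reweighted so as to give every interval its length;
    inverting the positive weight then recovers \<open>\<nu>\<close>.\<close>
  define \<kappa> where "\<kappa> = density \<nu> (\<lambda>x. ennreal (w x / c))"
  have "lborel = \<kappa>"
  proof (rule lborel_eqI)
    fix l u :: real assume "\<And>b. b \<in> Basis \<Longrightarrow> l \<bullet> b \<le> u \<bullet> b"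
    then have lu: "l \<le> u" by simp
    have "emeasure \<kappa> (box l u) = (\<integral>\<^sup>+x. ennreal (w x / c) * indicator {l<..<u} x \<partial>\<nu>)"
      unfolding \<kappa>_def by (subst emeasure_density) (auto simp: box_real)
    also have "\<dots> = (\<integral>\<^sup>+x. ennreal (1 / c) * (ennreal (w x) * indicator {l<..<u} x) \<partial>\<nu>)"
      using c less_imp_le[OF w(2)] by (intro nn_integral_cong) (simp add: mult.assoc[symmetric] ennreal_mult[symmetric])
    also have "\<dots> = ennreal (1 / c) * ennreal (c * (u - l))"
      by (subst nn_integral_cmult) (auto simp: em[OF lu])
    also have "\<dots> = ennreal (u - l)" using c lu by (simp add: ennreal_mult[symmetric])
    finally show "emeasure \<kappa> (box l u) = ennreal (\<Prod>b\<in>Basis. (u - l) \<bullet> b)" by simp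
  qed (simp add: \<kappa>_def \<nu>)
  then have "density lborel (\<lambda>x. ennreal (c / w x)) = density \<kappa> (\<lambda>x. ennreal (c / w x))"
    by (rule arg_cong)
  also have "\<dots> = density \<nu> (\<lambda>x. ennreal (w x / c) * ennreal (c / w x))"
    unfolding \<kappa>_def by (rule density_density_eq) measurable
  also have "(\<lambda>x. ennreal (w x / c) * ennreal (c / w x)) = (\<lambda>x. 1)"
  proof
    fix x
    show "ennreal (w x / c) * ennreal (c / w x) = 1"
      using c w(2)[of x] by (simp add: ennreal_mult[symmetric])
  qed
  finally show ?thesis using c by (auto simp: density_1)
qed

section \<open>Sign changes and zeros of Laplace transforms\<close>

text \<open>Crossing points are indexed from 1, so the old chain is shifted by one. The equation
  \<open>x' 1 = y\<close> is part of the conclusion because a further point is later put in front of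
  \<open>y\<close>.\<close>

lemma has_crossings_prepend:
  assumes x: "\<forall>i\<in>{1..N}. x i < x (i + 1) \<and> f (x i) * f (x (i + 1)) < 0"
    and y: "y < x 1" "f y * f (x 1) < 0"
  shows "\<exists>x'. (\<forall>i\<in>{1..Suc N}. x' i < x' (i + 1) \<and> f (x' i) * f (x' (i + 1)) < 0) \<and> x' 1 = y"
proof (intro exI conjI ballI)
  let ?x = "\<lambda>i. if i \<le> 1 then y else x (i - 1)"
  fix i assume i: "i \<in> {1..Suc N}"
  show "?x i < ?x (i + 1)" "f (?x i) * f (?x (i + 1)) < 0"
  proof -
    have "?x i < ?x (i + 1) \<and> f (?x i) * f (?x (i + 1)) < 0"
    proof (cases "i = 1")
      case False
      then have "i - 1 \<in> {1..N}" "i - 1 + 1 = i" using i by auto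
      then show ?thesis using x[rule_format, of "i - 1"] False i by auto
    qed (use y in simp)
    then show "?x i < ?x (i + 1)" "f (?x i) * f (?x (i + 1)) < 0" by auto
  qed
qed simp

lemma crossings_chain_ge:
  fixes x :: "nat \<Rightarrow> real"
  assumes x: "\<forall>i\<in>{1..N}. x i < x (i + 1)" and "1 \<le> j" "j \<le> i" "i \<le> N + 1"
  shows "x j \<le> x i"
  using assms(3,4)
proof (induction i rule: dec_induct)
  case (step i)
  then show ?case using x[rule_format, of i] assms(2) by simp
qed simp

lemma no_crossings_constant_sign:
  assumes "\<not> has_crossings f 1"
  shows "(\<forall>x. 0 \<le> f x) \<or> (\<forall>x. f x \<le> 0)"
proof (rule ccontr)
  assume "\<not> ?thesis"
  then obtain x y where xy: "f x < 0" "f y > 0" by (auto simp: not_le)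
  then have "f x * f y < 0" by (simp add: mult_neg_pos)
  moreover from this have "f y * f x < 0" by (simp add: mult.commute)
  moreover have "x \<noteq> y" using xy by auto
  ultimately have "\<exists>a b. a < b \<and> f a * f b < 0" by (metis linorder_neqE_linordered_idom)
  then obtain a b where "a < b" "f a * f b < 0" by blast
  then have "has_crossings f 1"
    unfolding has_crossings_def by (intro exI[of _ "\<lambda>i. if i = 1 then a else b"]) auto
  with assms show False by simp
qed

text \<open>Multiplying by a factor that changes sign at the first sign change of \<open>f\<close> removes a crossing.\<close>

lemma has_crossings_reduce:
  fixes h :: "real \<Rightarrow> real"
  assumes h: "strict_mono h" and f: "has_crossings f (Suc N)" "\<not> has_crossings f (Suc (Suc N))"
  shows "\<exists>r. \<not> has_crossings (\<lambda>x. (h x - h r) * f x) (Suc N)"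
proof -
  obtain x where x: "\<forall>i\<in>{1..Suc N}. x i < x (i + 1) \<and> f (x i) * f (x (i + 1)) < 0"
    using f(1) unfolding has_crossings_def by blast
  \<comment> \<open>\<open>p\<close> starts a chain with the maximal number of crossings, so no
    point of opposite sign lies before it: such a point could be prepended.\<close>
  define p where "p = x 1"
  have fp: "f p \<noteq> 0" using x[rule_format, of 1] by (auto simp: p_def)
  define S where "S = {y. f y * f p < 0}"
  have Sp: "p < y" if "y \<in> S" for y
  proof (rule ccontr)
    assume "\<not> p < y"
    moreover have "y \<noteq> p" using that by (auto simp: S_def mult_less_0_iff)
    ultimately have "y < x 1" "f y * f (x 1) < 0" using that by (auto simp: S_def p_def)
    from has_crossings_prepend[OF x this] have "has_crossings f (Suc (Suc N))"
      unfolding has_crossings_def by blast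
    with f(2) show False by simp
  qed
  have "x 2 \<in> S" using x[rule_format, of 1] by (simp add: S_def p_def mult.commute numeral_2_eq_2)
  then have Sne: "S \<noteq> {}" by blast
  have Sb: "bdd_below S" using Sp by (intro bdd_belowI[of _ p]) (auto intro: less_imp_le)
  \<comment> \<open>As \<open>f\<close> is an arbitrary function, its first sign change is taken as
    an infimum: before \<open>r\<close> the sign of \<open>p\<close> persists up to zeros, and to
    the left of every point beyond \<open>r\<close> there is a point of opposite sign.\<close>
  define r where "r = Inf S"
  have pr: "p \<le> r" unfolding r_def using Sne Sp by (intro cInf_greatest) (auto intro: less_imp_le)
  have below: "f y * f p \<ge> 0" if "y < r" for y
  proof -
    have "y \<notin> S" using cInf_lower[OF _ Sb, of y] that unfolding r_def by auto
    then show ?thesis by (simp add: S_def not_less)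
  qed
  have above: "\<exists>y\<in>S. y < z" if "r < z" for z
    using that Sne Sb unfolding r_def by (simp add: cInf_less_iff)
  define g where "g x = (h x - h r) * f x" for x
  have "\<not> has_crossings g (Suc N)"
  proof
    assume "has_crossings g (Suc N)"
    then obtain z where z: "\<forall>i\<in>{1..Suc N}. z i < z (i + 1) \<and> g (z i) * g (z (i + 1)) < 0"
      unfolding has_crossings_def by blast
    have mono: "z j \<le> z i" if "1 \<le> j" "j \<le> i" "i \<le> Suc N + 1" for i j
      by (rule crossings_chain_ge[OF _ that]) (use z in blast)
    have sgn_above: "f u * f v < 0" if "r < u" "r < v" "g u * g v < 0" for u v
    proof -
      have "0 < (h u - h r) * (h v - h r)" using that h by (simp add: strict_mono_less)
      moreover have "g u * g v = ((h u - h r) * (h v - h r)) * (f u * f v)" by (simp add: g_def)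
      ultimately show ?thesis using that(3) by (metis mult_less_0_iff not_less_iff_gr_or_eq)
    qed
    have gz1: "g (z 1) \<noteq> 0" and gz12: "g (z 1) * g (z 2) < 0" and z12: "z 1 < z 2"
      using z[rule_format, of 1] by (auto simp: numeral_2_eq_2)
    have gz2: "g (z 2) \<noteq> 0" using gz12 by auto
    have "z 1 \<noteq> r" using gz1 by (auto simp: g_def)
    then consider "r < z 1" | "z 1 < r" by linarith
    then show False
    proof cases
      case 1
      \<comment> \<open>Beyond \<open>r\<close> the factor \<open>h x - h r\<close> is positive, so
        the chain for \<open>g\<close> is one for \<open>f\<close>. One more point in front, either
        \<open>p\<close> or a point of \<open>S\<close>, exceeds the maximum.\<close>
      have chain: "\<forall>i\<in>{1..Suc N}. z i < z (i + 1) \<and> f (z i) * f (z (i + 1)) < 0"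
      proof
        fix i assume i: "i \<in> {1..Suc N}"
        have "r < z i" "r < z (i + 1)" using mono[of 1 i] mono[of 1 "i + 1"] i 1 by auto
        then show "z i < z (i + 1) \<and> f (z i) * f (z (i + 1)) < 0" using z i sgn_above by blast
      qed
      have fz1: "f (z 1) \<noteq> 0" using gz1 by (auto simp: g_def)
      have "\<exists>y. y < z 1 \<and> f y * f (z 1) < 0"
      proof (cases "f (z 1) * f p < 0")
        case True
        then show ?thesis using pr 1 by (intro exI[of _ p]) (simp add: mult.commute)
      next
        case False
        obtain y where y: "y \<in> S" "y < z 1" using above[OF 1] by blast
        have "f y * f p < 0" using y by (simp add: S_def)
        then have "f y * f (z 1) < 0" using False fz1 fp by (auto simp: mult_less_0_iff not_less)
        then show ?thesis using y by blast
      qed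
      then obtain y where "y < z 1" "f y * f (z 1) < 0" by blast
      from has_crossings_prepend[OF chain this] have "has_crossings f (Suc (Suc N))"
        unfolding has_crossings_def by blast
      with f(2) show False by simp
    next
      case 2
      have hz1: "h (z 1) - h r < 0" using 2 h by (simp add: strict_mono_less)
      have fz1: "f (z 1) * f p > 0"
        using below[OF 2] gz1 fp by (auto simp: g_def less_le)
      have rz2: "r < z 2"
      proof (rule ccontr)
        assume "\<not> r < z 2"
        moreover have "z 2 \<noteq> r" using gz2 by (auto simp: g_def)
        ultimately have z2: "z 2 < r" by simp
        then have hz2: "h (z 2) - h r < 0" using h by (simp add: strict_mono_less)
        have fz2: "f (z 2) * f p > 0" using below[OF z2] gz2 fp by (auto simp: g_def less_le)
        have "0 < (h (z 1) - h r) * (h (z 2) - h r)" using hz1 hz2 by (rule mult_neg_neg)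
        moreover have "0 < f (z 1) * f (z 2)" using fz1 fz2 by (auto simp: zero_less_mult_iff)
        ultimately have "0 < ((h (z 1) - h r) * (h (z 2) - h r)) * (f (z 1) * f (z 2))" by (rule mult_pos_pos)
        also have "\<dots> = g (z 1) * g (z 2)" by (simp add: g_def)
        finally show False using gz12 by simp
      qed
      have hz2: "0 < h (z 2) - h r" using rz2 h by (simp add: strict_mono_less)
      have fz12: "0 < f (z 1) * f (z 2)"
      proof -
        have "(h (z 1) - h r) * (h (z 2) - h r) < 0" using hz1 hz2 by (rule mult_neg_pos)
        moreover have "g (z 1) * g (z 2) = ((h (z 1) - h r) * (h (z 2) - h r)) * (f (z 1) * f (z 2))" by (simp add: g_def)
        ultimately show ?thesis using gz12 by (metis mult_less_0_iff not_less_iff_gr_or_eq)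
      qed
      \<comment> \<open>Between \<open>z 1\<close> and \<open>z 2\<close> the factor changes sign,
        so \<open>f\<close> itself keeps its sign there. Dropping \<open>z 1\<close> costs one
        crossing; prepending \<open>y\<close> and then \<open>p\<close> gains two, which is one more
        than allowed.\<close>
      define z' where "z' i = z (i + 1)" for i
      have chain: "\<forall>i\<in>{1..N}. z' i < z' (i + 1) \<and> f (z' i) * f (z' (i + 1)) < 0"
      proof
        fix i assume i: "i \<in> {1..N}"
        have "r < z (i + 1)" "r < z (i + 1 + 1)" using mono[of 2 "i + 1"] mono[of 2 "i + 1 + 1"] i rz2 by auto
        moreover have "i + 1 \<in> {1..Suc N}" using i by auto
        ultimately show "z' i < z' (i + 1) \<and> f (z' i) * f (z' (i + 1)) < 0" unfolding z'_def using z sgn_above by blast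
      qed
      have z'1: "z' 1 = z 2" by (simp add: z'_def numeral_2_eq_2)
      obtain y where y: "y \<in> S" "y < z 2" using above[OF rz2] by blast
      have fy: "f y * f p < 0" using y by (simp add: S_def)
      then have "f y * f (z' 1) < 0" using fz1 fz12 unfolding z'1 by (auto simp: mult_less_0_iff zero_less_mult_iff)
      moreover have "y < z' 1" using y z'1 by simp
      ultimately have 1: "\<exists>x'. (\<forall>i\<in>{1..Suc N}. x' i < x' (i + 1) \<and> f (x' i) * f (x' (i + 1)) < 0) \<and> x' 1 = y"
        using has_crossings_prepend[OF chain] by blast
      then obtain x' where x': "\<forall>i\<in>{1..Suc N}. x' i < x' (i + 1) \<and> f (x' i) * f (x' (i + 1)) < 0" "x' 1 = y" by blast
      have "p < x' 1" "f p * f (x' 1) < 0" using x'(2) Sp[OF y(1)] fy by (auto simp: mult.commute)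
      from has_crossings_prepend[OF x'(1) this] have "has_crossings f (Suc (Suc N))"
        unfolding has_crossings_def by blast
      with f(2) show False by simp
    qed
  qed
  then show ?thesis unfolding g_def by blast
qed

text \<open>Points are added from left to right. The bound \<open>x < Max A\<close> separates the
  zeros of \<open>g'\<close> found so far from the new one, which lies beyond the old
  maximum.\<close>

lemma rolle_finite_set:
  fixes g g' :: "real \<Rightarrow> real"
  assumes g: "\<And>x. (g has_real_derivative g' x) (at x)" and "finite A" "A \<noteq> {}" "\<And>x. x \<in> A \<Longrightarrow> g x = 0"
  shows "\<exists>B. finite B \<and> B \<subseteq> {x. g' x = 0} \<and> card A = Suc (card B) \<and> (\<forall>x\<in>B. x < Max A)"
  using assms(2-4)
proof (induction A rule: finite_linorder_max_induct)
  case (insert b A)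
  show ?case
  proof (cases "A = {}")
    case True
    then show ?thesis by (intro exI[of _ "{}"]) auto
  next
    case False
    with insert obtain B where B: "finite B" "B \<subseteq> {x. g' x = 0}" "card A = Suc (card B)" "\<forall>x\<in>B. x < Max A" by auto
    have Ab: "Max A < b" using insert.hyps False by simp
    have "\<exists>\<xi>. Max A < \<xi> \<and> \<xi> < b \<and> g' \<xi> = 0"
    proof -
      have "g (Max A) = g b" using insert.prems insert.hyps False by simp
      moreover have "continuous_on {Max A..b} g"
        by (rule DERIV_continuous_on[of _ _ g']) (auto intro: has_field_derivative_at_within g)
      ultimately have "\<exists>\<xi>>Max A. \<xi> < b \<and> (*) (g' \<xi>) = (\<lambda>v. 0)"
        using g by (intro Rolle_deriv[OF Ab]) (auto simp: has_field_derivative_def)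
      then show ?thesis by (metis mult.right_neutral)
    qed
    then obtain \<xi> where \<xi>: "Max A < \<xi>" "\<xi> < b" "g' \<xi> = 0" by blast
    have "\<xi> \<notin> B" using B(4) \<xi>(1) by auto
    moreover have "Max (insert b A) = b" using Ab insert.hyps False by (simp add: max_absorb1)
    moreover have "b \<notin> A" using insert.hyps by auto
    ultimately show ?thesis
      using B \<xi> insert.hyps by (intro exI[of _ "insert \<xi> B"]) (auto intro: order_less_trans)
  qed
qed simp

lemma rolle_card:
  fixes g g' :: "real \<Rightarrow> real"
  assumes g: "\<And>x. (g has_real_derivative g' x) (at x)" and "finite {x. g' x = 0}" "card {x. g' x = 0} \<le> N"
  shows "finite {x. g x = 0} \<and> card {x. g x = 0} \<le> Suc N"
proof -
  \<comment> \<open>Finite subsets come first: an infinite set has \<open>card\<close> 0, so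
    finiteness has to be derived before a bound on \<open>card\<close> says anything.\<close>
  have *: "card A \<le> Suc N" if "finite A" "A \<subseteq> {x. g x = 0}" for A
  proof (cases "A = {}")
    case False
    with rolle_finite_set[OF g that(1)] that(2) obtain B where "B \<subseteq> {x. g' x = 0}" "card A = Suc (card B)" by blast
    then show ?thesis using card_mono[OF assms(2), of B] assms(3) by simp
  qed simp
  have "finite {x. g x = 0}"
  proof (rule ccontr)
    assume "infinite {x. g x = 0}"
    from infinite_arbitrarily_large[OF this, of "Suc (Suc N)"] *
    show False by force
  qed
  with * show ?thesis by blast
qed

lemma exp_second_order:
  fixes u :: real
  shows "\<bar>exp u - 1 - u\<bar> \<le> u\<^sup>2 * exp \<bar>u\<bar>"
proof -
  obtain t where t: "\<bar>t\<bar> \<le> \<bar>u\<bar>" "exp u = (\<Sum>m<2. u ^ m / fact m) + exp t / fact 2 * u ^ 2"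
    using Maclaurin_exp_le[of u 2] by blast
  have "exp u - 1 - u = exp t / 2 * u\<^sup>2" using t(2) by (simp add: numeral_2_eq_2)
  then have "\<bar>exp u - 1 - u\<bar> = \<bar>exp t / 2 * u\<^sup>2\<bar>" by (rule arg_cong)
  also have "\<dots> = exp t / 2 * u\<^sup>2" by simp
  also have "\<dots> \<le> exp \<bar>u\<bar> * u\<^sup>2"
  proof (rule mult_right_mono)
    have "exp t \<le> exp \<bar>u\<bar>" using t(1) by simp
    then show "exp t / 2 \<le> exp \<bar>u\<bar>" using exp_ge_zero[of t] by linarith
  qed simp
  finally show ?thesis by (simp add: mult.commute)
qed

lemma exp_abs_le: "exp \<bar>u\<bar> \<le> exp u + exp (- u)" for u :: real
  by (cases "0 \<le> u") (auto simp: abs_if)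

lemma square_le_exp: "u\<^sup>2 \<le> 2 * exp \<bar>u\<bar>" for u :: real
  using exp_lower_Taylor_quadratic[of "\<bar>u\<bar>"] by simp

text \<open>Asking for every real \<open>m\<close> leaves room to shift: a factor \<open>h\<close>
  is dominated through \<open>m - 1\<close> and \<open>m + 1\<close>, the remainder of a difference
  quotient through \<open>m - 2\<close> and \<open>m + 2\<close>.\<close>

definition exp_integrable :: "(real \<Rightarrow> real) \<Rightarrow> (real \<Rightarrow> real) \<Rightarrow> bool" where
  "exp_integrable h f \<longleftrightarrow> f \<in> borel_measurable borel \<and> (\<forall>m. integrable lborel (\<lambda>x. f x * exp (m * h x)))"

definition laplace :: "(real \<Rightarrow> real) \<Rightarrow> (real \<Rightarrow> real) \<Rightarrow> real \<Rightarrow> real" where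
  "laplace h f m = (\<integral>x. f x * exp (m * h x) \<partial>lborel)"

lemma exp_integrable_mult:
  assumes f: "exp_integrable h f" and [measurable]: "h \<in> borel_measurable borel"
  shows "exp_integrable h (\<lambda>x. h x * f x)"
  unfolding exp_integrable_def
proof (intro conjI allI)
  have [measurable]: "f \<in> borel_measurable borel" using f by (simp add: exp_integrable_def)
  show "(\<lambda>x. h x * f x) \<in> borel_measurable borel" by measurable
  fix m
  show "integrable lborel (\<lambda>x. h x * f x * exp (m * h x))"
  proof (rule Bochner_Integration.integrable_bound)
    show "integrable lborel (\<lambda>x. \<bar>f x * exp ((m + 1) * h x)\<bar> + \<bar>f x * exp ((m - 1) * h x)\<bar>)"
      using f unfolding exp_integrable_def by (intro Bochner_Integration.integrable_add integrable_abs) auto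
    show "AE x in lborel. norm (h x * f x * exp (m * h x)) \<le> norm (\<bar>f x * exp ((m + 1) * h x)\<bar> + \<bar>f x * exp ((m - 1) * h x)\<bar>)"
    proof (rule AE_I2)
      fix x
      have "\<bar>h x\<bar> \<le> exp (h x) + exp (- h x)"
        using exp_ge_add_one_self[of "\<bar>h x\<bar>"] exp_abs_le[of "h x"] by linarith
      then have "\<bar>h x\<bar> * (\<bar>f x\<bar> * exp (m * h x)) \<le> (exp (h x) + exp (- h x)) * (\<bar>f x\<bar> * exp (m * h x))"
        by (rule mult_right_mono) simp
      also have "\<dots> = \<bar>f x * exp ((m + 1) * h x)\<bar> + \<bar>f x * exp ((m - 1) * h x)\<bar>"
        by (simp add: abs_mult algebra_simps exp_add exp_diff exp_minus divide_inverse)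
      finally show "norm (h x * f x * exp (m * h x)) \<le> norm (\<bar>f x * exp ((m + 1) * h x)\<bar> + \<bar>f x * exp ((m - 1) * h x)\<bar>)"
        by (simp add: abs_mult mult.assoc)
    qed
  qed measurable
qed

lemma exp_integrable_diff_mult:
  assumes f: "exp_integrable h f" and h[measurable]: "h \<in> borel_measurable borel"
  shows "exp_integrable h (\<lambda>x. (h x - c) * f x)"
    and "laplace h (\<lambda>x. (h x - c) * f x) m = laplace h (\<lambda>x. h x * f x) m - c * laplace h f m"
proof -
  note hf = exp_integrable_mult[OF f h]
  have eq: "(h x - c) * f x * exp (m * h x) = h x * f x * exp (m * h x) - c * (f x * exp (m * h x))" for x m
    by (simp add: algebra_simps)
  show "exp_integrable h (\<lambda>x. (h x - c) * f x)"
    using f hf unfolding exp_integrable_def eq by auto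
  show "laplace h (\<lambda>x. (h x - c) * f x) m = laplace h (\<lambda>x. h x * f x) m - c * laplace h f m"
    using f hf unfolding exp_integrable_def laplace_def eq by simp
qed

lemma laplace_derivative:
  assumes f: "exp_integrable h f" and h[measurable]: "h \<in> borel_measurable borel"
  shows "(laplace h f has_real_derivative laplace h (\<lambda>x. h x * f x) m) (at m)"
proof -
  have [measurable]: "f \<in> borel_measurable borel" using f by (simp add: exp_integrable_def)
  have fi: "integrable lborel (\<lambda>x. f x * exp (m * h x))" for m using f by (simp add: exp_integrable_def)
  have hfi: "integrable lborel (\<lambda>x. h x * f x * exp (m * h x))" for m
    using exp_integrable_mult[OF f h] by (simp add: exp_integrable_def)
  \<comment> \<open>For \<open>\<bar>d\<bar> \<le> 1\<close> the second-order remainder of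
    \<open>exp (d h)\<close> is at most \<open>d\<^sup>2 h\<^sup>2 exp \<bar>h\<bar>\<close>, and
    \<open>h\<^sup>2 \<le> 2 exp \<bar>h\<bar>\<close> turns this into
    \<open>2 d\<^sup>2 exp (2 \<bar>h\<bar>)\<close>: hence the factor 2 and the shifts by
    2.\<close>
  define g where "g x = 2 * (\<bar>f x * exp ((m + 2) * h x)\<bar> + \<bar>f x * exp ((m - 2) * h x)\<bar>)" for x
  have gi: "integrable lborel g" unfolding g_def[abs_def] using fi by (intro integrable_mult_right Bochner_Integration.integrable_add integrable_abs)
  define C where "C = (\<integral>x. g x \<partial>lborel)"
  have bound: "\<bar>laplace h f (m + d) - laplace h f m - d * laplace h (\<lambda>x. h x * f x) m\<bar> \<le> d\<^sup>2 * C" if d: "\<bar>d\<bar> \<le> 1" for d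
  proof -
    have "laplace h f (m + d) - laplace h f m - d * laplace h (\<lambda>x. h x * f x) m
      = (\<integral>x. f x * exp ((m + d) * h x) - f x * exp (m * h x) - d * (h x * f x * exp (m * h x)) \<partial>lborel)"
      unfolding laplace_def using fi hfi by simp
    also have "\<bar>\<dots>\<bar> \<le> (\<integral>x. d\<^sup>2 * g x \<partial>lborel)"
    proof (rule integral_abs_bound_integral)
      show "integrable lborel (\<lambda>x. f x * exp ((m + d) * h x) - f x * exp (m * h x) - d * (h x * f x * exp (m * h x)))"
        using fi hfi by auto
      show "integrable lborel (\<lambda>x. d\<^sup>2 * g x)" using gi by auto
      fix x
      have "f x * exp ((m + d) * h x) - f x * exp (m * h x) - d * (h x * f x * exp (m * h x))
        = (f x * exp (m * h x)) * (exp (d * h x) - 1 - d * h x)"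
        by (simp add: distrib_right exp_add algebra_simps)
      then have "\<bar>f x * exp ((m + d) * h x) - f x * exp (m * h x) - d * (h x * f x * exp (m * h x))\<bar>
        = \<bar>f x\<bar> * exp (m * h x) * \<bar>exp (d * h x) - 1 - d * h x\<bar>"
        by (simp add: abs_mult)
      also have "\<dots> \<le> \<bar>f x\<bar> * exp (m * h x) * (d\<^sup>2 * (2 * exp (2 * \<bar>h x\<bar>)))"
      proof (intro mult_left_mono)
        have "\<bar>exp (d * h x) - 1 - d * h x\<bar> \<le> (d * h x)\<^sup>2 * exp \<bar>d * h x\<bar>" by (rule exp_second_order)
        also have "\<dots> \<le> (d\<^sup>2 * (2 * exp \<bar>h x\<bar>)) * exp \<bar>h x\<bar>"
        proof (intro mult_mono)
          show "(d * h x)\<^sup>2 \<le> d\<^sup>2 * (2 * exp \<bar>h x\<bar>)"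
            unfolding power_mult_distrib by (intro mult_left_mono square_le_exp) simp
          show "exp \<bar>d * h x\<bar> \<le> exp \<bar>h x\<bar>" using mult_right_mono[OF d, of "\<bar>h x\<bar>"] by (simp add: abs_mult)
        qed auto
        also have "\<dots> = d\<^sup>2 * (2 * exp (2 * \<bar>h x\<bar>))" by (simp add: exp_double power2_eq_square)
        finally show "\<bar>exp (d * h x) - 1 - d * h x\<bar> \<le> d\<^sup>2 * (2 * exp (2 * \<bar>h x\<bar>))" .
      qed simp
      also have "\<dots> \<le> \<bar>f x\<bar> * exp (m * h x) * (d\<^sup>2 * (2 * (exp (2 * h x) + exp (- (2 * h x)))))"
        using exp_abs_le[of "2 * h x"] by (intro mult_left_mono) (auto simp: abs_mult)
      also have "\<dots> = d\<^sup>2 * g x"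
        unfolding g_def by (simp add: abs_mult algebra_simps exp_add exp_diff exp_minus divide_inverse)
      finally show "\<bar>f x * exp ((m + d) * h x) - f x * exp (m * h x) - d * (h x * f x * exp (m * h x))\<bar> \<le> d\<^sup>2 * g x" .
    qed
    also have "\<dots> = d\<^sup>2 * C" by (simp add: C_def)
    finally show ?thesis .
  qed
  have lim: "(\<lambda>d. (laplace h f (m + d) - laplace h f m) / d - laplace h (\<lambda>x. h x * f x) m) \<midarrow>0\<rightarrow> 0"
  proof (rule Lim_null_comparison[where g="\<lambda>d. \<bar>d\<bar> * C"])
    have "\<forall>\<^sub>F d in at 0. d \<noteq> 0 \<and> \<bar>d\<bar> < (1::real)"
      unfolding eventually_at by (intro exI[of _ 1]) (auto simp: dist_real_def)
    then show "\<forall>\<^sub>F d in at 0. norm ((laplace h f (m + d) - laplace h f m) / d - laplace h (\<lambda>x. h x * f x) m) \<le> \<bar>d\<bar> * C"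
    proof eventually_elim
      case (elim d)
      have "(laplace h f (m + d) - laplace h f m) / d - laplace h (\<lambda>x. h x * f x) m
        = (laplace h f (m + d) - laplace h f m - d * laplace h (\<lambda>x. h x * f x) m) / d"
        using elim by (simp add: field_simps)
      also have "\<bar>\<dots>\<bar> \<le> d\<^sup>2 * C / \<bar>d\<bar>"
        unfolding abs_divide using bound[of d] elim by (intro divide_right_mono) auto
      also have "\<dots> = \<bar>d\<bar> * C" using elim by (simp add: power2_eq_square abs_if)
      finally show ?case by simp
    qed
    have "((\<lambda>d. \<bar>d\<bar> * C) \<longlongrightarrow> \<bar>0\<bar> * C) (at 0)" by (intro tendsto_intros)
    then show "(\<lambda>d. \<bar>d\<bar> * C) \<midarrow>0\<rightarrow> 0" by simp
  qed
  then show ?thesis unfolding DERIV_def by (simp add: LIM_zero_iff)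
qed

text \<open>The base case of the rule of signs: the exponential is positive, so for \<open>f\<close>
  of one sign a vanishing integral forces the integrand to vanish almost everywhere.\<close>

lemma laplace_zero_one_sign:
  assumes f: "exp_integrable h f" and h[measurable]: "h \<in> borel_measurable borel"
    and sgn: "(\<forall>x. 0 \<le> f x) \<or> (\<forall>x. f x \<le> 0)" and zero: "laplace h f m = 0"
  shows "AE x in lborel. f x = 0"
proof -
  have fi: "integrable lborel (\<lambda>x. f x * exp (m * h x))" using f by (simp add: exp_integrable_def)
  from sgn have "AE x in lborel. f x * exp (m * h x) = 0"
  proof
    assume "\<forall>x. 0 \<le> f x"
    then show ?thesis using integral_nonneg_eq_0_iff_AE[OF fi] zero by (simp add: laplace_def)
  next
    assume n: "\<forall>x. f x \<le> 0"
    have fi': "integrable lborel (\<lambda>x. - (f x * exp (m * h x)))" using fi by simp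
    have "AE x in lborel. - (f x * exp (m * h x)) = 0"
      using integral_nonneg_eq_0_iff_AE[OF fi'] zero n by (simp add: laplace_def mult_nonpos_nonneg)
    then show ?thesis by simp
  qed
  then show ?thesis by simp
qed

text \<open>Descartes' rule of signs for Laplace transforms: dividing by \<open>exp (m * h r)\<close> and
  differentiating in \<open>m\<close> multiplies \<open>f\<close> by \<open>h - h r\<close>, which removes one crossing and, by Rolle, at
  most one zero.\<close>

lemma laplace_zeros_le_crossings:
  assumes h: "strict_mono h" and hm[measurable]: "h \<in> borel_measurable borel"
    and "exp_integrable h f" "\<not> has_crossings f (Suc N)" "\<not> (AE x in lborel. f x = 0)"
  shows "finite {m. laplace h f m = 0} \<and> card {m. laplace h f m = 0} \<le> N"
  using assms(3-5)
proof (induction N arbitrary: f)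
  case 0
  then have "(\<forall>x. 0 \<le> f x) \<or> (\<forall>x. f x \<le> 0)" by (intro no_crossings_constant_sign) simp
  then have "{m. laplace h f m = 0} = {}" using laplace_zero_one_sign[OF 0(1) hm] 0(3) by blast
  then show ?case by simp
next
  case (Suc N)
  show ?case
  proof (cases "has_crossings f (Suc N)")
    case False
    from Suc.IH[OF Suc.prems(1) this Suc.prems(3)] show ?thesis by simp
  next
    case True
    obtain r where r: "\<not> has_crossings (\<lambda>x. (h x - h r) * f x) (Suc N)"
      using has_crossings_reduce[OF h True Suc.prems(2)] by blast
    let ?f = "\<lambda>x. (h x - h r) * f x"
    \<comment> \<open>The new factor vanishes only at \<open>r\<close>, a null set, so not being
      zero almost everywhere is inherited.\<close>
    have "\<not> (AE x in lborel. ?f x = 0)"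
    proof
      assume "AE x in lborel. ?f x = 0"
      moreover have "AE x in lborel. x \<noteq> r" by (rule AE_lborel_singleton)
      ultimately have "AE x in lborel. f x = 0"
      proof eventually_elim
        case (elim x)
        have "h x \<noteq> h r" using strict_mono_eq[OF h] elim(2) by simp
        then show ?case using elim(1) by simp
      qed
      with Suc.prems(3) show False by simp
    qed
    from Suc.IH[OF exp_integrable_diff_mult(1)[OF Suc.prems(1) hm] r this]
    have IH: "finite {m. laplace h ?f m = 0}" "card {m. laplace h ?f m = 0} \<le> N" by auto
    define g where "g m = exp (- (m * h r)) * laplace h f m" for m
    define g' where "g' m = exp (- (m * h r)) * laplace h ?f m" for m
    have "(g has_real_derivative g' m) (at m)" for m
      unfolding g_def[abs_def] g'_def exp_integrable_diff_mult(2)[OF Suc.prems(1) hm]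
      using laplace_derivative[OF Suc.prems(1) hm, of m]
      by (auto intro!: derivative_eq_intros simp: algebra_simps)
    from rolle_card[OF this, of N] IH
    have "finite {m. g m = 0} \<and> card {m. g m = 0} \<le> Suc N" by (simp add: g'_def)
    then show ?thesis by (simp add: g_def)
  qed
qed

section \<open>Invariant measures\<close>

lemma integrable_exp_neg_abs: "integrable lborel (\<lambda>x::real. exp (- \<bar>x\<bar>))"
proof (rule integrableI_bounded)
  \<comment> \<open>The negative half line is reduced to this one by reflection, written
    \<open>0 + -1 * x\<close> to match the affine substitution rule.\<close>
  have half: "(\<integral>\<^sup>+x. ennreal (exp (- x)) * indicator {0..} x \<partial>lborel) = (1 :: ennreal)"
    using nn_intergal_power_times_exp_Ici[of 0] by simp
  have "(\<integral>\<^sup>+x. ennreal (norm (exp (- \<bar>x::real\<bar>))) \<partial>lborel)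
    \<le> (\<integral>\<^sup>+x. ennreal (exp (- x)) * indicator {0..} x + ennreal (exp (- (0 + -1 * x))) * indicator {0..} (0 + -1 * x) \<partial>(lborel :: real measure))"
    by (intro nn_integral_mono) (auto simp: indicator_def abs_if)
  also have "\<dots> = (\<integral>\<^sup>+x. ennreal (exp (- x)) * indicator {0..} x \<partial>(lborel :: real measure))
      + (\<integral>\<^sup>+x. ennreal (exp (- (0 + -1 * x))) * indicator {0..} (0 + -1 * x) \<partial>(lborel :: real measure))"
    by (intro nn_integral_add) measurable
  also have "(\<integral>\<^sup>+x. ennreal (exp (- (0 + -1 * x))) * indicator {0..} (0 + -1 * x) \<partial>(lborel :: real measure)) = 1"
    using nn_integral_real_affine[of "\<lambda>x. ennreal (exp (- x)) * indicator {0..} x" "-1" 0] half by simp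
  finally show "(\<integral>\<^sup>+x. ennreal (norm (exp (- \<bar>x::real\<bar>))) \<partial>lborel) < \<infinity>"
    unfolding half by (simp add: order_le_less_trans[OF _ ennreal_less_top[of 2]] ennreal_plus[symmetric] del: ennreal_plus)
qed measurable

lemma integral_derivative_zero:
  fixes F f :: "real \<Rightarrow> real"
  assumes F: "\<And>x. (F has_real_derivative f x) (at x)" and f: "continuous_on UNIV f" "integrable lborel f"
    and lim: "(\<lambda>n. F (real n)) \<longlonglongrightarrow> 0" "(\<lambda>n. F (- real n)) \<longlonglongrightarrow> 0"
  shows "(\<integral>x. f x \<partial>lborel) = 0"
proof -
  have fm[measurable]: "f \<in> borel_measurable borel" using f(2) by auto
  have "(\<lambda>n. \<integral>x. f x * indicator {- real n..real n} x \<partial>lborel) \<longlonglongrightarrow> (\<integral>x. f x \<partial>lborel)"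
  proof (rule integral_dominated_convergence[where w="\<lambda>x. \<bar>f x\<bar>"])
    show "AE x in lborel. (\<lambda>n. f x * indicator {- real n..real n} x) \<longlonglongrightarrow> f x"
    proof (rule AE_I2)
      fix x
      obtain n0 where n0: "\<bar>x\<bar> < real n0" using reals_Archimedean2 by blast
      have "\<forall>\<^sub>F n in sequentially. f x * indicator {- real n..real n} x = f x"
        using eventually_ge_at_top[of n0]
      proof eventually_elim
        case (elim n)
        then have "\<bar>x\<bar> \<le> real n" using n0 by simp
        then show ?case by (auto simp: indicator_def)
      qed
      then show "(\<lambda>n. f x * indicator {- real n..real n} x) \<longlonglongrightarrow> f x" by (rule tendsto_eventually)
    qed
    show "AE x in lborel. norm (f x * indicator {- real n..real n} x) \<le> \<bar>f x\<bar>" for n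
      by (intro AE_I2) (auto simp: indicator_def)
  qed (use f(2) in auto)
  moreover have "(\<integral>x. f x * indicator {- real n..real n} x \<partial>lborel) = F (real n) - F (- real n)" for n
    using f(1) by (intro integral_FTC_Icc_real F) (auto simp: continuous_on_eq_continuous_at)
  moreover have "(\<lambda>n. F (real n) - F (- real n)) \<longlonglongrightarrow> 0 - 0" by (intro tendsto_diff lim)
  ultimately show ?thesis using LIMSEQ_unique by fastforce
qed

text \<open>With rate 2, the product of \<open>exp (Q x)\<close> and a function growing like
  \<open>exp \<bar>x\<bar>\<close> still decays like \<open>exp (- \<bar>x\<bar>)\<close>.
  Monotonicity of \<open>Q x + 2 x\<close> and \<open>Q x - 2 x\<close> handles the two ends,
  compactness the middle.\<close>

lemma linear_decay:
  fixes Q q :: "real \<Rightarrow> real"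
  assumes Q: "\<And>x. (Q has_real_derivative q x) (at x)"
    and q: "\<And>x. R \<le> x \<Longrightarrow> q x \<le> - 2" "\<And>x. x \<le> - R \<Longrightarrow> 2 \<le> q x" and R: "0 \<le> R"
  shows "\<exists>K. \<forall>x. Q x \<le> K - 2 * \<bar>x\<bar>"
proof -
  have Qc: "continuous_on UNIV Q" by (intro continuous_at_imp_continuous_on ballI DERIV_isCont[OF Q])
  have "bounded (Q ` {-R..R})"
    by (intro compact_imp_bounded compact_continuous_image continuous_on_subset[OF Qc]) auto
  then obtain K0 where K0: "\<And>x. x \<in> {-R..R} \<Longrightarrow> \<bar>Q x\<bar> \<le> K0" unfolding bounded_iff by (auto simp del: atLeastAtMost_iff)
  have right: "Q x + 2 * x \<le> Q R + 2 * R" if "R \<le> x" for x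
  proof (rule DERIV_nonpos_imp_nonincreasing[OF that])
    fix y assume "R \<le> y" "y \<le> x"
    moreover have "((\<lambda>x. Q x + 2 * x) has_real_derivative q y + 2) (at y)" by (auto intro!: derivative_eq_intros Q)
    ultimately show "\<exists>z. ((\<lambda>x. Q x + 2 * x) has_real_derivative z) (at y) \<and> z \<le> 0" using q(1)[of y] by force
  qed
  have left: "Q x - 2 * x \<le> Q (- R) - 2 * (- R)" if "x \<le> - R" for x
  proof (rule DERIV_nonneg_imp_nondecreasing[OF that])
    fix y assume "x \<le> y" "y \<le> - R"
    moreover have "((\<lambda>x. Q x - 2 * x) has_real_derivative q y - 2) (at y)" by (auto intro!: derivative_eq_intros Q)
    ultimately show "\<exists>z. ((\<lambda>x. Q x - 2 * x) has_real_derivative z) (at y) \<and> 0 \<le> z" using q(2)[of y] by force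
  qed
  have "Q x \<le> (K0 + 2 * R) - 2 * \<bar>x\<bar>" for x
  proof -
    consider "R \<le> x" | "x \<le> - R" | "x \<in> {-R..R}" by force
    then show ?thesis
    proof cases
      case 1
      then show ?thesis using right[of x] K0[of R] R by simp
    next
      case 2
      then show ?thesis using left[of x] K0[of "- R"] R by simp
    next
      case 3
      then show ?thesis using K0[of x] by (simp add: abs_le_iff) linarith
    qed
  qed
  then show ?thesis by blast
qed

text \<open>The exponent \<open>\<kappa> ln x - x\<close> is largest at \<open>x = \<kappa>\<close>,
  which gives the constant; the tangent bound \<open>ln y \<le> y - 1\<close> at
  \<open>y = x / \<kappa>\<close> proves it.\<close>

lemma powr_le_exp:
  fixes x \<kappa> :: real
  assumes "0 < \<kappa>" "0 \<le> x"
  shows "x powr \<kappa> \<le> exp (\<kappa> * ln \<kappa> - \<kappa>) * exp x"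
proof (cases "x = 0")
  case False
  then have x: "x > 0" using assms(2) by simp
  have "ln (x / \<kappa>) \<le> x / \<kappa> - 1" using x assms(1) by (intro ln_le_minus_one) simp
  then have "\<kappa> * ln x \<le> \<kappa> * (ln \<kappa> + (x / \<kappa> - 1))"
    using x assms(1) by (intro mult_left_mono) (auto simp: ln_div)
  also have "\<dots> = (\<kappa> * ln \<kappa> - \<kappa>) + x" using assms(1) by (simp add: field_simps)
  finally show ?thesis using x by (simp add: powr_def exp_add[symmetric])
qed simp

lemma integrable_of_exp_decay:
  fixes g Q :: "real \<Rightarrow> real"
  assumes [measurable]: "g \<in> borel_measurable borel" and Q: "continuous_on UNIV Q" "\<And>x. Q x \<le> K - 2 * \<bar>x\<bar>"
    and g: "\<And>x. \<bar>g x\<bar> \<le> C * exp \<bar>x\<bar>"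
  shows "integrable lborel (\<lambda>x. g x * exp (Q x))"
proof (rule Bochner_Integration.integrable_bound)
  have [measurable]: "Q \<in> borel_measurable borel" by (rule borel_measurable_continuous_onI[OF Q(1)])
  have C: "0 \<le> C" using g[of 0] by simp
  show "integrable lborel (\<lambda>x. (C * exp K) * exp (- \<bar>x::real\<bar>))"
    by (intro integrable_mult_right integrable_exp_neg_abs)
  show "AE x in lborel. norm (g x * exp (Q x)) \<le> norm ((C * exp K) * exp (- \<bar>x\<bar>))"
  proof (rule AE_I2)
    fix x
    have "\<bar>g x\<bar> * exp (Q x) \<le> (C * exp \<bar>x\<bar>) * exp (K - 2 * \<bar>x\<bar>)"
      using g[of x] Q(2)[of x] C by (intro mult_mono) auto
    also have "\<dots> = (C * exp K) * exp (- \<bar>x\<bar>)"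
      by (simp add: mult.assoc exp_add[symmetric])
    finally show "norm (g x * exp (Q x)) \<le> norm ((C * exp K) * exp (- \<bar>x\<bar>))" using C by (simp add: abs_mult)
  qed
  show "(\<lambda>x. g x * exp (Q x)) \<in> borel_measurable lborel" by measurable
qed

lemma continuous_AE_zero:
  fixes f :: "real \<Rightarrow> real"
  assumes f: "continuous_on UNIV f" and ae: "AE x in lborel. f x = 0"
  shows "f x = 0"
proof (rule ccontr)
  assume x: "f x \<noteq> 0"
  have "open {y. f y \<noteq> 0}"
    using continuous_on_open_vimage[of UNIV f] f by (simp add: open_Collect_neq)
  then obtain d where d: "d > 0" "ball x d \<subseteq> {y. f y \<noteq> 0}" using x open_contains_ball by blast
  have sub: "{x - d<..<x + d} \<subseteq> {y. f y \<noteq> 0}" using d(2) by (simp add: ball_eq_greaterThanLessThan)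
  have [measurable]: "f \<in> borel_measurable borel" by (rule borel_measurable_continuous_onI[OF f])
  have "emeasure lborel {y. f y \<noteq> 0} = 0"
    using ae by (subst (asm) AE_iff_measurable[OF _ refl]) auto
  moreover have "emeasure lborel {x - d<..<x + d} \<le> emeasure lborel {y. f y \<noteq> 0}"
    by (rule emeasure_mono[OF sub]) simp
  ultimately show False using d(1) by simp
qed

lemma zero_crossing_number_enat:
  assumes "zero_crossing_number f = enat N"
  shows "\<not> has_crossings f (Suc N)" "0 < N \<Longrightarrow> \<exists>x. f x \<noteq> 0"
proof -
  show "\<not> has_crossings f (Suc N)"
  proof
    assume "has_crossings f (Suc N)"
    then have "enat (Suc N) \<le> zero_crossing_number f" unfolding zero_crossing_number_def by (intro SUP_upper) simp
    then show False using assms by simp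
  qed
  show "\<exists>x. f x \<noteq> 0" if "0 < N"
  proof (rule ccontr)
    assume "\<not> ?thesis"
    then have "n = 0" if "has_crossings f n" for n
      using that unfolding has_crossings_def by (cases n) auto
    then have "zero_crossing_number f \<le> 0" unfolding zero_crossing_number_def by (intro SUP_least) (auto simp: zero_enat_def)
    then show False using assms that by (simp add: zero_enat_def)
  qed
qed

text \<open>Transfers the crossing number of \<open>V'\<close> to \<open>V'\<close> times the
  positive weight \<open>exp Q0 / \<sigma>\<^sup>2\<close>, whose transform is studied.\<close>

lemma has_crossings_mult_pos:
  assumes "\<And>x. 0 < g x"
  shows "has_crossings (\<lambda>x. f x * g x) N \<longleftrightarrow> has_crossings f N"
proof -
  have "f x * g x * (f y * g y) < 0 \<longleftrightarrow> f x * f y < 0" for x y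
  proof -
    have 1: "f x * g x * (f y * g y) = (f x * f y) * (g x * g y)" by simp
    have "0 < g x * g y" using assms by simp
    then have 2: "a * (g x * g y) < 0 \<longleftrightarrow> a < 0" for a by (metis mult_less_0_iff less_asym)
    show ?thesis unfolding 1 2 ..
  qed
  then show ?thesis unfolding has_crossings_def by simp
qed

context brownian_motion
begin

text \<open>A stationary solution has constant mean, so the mean-field term becomes the linear drift
  \<open>- \<theta> (x - m)\<close> and the generator identity applies. Through the test functions
  it says that \<open>\<nu>\<close>, weighted by \<open>exp (- Q) \<sigma>\<^sup>2 / 2\<close>,
  kills functions of zero integral.\<close>

lemma invariant_measure_density:
  assumes V: "\<And>x. (deriv V has_real_derivative v' x) (at x)" "continuous_on UNIV v'"
    and \<sigma>: "C-lipschitz_on UNIV \<sigma>" "0 < \<sigma>l" "\<And>x. \<sigma>l\<^sup>2 \<le> (\<sigma> x)\<^sup>2" "\<And>x. \<bar>\<sigma> x\<bar> \<le> \<sigma>u"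
    and inv: "invariant_measure M F B V \<theta> \<sigma> \<nu>"
    and Q: "\<And>x. (Q has_real_derivative 2 * (- deriv V x - \<theta> * (x - (\<integral>y. y \<partial>\<nu>))) / (\<sigma> x)\<^sup>2) (at x)"
  shows "\<exists>c>0. \<nu> = density lborel (\<lambda>x. ennreal (c * (exp (Q x) / (\<sigma> x)\<^sup>2)))"
proof -
  define m where "m = (\<integral>y. y \<partial>\<nu>)"
  define b where "b x = - deriv V x - \<theta> * (x - m)" for x
  have vc: "continuous_on UNIV (deriv V)" by (intro continuous_at_imp_continuous_on ballI DERIV_isCont[OF V(1)])
  have \<sigma>c: "continuous_on UNIV \<sigma>" by (rule lipschitz_on_continuous_on[OF \<sigma>(1)])
  have Qc: "continuous_on UNIV Q" by (intro continuous_at_imp_continuous_on ballI DERIV_isCont[OF Q])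
  have b: "(b has_real_derivative - v' x - \<theta>) (at x)" for x
    unfolding b_def[abs_def] using V(1)[of x] by (auto intro!: derivative_eq_intros)
  have b'c: "continuous_on UNIV (\<lambda>x. - v' x - \<theta>)" by (intro continuous_intros V(2))
  have bc: "continuous_on UNIV b" by (intro continuous_at_imp_continuous_on ballI DERIV_isCont[OF b])
  have \<sigma>_nz: "\<sigma> x \<noteq> 0" for x using \<sigma>(2) \<sigma>(3)[of x] by (auto simp: power2_eq_square mult_le_0_iff)

  have \<nu>: "prob_space \<nu>" "sets \<nu> = sets borel" using inv unfolding invariant_measure_def P2_def by auto
  \<comment> \<open>This must be the solution selected inside \<open>P_star\<close>, because
    invariance is a statement about its laws.\<close>
  define X where "X = (SOME X. mv_solution_from M F B V \<theta> \<sigma> \<nu> X)"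
  have "mv_solution_from M F B V \<theta> \<sigma> \<nu> X"
    unfolding X_def using inv unfolding invariant_measure_def by (intro someI_ex[of "mv_solution_from M F B V \<theta> \<sigma> \<nu>"]) blast
  then obtain \<xi> where sol: "mv_solution M F B V \<theta> \<sigma> \<xi> X" unfolding mv_solution_from_def by blast
  have law: "distr M borel (X t) = \<nu>" if "0 \<le> t" for t
    using inv that unfolding invariant_measure_def P_star_def X_def by blast
  have X: "X t \<in> borel_measurable (F t)" if "0 \<le> t" for t using sol that unfolding mv_solution_def by blast
  have cont: "AE \<omega> in M. continuous_on {0..} (\<lambda>t. X t \<omega>)" using sol unfolding mv_solution_def by blast
  have EX: "expectation (X t) = m" if "0 \<le> t" for t
    using integral_distr[OF F_measurable_imp[OF that X[OF that]], of "\<lambda>x. x"] law[OF that] by (simp add: m_def)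
  have eqn: "\<exists>I. has_ito_integral M F B t (\<lambda>s \<omega>. \<sigma> (X s \<omega>)) I \<and>
      (AE \<omega> in M. X t \<omega> = \<xi> \<omega> + (LINT s:{0..t}|lborel. b (X s \<omega>)) + I \<omega>)" if t: "0 \<le> t" for t
  proof -
    obtain I where I: "has_ito_integral M F B t (\<lambda>s \<omega>. \<sigma> (X s \<omega>)) I"
      and ae: "AE \<omega> in M. X t \<omega> = \<xi> \<omega> - (LINT s:{0..t}|lborel. deriv V (X s \<omega>))
            - \<theta> * (LINT s:{0..t}|lborel. X s \<omega> - (\<integral>\<omega>'. X s \<omega>' \<partial>M)) + I \<omega>"
      using sol t unfolding mv_solution_def by blast
    have "AE \<omega> in M. X t \<omega> = \<xi> \<omega> + (LINT s:{0..t}|lborel. b (X s \<omega>)) + I \<omega>"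
      using ae cont
    proof eventually_elim
      case (elim \<omega>)
      have Xc: "continuous_on {0..t} (\<lambda>s. X s \<omega>)" by (rule continuous_on_subset[OF elim(2)]) auto
      have i1: "set_integrable lborel {0..t} (\<lambda>s. deriv V (X s \<omega>))"
        by (intro borel_integrable_atLeastAtMost' continuous_on_compose2[OF vc Xc]) auto
      have i2: "set_integrable lborel {0..t} (\<lambda>s. X s \<omega> - m)"
        by (intro borel_integrable_atLeastAtMost' continuous_intros Xc)
      \<comment> \<open>The mean equals \<open>m\<close> at the times in \<open>{0..t}\<close>; at
        negative times nothing is known about \<open>X\<close>.\<close>
      have e: "(LINT s:{0..t}|lborel. X s \<omega> - (\<integral>\<omega>'. X s \<omega>' \<partial>M)) = (LINT s:{0..t}|lborel. X s \<omega> - m)"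
        by (rule set_lebesgue_integral_cong) (auto simp: EX)
      have "(LINT s:{0..t}|lborel. b (X s \<omega>)) = (LINT s:{0..t}|lborel. (- 1) * deriv V (X s \<omega>) - \<theta> * (X s \<omega> - m))"
        by (simp add: b_def)
      also have "\<dots> = (LINT s:{0..t}|lborel. (- 1) * deriv V (X s \<omega>)) - (LINT s:{0..t}|lborel. \<theta> * (X s \<omega> - m))"
        by (intro set_integral_diff(2) set_integrable_mult_right i1 i2)
      also have "\<dots> = - (LINT s:{0..t}|lborel. deriv V (X s \<omega>)) - \<theta> * (LINT s:{0..t}|lborel. X s \<omega> - m)"
        by (simp only: set_integral_mult_right)
      finally show ?case using elim(1) unfolding e by simp
    qed
    with I show ?thesis by blast
  qed

  define w where "w x = exp (- Q x) * (\<sigma> x)\<^sup>2 / 2" for x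
  have wc: "continuous_on UNIV w" unfolding w_def[abs_def] by (intro continuous_intros Qc \<sigma>c) auto
  have wpos: "0 < w x" for x unfolding w_def using \<sigma>_nz[of x] by simp
  have test: "(\<integral>x. w x * k x \<partial>\<nu>) = 0"
    if k: "L-lipschitz_on UNIV k" "0 \<le> R" "\<And>x. R \<le> \<bar>x\<bar> \<Longrightarrow> k x = 0" "(\<integral>x. k x \<partial>lborel) = 0" for k L R
  proof -
    obtain f f' f'' K where f: "\<And>x. (f has_real_derivative f' x) (at x)" "\<And>x. (f' has_real_derivative f'' x) (at x)"
      "\<And>x y. \<bar>f'' x - f'' y\<bar> \<le> K * \<bar>x - y\<bar>" "\<And>x. \<bar>f x\<bar> \<le> K" "\<And>x. \<bar>f' x\<bar> \<le> K" "\<And>x. \<bar>f'' x\<bar> \<le> K"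
      "\<And>x. \<bar>f' x * b x\<bar> \<le> K" and eq: "\<And>x. f' x * b x + f'' x / 2 * (\<sigma> x)\<^sup>2 = w x * k x"
      using test_function_exists[OF \<sigma>(1-3) b b'c Q[folded m_def, folded b_def] k] unfolding w_def by blast
    have "(\<integral>x. f' x * b x + f'' x / 2 * (\<sigma> x)\<^sup>2 \<partial>\<nu>) = 0"
      by (rule generator_identity[OF X cont law bc \<sigma>c \<sigma>(4) eqn f])
    then show ?thesis unfolding eq .
  qed
  have "\<exists>c>0. \<nu> = density lborel (\<lambda>x. ennreal (c / w x))"
    by (rule density_of_test_integrals[OF \<nu> wc wpos]) (rule test)
  then obtain c where c: "c > 0" "\<nu> = density lborel (\<lambda>x. ennreal (c / w x))" by blast
  have "c / w x = (2 * c) * (exp (Q x) / (\<sigma> x)\<^sup>2)" for x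
    unfolding w_def by (simp add: exp_minus field_simps)
  then show ?thesis using c by (intro exI[of _ "2 * c"]) simp
qed

end

theorem proposition4p3:
  fixes V \<sigma> :: "real \<Rightarrow> real" and \<theta> :: real and n :: nat
    and M :: "'a measure" and F :: "real \<Rightarrow> 'a measure" and B :: "real \<Rightarrow> 'a \<Rightarrow> real"
  assumes BM: "brownian_motion M F B"
    and V_C2: "\<And>x. V differentiable at x" "\<And>x. deriv V differentiable at x"
      "continuous_on UNIV (deriv (deriv V))"
    and theta: "\<theta> > 0"
    and a: "\<exists>L>0. \<forall>x y. - (x - y) * (deriv V x - deriv V y) \<le> L * \<bar>x - y\<bar>\<^sup>2"
    and b: "\<exists>L>0. \<exists>\<kappa>\<ge>1. \<forall>x. \<bar>deriv V x\<bar> \<le> L * (1 + \<bar>x\<bar> powr \<kappa>)"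
    and c: "\<exists>\<alpha>>0. \<exists>\<beta>>0. \<exists>\<delta>>0. \<forall>x y.
      - (x - y) * (deriv V x - deriv V y) \<le> - \<alpha> * \<bar>x - y\<bar> powr (2 + \<delta>) + \<beta>"
    and d: "\<exists>C. C-lipschitz_on UNIV \<sigma>"
      "\<exists>\<sigma>l \<sigma>u. 0 < \<sigma>l \<and> \<sigma>l < \<sigma>u \<and> (\<forall>x. \<sigma>l\<^sup>2 \<le> (\<sigma> x)\<^sup>2 \<and> (\<sigma> x)\<^sup>2 \<le> \<sigma>u\<^sup>2)"
    and n: "n \<ge> 1"
    and Z: "zero_crossing_number (deriv V) = enat (2 * n - 1)"
  shows "finite {\<nu>. invariant_measure M F B V \<theta> \<sigma> \<nu>} \<and>
    card {\<nu>. invariant_measure M F B V \<theta> \<sigma> \<nu>} \<le> 2 * n - 1"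
proof -
  interpret brownian_motion M F B by (rule BM)
  define v where "v = deriv V"
  have v: "(v has_real_derivative deriv v x) (at x)" for x
    using V_C2(2)[of x] unfolding v_def by (simp add: DERIV_deriv_iff_real_differentiable)
  have vc: "continuous_on UNIV v" by (intro continuous_at_imp_continuous_on ballI DERIV_isCont[OF v])
  obtain C where \<sigma>lip: "C-lipschitz_on UNIV \<sigma>" using d(1) by blast
  obtain \<sigma>l \<sigma>u where \<sigma>l: "0 < \<sigma>l" "\<sigma>l < \<sigma>u" "\<And>x. \<sigma>l\<^sup>2 \<le> (\<sigma> x)\<^sup>2" "\<And>x. (\<sigma> x)\<^sup>2 \<le> \<sigma>u\<^sup>2"
    using d(2) by blast
  have \<sigma>c: "continuous_on UNIV \<sigma>" by (rule lipschitz_on_continuous_on[OF \<sigma>lip])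
  have \<sigma>sq: "0 < (\<sigma> x)\<^sup>2" for x using \<sigma>l(1) \<sigma>l(3)[of x] by (meson less_le_trans zero_less_power)
  then have \<sigma>nz: "\<sigma> x \<noteq> 0" for x by (metis power_zero_numeral less_irrefl)
  have \<sigma>b: "\<bar>\<sigma> x\<bar> \<le> \<sigma>u" for x using \<sigma>l(1,2) \<sigma>l(4)[of x] by (simp add: abs_le_square_iff[symmetric])

  have "continuous_on UNIV (\<lambda>x. 1 / (\<sigma> x)\<^sup>2)" using \<sigma>nz by (intro continuous_intros \<sigma>c) auto
  from antiderivative_real[OF this] obtain h where h: "\<And>x. (h has_real_derivative 1 / (\<sigma> x)\<^sup>2) (at x)" by blast
  have "continuous_on UNIV (\<lambda>x. - 2 * (v x + \<theta> * x) / (\<sigma> x)\<^sup>2)" using \<sigma>nz by (intro continuous_intros \<sigma>c vc) auto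
  from antiderivative_real[OF this] obtain Q0 where Q0: "\<And>x. (Q0 has_real_derivative - 2 * (v x + \<theta> * x) / (\<sigma> x)\<^sup>2) (at x)" by blast
  \<comment> \<open>The rule of signs needs an increasing exponent; here its slope is
    \<open>1 / \<sigma>\<^sup>2 > 0\<close>.\<close>
  have h_mono: "strict_mono h"
    by (rule strict_monoI, rule DERIV_pos_imp_increasing) (use h \<sigma>sq in \<open>auto intro!: exI[of _ "1 / (\<sigma> _)\<^sup>2"]\<close>)
  have hc: "continuous_on UNIV h" by (intro continuous_at_imp_continuous_on ballI DERIV_isCont[OF h])
  have hm: "h \<in> borel_measurable borel" by (rule borel_measurable_continuous_onI[OF hc])
  note [measurable] = borel_measurable_continuous_onI[OF vc] borel_measurable_continuous_onI[OF \<sigma>c]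

  \<comment> \<open>The parameter stands for \<open>2 \<theta> m\<close>, but all real values are
    treated, since the zeros of the transform are counted over the whole line.\<close>
  define Q where "Q \<mu> x = Q0 x + \<mu> * h x" for \<mu> x
  have Q: "(Q \<mu> has_real_derivative (- 2 * (v x + \<theta> * x) + \<mu>) / (\<sigma> x)\<^sup>2) (at x)" for \<mu> x
    unfolding Q_def[abs_def] using Q0[of x] h[of x] by (auto intro!: derivative_eq_intros simp: add_divide_distrib)
  have Qc: "continuous_on UNIV (Q \<mu>)" for \<mu> by (intro continuous_at_imp_continuous_on ballI DERIV_isCont[OF Q])

  \<comment> \<open>Linear decay of the exponent\<close>
  obtain \<alpha> \<beta> \<delta> where \<alpha>: "\<alpha> > 0" "\<beta> > 0"
    "\<And>x y. - (x - y) * (v x - v y) \<le> - \<alpha> * \<bar>x - y\<bar> powr (2 + \<delta>) + \<beta>"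
    using c unfolding v_def by blast
  have diss: "- x * (v x - v 0) \<le> \<beta>" for x
  proof -
    have "0 \<le> \<alpha> * \<bar>x\<bar> powr (2 + \<delta>)" using \<alpha>(1) by simp
    then show ?thesis using \<alpha>(3)[of x 0] by simp
  qed
  have decay: "\<exists>K. \<forall>x. Q \<mu> x \<le> K - 2 * \<bar>x\<bar>" for \<mu>
  proof -
    \<comment> \<open>Beyond \<open>R\<close> the term \<open>\<theta> x\<close> outweighs
      \<open>\<mu>\<close>, the one-sided bound on \<open>v\<close> and
      \<open>\<sigma>u\<^sup>2\<close>, so the slope of \<open>Q \<mu>\<close> is at most
      \<open>- 2\<close> on the right and at least \<open>2\<close> on the left. The value 1 allows
      \<open>diss\<close> to be divided by \<open>\<bar>x\<bar>\<close>.\<close>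
    define R where "R = max 1 ((\<bar>\<mu>\<bar> / 2 + \<sigma>u\<^sup>2 + \<beta> + \<bar>v 0\<bar>) / \<theta>)"
    have R: "1 \<le> R" by (simp add: R_def)
    have Rx: "\<bar>\<mu>\<bar> / 2 + \<sigma>u\<^sup>2 + \<beta> + \<bar>v 0\<bar> \<le> \<theta> * x" if "R \<le> x" for x
    proof -
      have "(\<bar>\<mu>\<bar> / 2 + \<sigma>u\<^sup>2 + \<beta> + \<bar>v 0\<bar>) / \<theta> \<le> x" using that by (simp add: R_def)
      then show ?thesis using theta by (simp add: field_simps)
    qed
    show ?thesis
    proof (rule linear_decay[OF Q])
      show "0 \<le> R" using R by simp
      fix x
      have vge: "- \<beta> \<le> v x - v 0" if "1 \<le> x"
      proof (rule ccontr)
        assume "\<not> ?thesis"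
        then have "\<beta> < - (v x - v 0)" by simp
        then have "\<beta> * 1 < - (v x - v 0) * x" using \<alpha>(2) that by (intro mult_less_le_imp_less) auto
        then show False using diss[of x] by (simp add: algebra_simps)
      qed
      have vle: "v x - v 0 \<le> \<beta>" if "x \<le> - 1"
      proof (rule ccontr)
        assume "\<not> ?thesis"
        then have "\<beta> < v x - v 0" by simp
        then have "\<beta> * 1 < (v x - v 0) * (- x)" using \<alpha>(2) that by (intro mult_less_le_imp_less) auto
        then show False using diss[of x] by (simp add: algebra_simps)
      qed
      show "(- 2 * (v x + \<theta> * x) + \<mu>) / (\<sigma> x)\<^sup>2 \<le> - 2" if "R \<le> x"
      proof -
        have "- 2 * (v x + \<theta> * x) + \<mu> \<le> - 2 * \<sigma>u\<^sup>2"
          using Rx[OF that] vge R that abs_ge_self[of \<mu>] abs_ge_minus_self[of "v 0"] by (simp add: algebra_simps)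
        also have "\<dots> \<le> - 2 * (\<sigma> x)\<^sup>2" using \<sigma>l(4) by simp
        finally show ?thesis using \<sigma>sq[of x] by (simp add: pos_divide_le_eq)
      qed
      show "2 \<le> (- 2 * (v x + \<theta> * x) + \<mu>) / (\<sigma> x)\<^sup>2" if "x \<le> - R"
      proof -
        have "2 * (\<sigma> x)\<^sup>2 \<le> 2 * \<sigma>u\<^sup>2" using \<sigma>l(4) by simp
        also have "\<dots> \<le> - 2 * (v x + \<theta> * x) + \<mu>"
          using Rx[of "- x"] vle R that abs_ge_minus_self[of \<mu>] abs_ge_self[of "v 0"] by (simp add: algebra_simps)
        finally show ?thesis using \<sigma>sq[of x] by (simp add: pos_le_divide_eq)
      qed
    qed
  qed

  \<comment> \<open>Growth of the drift and integrability against the weights\<close>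
  obtain L \<kappa> where L: "L > 0" "\<kappa> \<ge> 1" "\<And>x. \<bar>v x\<bar> \<le> L * (1 + \<bar>x\<bar> powr \<kappa>)" using b unfolding v_def by blast
  define A where "A = L * (1 + exp (\<kappa> * ln \<kappa> - \<kappa>))"
  have vexp: "\<bar>v x\<bar> \<le> A * exp \<bar>x\<bar>" for x
  proof -
    have "1 + \<bar>x\<bar> powr \<kappa> \<le> exp \<bar>x\<bar> + exp (\<kappa> * ln \<kappa> - \<kappa>) * exp \<bar>x\<bar>"
      using powr_le_exp[of \<kappa> "\<bar>x\<bar>"] L(2) by (intro add_mono) auto
    then have "L * (1 + \<bar>x\<bar> powr \<kappa>) \<le> L * (exp \<bar>x\<bar> + exp (\<kappa> * ln \<kappa> - \<kappa>) * exp \<bar>x\<bar>)"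
      using L(1) by (intro mult_left_mono) auto
    then show ?thesis using L(3)[of x] by (simp add: A_def algebra_simps)
  qed
  have int: "integrable lborel (\<lambda>x. g x / (\<sigma> x)\<^sup>2 * exp (Q \<mu> x))"
    if [measurable]: "g \<in> borel_measurable borel" and g: "\<And>x. \<bar>g x\<bar> \<le> K * exp \<bar>x\<bar>" for g K \<mu>
  proof -
    obtain K' where K': "\<And>x. Q \<mu> x \<le> K' - 2 * \<bar>x\<bar>" using decay by blast
    show ?thesis
    proof (rule integrable_of_exp_decay[OF _ Qc K'])
      show "(\<lambda>x. g x / (\<sigma> x)\<^sup>2) \<in> borel_measurable borel" by measurable
      fix x
      have "\<bar>g x\<bar> / (\<sigma> x)\<^sup>2 \<le> (K * exp \<bar>x\<bar>) / \<sigma>l\<^sup>2"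
        using g[of x] \<sigma>l(1,3) abs_ge_zero[of "g x"] by (intro frac_le) (auto intro: order_trans)
      then show "\<bar>g x / (\<sigma> x)\<^sup>2\<bar> \<le> K / \<sigma>l\<^sup>2 * exp \<bar>x\<bar>" by (simp add: abs_divide)
    qed
  qed
  have xexp: "\<bar>x\<bar> \<le> 1 * exp \<bar>x\<bar>" "\<bar>1\<bar> \<le> 1 * exp \<bar>x\<bar>" for x :: real
    using order_trans[OF _ exp_ge_add_one_self[of "\<bar>x\<bar>"]] by auto
  note iv = int[OF borel_measurable_continuous_onI[OF vc] vexp]
  have ix: "integrable lborel (\<lambda>x. x / (\<sigma> x)\<^sup>2 * exp (Q \<mu> x))" for \<mu>
    by (rule int[OF _ xexp(1)]) simp
  have i1: "integrable lborel (\<lambda>x. 1 / (\<sigma> x)\<^sup>2 * exp (Q \<mu> x))" for \<mu>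
    by (rule int[OF _ xexp(2)]) simp

  \<comment> \<open>The transform and the number of its zeros\<close>
  define f where "f x = v x * (exp (Q0 x) / (\<sigma> x)\<^sup>2)" for x
  have f_eq: "f x * exp (\<mu> * h x) = v x / (\<sigma> x)\<^sup>2 * exp (Q \<mu> x)" for x \<mu>
    by (simp add: f_def Q_def exp_add)
  have fpos: "0 < exp (Q0 x) / (\<sigma> x)\<^sup>2" for x using \<sigma>sq by simp
  have fc: "continuous_on UNIV f"
    unfolding f_def[abs_def] using \<sigma>nz continuous_at_imp_continuous_on[of UNIV Q0] DERIV_isCont[OF Q0]
    by (intro continuous_intros vc \<sigma>c) auto
  have fexp: "exp_integrable h f"
    unfolding exp_integrable_def f_eq using borel_measurable_continuous_onI[OF fc] iv by blast
  have "\<not> has_crossings f (Suc (2 * n - 1))"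
    unfolding f_def[abs_def] has_crossings_mult_pos[OF fpos]
    using zero_crossing_number_enat(1)[OF Z] unfolding v_def .
  moreover have "\<not> (AE x in lborel. f x = 0)"
  proof
    assume ae: "AE x in lborel. f x = 0"
    \<comment> \<open>Since \<open>n \<ge> 1\<close>, the crossing number \<open>2 n - 1\<close> is
      positive, so \<open>V'\<close> is not identically zero; by continuity it cannot vanish almost
      everywhere.\<close>
    obtain x where "v x \<noteq> 0" using zero_crossing_number_enat(2)[OF Z] n unfolding v_def by auto
    moreover have "f x = 0" by (rule continuous_AE_zero[OF fc ae])
    ultimately show False using fpos[of x] unfolding f_def by (metis mult_eq_0_iff less_irrefl)
  qed
  ultimately have zeros: "finite {\<mu>. laplace h f \<mu> = 0}" "card {\<mu>. laplace h f \<mu> = 0} \<le> 2 * n - 1"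
    using laplace_zeros_le_crossings[OF h_mono hm fexp] by blast+

  \<comment> \<open>Densities of invariant measures and their normalisation\<close>
  define mean where "mean \<nu> = (\<integral>y. y \<partial>\<nu>)" for \<nu> :: "real measure"
  define p where "p \<mu> x = exp (Q \<mu> x) / (\<sigma> x)\<^sup>2" for \<mu> x
  have p_pos: "0 < p \<mu> x" for \<mu> x unfolding p_def using \<sigma>sq by simp
  have p_meas[measurable]: "p \<mu> \<in> borel_measurable borel" for \<mu>
    unfolding p_def[abs_def] using borel_measurable_continuous_onI[OF Qc[of \<mu>]] by measurable
  have dens: "\<exists>c>0. \<nu> = density lborel (\<lambda>x. ennreal (c * p (2 * \<theta> * mean \<nu>) x))"
    if "invariant_measure M F B V \<theta> \<sigma> \<nu>" for \<nu>
    unfolding p_def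
  proof (rule invariant_measure_density[OF _ _ \<sigma>lip \<sigma>l(1,3) \<sigma>b that])
    show "(deriv V has_real_derivative deriv v x) (at x)" for x using v unfolding v_def .
    show "continuous_on UNIV (deriv v)" using V_C2(3) unfolding v_def .
    show "(Q (2 * \<theta> * mean \<nu>) has_real_derivative 2 * (- deriv V x - \<theta> * (x - (\<integral>y. y \<partial>\<nu>))) / (\<sigma> x)\<^sup>2) (at x)" for x
      using Q[of "2 * \<theta> * mean \<nu>" x] unfolding v_def mean_def by (simp add: algebra_simps)
  qed
  have ps: "prob_space \<nu>" if "invariant_measure M F B V \<theta> \<sigma> \<nu>" for \<nu>
    using that unfolding invariant_measure_def P2_def by blast

  \<comment> \<open>The integrand is the derivative of \<open>exp (Q \<mu>)\<close>, which tends to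
    zero at both ends. The identity relates the integrals of \<open>v\<close>, \<open>x\<close> and
    \<open>1\<close> against the unnormalised density.\<close>
  have drift0: "(\<integral>x. (- 2 * (v x + \<theta> * x) + \<mu>) / (\<sigma> x)\<^sup>2 * exp (Q \<mu> x) \<partial>lborel) = 0" for \<mu>
  proof (rule integral_derivative_zero)
    show "((\<lambda>x. exp (Q \<mu> x)) has_real_derivative (- 2 * (v x + \<theta> * x) + \<mu>) / (\<sigma> x)\<^sup>2 * exp (Q \<mu> x)) (at x)" for x
      using Q[of \<mu> x] by (auto intro!: derivative_eq_intros)
    show "continuous_on UNIV (\<lambda>x. (- 2 * (v x + \<theta> * x) + \<mu>) / (\<sigma> x)\<^sup>2 * exp (Q \<mu> x))"
      using \<sigma>nz by (intro continuous_intros vc \<sigma>c Qc) auto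
    have "integrable lborel (\<lambda>x. (- 2) * (v x / (\<sigma> x)\<^sup>2 * exp (Q \<mu> x)) + (- 2 * \<theta>) * (x / (\<sigma> x)\<^sup>2 * exp (Q \<mu> x))
       + \<mu> * (1 / (\<sigma> x)\<^sup>2 * exp (Q \<mu> x)))"
      by (intro Bochner_Integration.integrable_add integrable_mult_right iv ix i1)
    then show "integrable lborel (\<lambda>x. (- 2 * (v x + \<theta> * x) + \<mu>) / (\<sigma> x)\<^sup>2 * exp (Q \<mu> x))"
      by (simp add: algebra_simps add_divide_distrib diff_divide_distrib)
    obtain K where K: "\<And>x. Q \<mu> x \<le> K - 2 * \<bar>x\<bar>" using decay by blast
    have "(\<lambda>k. exp K * exp (- 2) ^ k) \<longlonglongrightarrow> exp K * 0"
      by (intro tendsto_mult tendsto_const LIMSEQ_realpow_zero) auto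
    then have lim: "(\<lambda>k. exp K * exp (- (2 * real k))) \<longlonglongrightarrow> 0"
      by (simp add: exp_of_nat_mult[symmetric] mult.commute)
    have bd: "norm (exp (Q \<mu> x)) \<le> exp K * exp (- (2 * \<bar>x\<bar>))" for x
      using K[of x] by (simp add: exp_add[symmetric])
    show "(\<lambda>k. exp (Q \<mu> (real k))) \<longlonglongrightarrow> 0"
      by (rule Lim_null_comparison[OF _ lim]) (use bd[of "real _"] in auto)
    show "(\<lambda>k. exp (Q \<mu> (- real k))) \<longlonglongrightarrow> 0"
      by (rule Lim_null_comparison[OF _ lim]) (use bd[of "- real _"] in auto)
  qed

  let ?S = "{\<nu>. invariant_measure M F B V \<theta> \<sigma> \<nu>}"
  have zero: "laplace h f (2 * \<theta> * mean \<nu>) = 0" if inv: "invariant_measure M F B V \<theta> \<sigma> \<nu>" for \<nu>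
  proof -
    let ?\<mu> = "2 * \<theta> * mean \<nu>"
    obtain k where k: "k > 0" "\<nu> = density lborel (\<lambda>x. ennreal (k * p ?\<mu> x))" using dens[OF inv] by blast
    interpret \<nu>: prob_space \<nu> by (rule ps[OF inv])
    have int\<nu>: "(\<integral>x. g x \<partial>\<nu>) = k * (\<integral>x. g x / (\<sigma> x)\<^sup>2 * exp (Q ?\<mu> x) \<partial>lborel)"
      if "g \<in> borel_measurable borel" for g :: "real \<Rightarrow> real"
    proof -
      have "(\<integral>x. g x \<partial>\<nu>) = (\<integral>x. (k * p ?\<mu> x) * g x \<partial>lborel)"
        by (subst k(2), subst integral_density) (use that k p_pos in \<open>auto simp: less_imp_le\<close>)
      also have "\<dots> = (\<integral>x. k * (g x / (\<sigma> x)\<^sup>2 * exp (Q ?\<mu> x)) \<partial>lborel)"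
        by (simp add: p_def mult_ac)
      also have "\<dots> = k * (\<integral>x. g x / (\<sigma> x)\<^sup>2 * exp (Q ?\<mu> x) \<partial>lborel)"
        by (rule integral_mult_right_zero)
      finally show ?thesis .
    qed
    \<comment> \<open>The total mass of the unnormalised density, so \<open>k J = 1\<close>. With
      \<open>\<mu> = 2 \<theta> mean \<nu>\<close> the integral of \<open>x\<close> contributes
      \<open>- \<mu> J\<close> to \<open>drift0\<close> and cancels the term \<open>\<mu> J\<close>,
      leaving only the integral of \<open>v\<close>.\<close>
    define J where "J = (\<integral>x. 1 / (\<sigma> x)\<^sup>2 * exp (Q ?\<mu> x) \<partial>lborel)"
    have "k * J = 1" using int\<nu>[of "\<lambda>_. 1"] \<nu>.prob_space by (simp add: J_def)
    moreover have "mean \<nu> = k * (\<integral>x. x / (\<sigma> x)\<^sup>2 * exp (Q ?\<mu> x) \<partial>lborel)"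
      using int\<nu>[of "\<lambda>x. x"] by (simp add: mean_def)
    ultimately have "k * (\<integral>x. x / (\<sigma> x)\<^sup>2 * exp (Q ?\<mu> x) \<partial>lborel) = k * (mean \<nu> * J)"
      by (simp add: mult.left_commute)
    then have mJ: "(\<integral>x. x / (\<sigma> x)\<^sup>2 * exp (Q ?\<mu> x) \<partial>lborel) = mean \<nu> * J" using k(1) by simp
    have "0 = (\<integral>x. (- 2) * (v x / (\<sigma> x)\<^sup>2 * exp (Q ?\<mu> x)) + (- 2 * \<theta>) * (x / (\<sigma> x)\<^sup>2 * exp (Q ?\<mu> x))
       + ?\<mu> * (1 / (\<sigma> x)\<^sup>2 * exp (Q ?\<mu> x)) \<partial>lborel)"
      using drift0[of ?\<mu>] by (simp add: algebra_simps add_divide_distrib diff_divide_distrib)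
    also have "\<dots> = (- 2) * (\<integral>x. v x / (\<sigma> x)\<^sup>2 * exp (Q ?\<mu> x) \<partial>lborel)
       + (- 2 * \<theta>) * (\<integral>x. x / (\<sigma> x)\<^sup>2 * exp (Q ?\<mu> x) \<partial>lborel) + ?\<mu> * J"
    proof -
      note j = integrable_mult_right[OF iv] integrable_mult_right[OF ix] integrable_mult_right[OF i1]
      show ?thesis
        by (subst Bochner_Integration.integral_add, intro Bochner_Integration.integrable_add j, rule j,
          subst Bochner_Integration.integral_add, rule j, rule j) (simp only: integral_mult_right_zero J_def)
    qed
    also have "\<dots> = (- 2) * laplace h f ?\<mu>"
      unfolding mJ laplace_def f_eq by simp
    finally show ?thesis by simp
  qed
  \<comment> \<open>Equal means give the same density up to a factor, which total mass 1 determines.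
    Keeping the mass integral in \<open>ennreal\<close> allows the two factors to be compared
    without a separate finiteness proof.\<close>
  have inj: "inj_on (\<lambda>\<nu>. 2 * \<theta> * mean \<nu>) ?S"
  proof (rule inj_onI)
    fix \<nu>1 \<nu>2 assume inv: "\<nu>1 \<in> ?S" "\<nu>2 \<in> ?S" and eq: "2 * \<theta> * mean \<nu>1 = 2 * \<theta> * mean \<nu>2"
    define q where "q = p (2 * \<theta> * mean \<nu>1)"
    obtain k1 k2 where k: "k1 > 0" "\<nu>1 = density lborel (\<lambda>x. ennreal (k1 * q x))"
      "k2 > 0" "\<nu>2 = density lborel (\<lambda>x. ennreal (k2 * q x))"
      using dens[of \<nu>1] dens[of \<nu>2] inv unfolding q_def eq by auto
    have one: "ennreal k * (\<integral>\<^sup>+x. ennreal (q x) \<partial>lborel) = 1"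
      if "k > 0" "prob_space (density lborel (\<lambda>x. ennreal (k * q x)))" for k
    proof -
      have "(\<integral>\<^sup>+x. ennreal (k * q x) \<partial>lborel) = 1"
        using prob_space.emeasure_space_1[OF that(2)] by (simp add: emeasure_density q_def)
      moreover have "(\<integral>\<^sup>+x. ennreal (k * q x) \<partial>lborel) = ennreal k * (\<integral>\<^sup>+x. ennreal (q x) \<partial>lborel)"
        using that(1) p_pos by (subst nn_integral_cmult[symmetric]) (auto simp: q_def ennreal_mult less_imp_le)
      ultimately show ?thesis by simp
    qed
    have o1: "ennreal k1 * (\<integral>\<^sup>+x. ennreal (q x) \<partial>lborel) = 1" and o2: "ennreal k2 * (\<integral>\<^sup>+x. ennreal (q x) \<partial>lborel) = 1"
      using one[OF k(1)] one[OF k(3)] ps[of \<nu>1] ps[of \<nu>2] inv k(2,4) by auto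
    have "ennreal k1 = ennreal k1 * (ennreal k2 * (\<integral>\<^sup>+x. ennreal (q x) \<partial>lborel))" using o2 by simp
    also have "\<dots> = ennreal k2 * (ennreal k1 * (\<integral>\<^sup>+x. ennreal (q x) \<partial>lborel))" by (simp only: mult.left_commute)
    also have "\<dots> = ennreal k2" using o1 by simp
    finally have "k1 = k2" using k(1,3) by simp
    then show "\<nu>1 = \<nu>2" using k by simp
  qed
  have sub: "(\<lambda>\<nu>. 2 * \<theta> * mean \<nu>) ` ?S \<subseteq> {\<mu>. laplace h f \<mu> = 0}" using zero by auto
  have "finite ?S" by (rule inj_on_finite[OF inj sub zeros(1)])
  moreover have "card ?S \<le> 2 * n - 1" using card_inj_on_le[OF inj sub zeros(1)] zeros(2) by simp
  ultimately show ?thesis by simp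
qed

end
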